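(* Let $1\to H\to G\xrightarrow{\pi} K\to 1$ be a short exact sequence of Polish groups. If the universal minimal flows $\mathrm{M}(H)$ and $\mathrm{M}(K)$ are metrizable, then so is $\mathrm{M}(G)$. Furthermore, letting $\pi\colon \mathrm{M}(G)\to \mathrm{M}(K)$ be the canonical $G$-map, the fiber $\pi^{-1}(\{y\})$ is a minimal $H$-flow for every $y\in \mathrm{M}(K)$.
   Context: Short exact sequence of Polish groups: $G$ is a Polish group, $H\subseteq G$ is a closed normal subgroup, $K=G/H$ with the quotient topology, and $\pi\colon G\to K$ is the quotient map (a continuous open homomorphism). For a topological group $G$, a $G$-flow is a continuous right action $X\times G\to X$ on a compact Hausdorff space $X$. A $G$-map between $G$-flows is a continuous $G$-equivariant map. A $G$-flow is minimal if every orbit is dense. The universal minimal flow $\mathrm{M}(G)$ is the minimal $G$-flow, unique up to isomorphism, that admits a $G$-map onto every minimal $G$-flow. Every $K$-flow is a $G$-flow via $x\cdot g := x\cdot \pi(g)$; thus $\mathrm{M}(K)$ is a minimal $G$-flow. The canonical map $\pi\colon \mathrm{M}(G)\to\mathrm{M}(K)$ is a $G$-map, obtained as follows: let $\mathrm{S}(G)$ be the greatest ambit (Samuel compactification) of $G$; the homomorphism $\pi\colon G\to K$ extends continuously to $\pi\colon \mathrm{S}(G)\to \mathrm{S}(K)$; if $\mathrm{M}(G)$ is realized as a minimal subflow $M\subseteq \mathrm{S}(G)$, then $\pi[M]\subseteq \mathrm{S}(K)$ is a minimal $K$-flow isomorphic to $\mathrm{M}(K)$, and the canonical map is $\pi|_M$.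 (Any two $G$-maps from $\mathrm{M}(G)$ to a given minimal $G$-flow differ by precomposition with an automorphism of $\mathrm{M}(G)$, so one may equivalently take any $G$-map $\mathrm{M}(G)\to \mathrm{M}(K)$.) Each fiber $\pi^{-1}(\{y\})$ is a closed $H$-invariant set, viewed as an $H$-flow by restricting the $G$-action to $H$. *)

theory Defs
  imports "HOL-Algebra.Coset" "HOL-Analysis.Analysis"
begin

section \<open>Polish groups and quotients\<close>

definition topological_group :: "('g, 'm) monoid_scheme \<Rightarrow> 'g topology \<Rightarrow> bool" where
  "topological_group G T \<longleftrightarrow>
     Group.group G \<and> topspace T = carrier G \<and>
     continuous_map (prod_topology T T) T (\<lambda>(g, h). g \<otimes>\<^bsub>G\<^esub> h) \<and>
     continuous_map T T (\<lambda>g. inv\<^bsub>G\<^esub> g)"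

definition Polish_group :: "('g, 'm) monoid_scheme \<Rightarrow> 'g topology \<Rightarrow> bool" where
  "Polish_group G T \<longleftrightarrow>
     topological_group G T \<and> completely_metrizable_space T \<and> separable_space T"

text \<open>The quotient topology on \<open>G Mod H\<close>; the quotient homomorphism is \<open>\<lambda>g. H #>\<^bsub>G\<^esub> g\<close>.\<close>

definition quotient_group_topology ::
    "('g, 'm) monoid_scheme \<Rightarrow> 'g topology \<Rightarrow> 'g set \<Rightarrow> 'g set topology" where
  "quotient_group_topology G T H =
     topology (\<lambda>U. U \<subseteq> carrier (G Mod H) \<and> openin T {g \<in> carrier G. H #>\<^bsub>G\<^esub> g \<in> U})"

lemma openin_quotient_group_topology:
  assumes "topspace T = carrier G"
  shows "openin (quotient_group_topology G T H) U \<longleftrightarrow>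
           U \<subseteq> carrier (G Mod H) \<and> openin T {g \<in> carrier G. H #>\<^bsub>G\<^esub> g \<in> U}"
proof -
  have "istopology (\<lambda>U. U \<subseteq> carrier (G Mod H) \<and> openin T {g \<in> carrier G. H #>\<^bsub>G\<^esub> g \<in> U})"
    unfolding istopology_def
  proof (intro conjI allI impI; (elim conjE)?)
    fix U V
    assume "openin T {g \<in> carrier G. H #>\<^bsub>G\<^esub> g \<in> U}" "openin T {g \<in> carrier G. H #>\<^bsub>G\<^esub> g \<in> V}"
    then have "openin T ({g \<in> carrier G. H #>\<^bsub>G\<^esub> g \<in> U} \<inter> {g \<in> carrier G. H #>\<^bsub>G\<^esub> g \<in> V})"
      by blast
    also have "{g \<in> carrier G. H #>\<^bsub>G\<^esub> g \<in> U} \<inter> {g \<in> carrier G. H #>\<^bsub>G\<^esub> g \<in> V}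
                 = {g \<in> carrier G. H #>\<^bsub>G\<^esub> g \<in> U \<inter> V}"
      by blast
    finally show "openin T {g \<in> carrier G. H #>\<^bsub>G\<^esub> g \<in> U \<inter> V}" .
  next
    fix \<U>
    assume "\<forall>U\<in>\<U>. U \<subseteq> carrier (G Mod H) \<and> openin T {g \<in> carrier G. H #>\<^bsub>G\<^esub> g \<in> U}"
    then have "openin T (\<Union>U\<in>\<U>. {g \<in> carrier G. H #>\<^bsub>G\<^esub> g \<in> U})"
      by blast
    also have "(\<Union>U\<in>\<U>. {g \<in> carrier G. H #>\<^bsub>G\<^esub> g \<in> U}) = {g \<in> carrier G. H #>\<^bsub>G\<^esub> g \<in> \<Union>\<U>}"
      by blast
    finally show "openin T {g \<in> carrier G. H #>\<^bsub>G\<^esub> g \<in> \<Union>\<U>}" .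
  qed blast+
  then show ?thesis
    by (simp add: quotient_group_topology_def topology_inverse')
qed

lemma topspace_quotient_group_topology:
  assumes "topspace T = carrier G"
  shows "topspace (quotient_group_topology G T H) = carrier (G Mod H)"
proof (rule equalityI)
  show "topspace (quotient_group_topology G T H) \<subseteq> carrier (G Mod H)"
    using assms openin_quotient_group_topology openin_topspace by blast
  have "{g \<in> carrier G. H #>\<^bsub>G\<^esub> g \<in> carrier (G Mod H)} = topspace T"
    using assms by (auto simp: carrier_FactGroup)
  then have "openin (quotient_group_topology G T H) (carrier (G Mod H))"
    by (simp add: openin_quotient_group_topology[OF assms])
  then show "carrier (G Mod H) \<subseteq> topspace (quotient_group_topology G T H)"
    by (rule openin_subset)
qed

lemma quotient_map_quotient_group_topology:
  assumes "topspace T = carrier G"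
  shows "quotient_map T (quotient_group_topology G T H) (\<lambda>g. H #>\<^bsub>G\<^esub> g)"
  using assms
  by (auto simp: quotient_map_def topspace_quotient_group_topology openin_quotient_group_topology
      carrier_FactGroup)

section \<open>Flows\<close>

definition flow ::
    "('g, 'm) monoid_scheme \<Rightarrow> 'g topology \<Rightarrow> 'x topology \<Rightarrow> ('x \<Rightarrow> 'g \<Rightarrow> 'x) \<Rightarrow> bool" where
  "flow G T X act \<longleftrightarrow>
     compact_space X \<and> Hausdorff_space X \<and>
     continuous_map (prod_topology X T) X (\<lambda>(x, g). act x g) \<and>
     (\<forall>x\<in>topspace X. act x \<one>\<^bsub>G\<^esub> = x) \<and>
     (\<forall>x\<in>topspace X. \<forall>g\<in>carrier G. \<forall>h\<in>carrier G. act (act x g) h = act x (g \<otimes>\<^bsub>G\<^esub> h))"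

text \<open>As usual, the empty flow is not regarded as minimal (no nonempty flow maps to it).\<close>

definition minimal_flow ::
    "('g, 'm) monoid_scheme \<Rightarrow> 'g topology \<Rightarrow> 'x topology \<Rightarrow> ('x \<Rightarrow> 'g \<Rightarrow> 'x) \<Rightarrow> bool" where
  "minimal_flow G T X act \<longleftrightarrow>
     flow G T X act \<and> topspace X \<noteq> {} \<and>
     (\<forall>x\<in>topspace X. X closure_of (act x ` carrier G) = topspace X)"

definition G_map ::
    "('g, 'm) monoid_scheme \<Rightarrow> 'x topology \<Rightarrow> ('x \<Rightarrow> 'g \<Rightarrow> 'x) \<Rightarrow>
     'y topology \<Rightarrow> ('y \<Rightarrow> 'g \<Rightarrow> 'y) \<Rightarrow> ('x \<Rightarrow> 'y) \<Rightarrow> bool" where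
  "G_map G X a Y b f \<longleftrightarrow>
     continuous_map X Y f \<and> (\<forall>x\<in>topspace X. \<forall>g\<in>carrier G. f (a x g) = b (f x) g)"

text \<open>
  HOL cannot quantify over the point type of the target flow inside a definition.  The type
  \<open>'g set set\<close> is large enough: every minimal \<open>G\<close>-flow, on whatever type, has an isomorphic copy
  there.  Accordingly, the lemma \<open>universal_minimal_flow_onto\<close> below gives a \<open>G\<close>-map onto
  minimal flows over arbitrary types.
\<close>

definition universal_minimal_flow ::
    "('g, 'm) monoid_scheme \<Rightarrow> 'g topology \<Rightarrow> 'x topology \<Rightarrow> ('x \<Rightarrow> 'g \<Rightarrow> 'x) \<Rightarrow> bool" where
  "universal_minimal_flow G T X a \<longleftrightarrow>
     minimal_flow G T X a \<and>
     (\<forall>(Y :: 'g set set topology) b. minimal_flow G T Y b \<longrightarrow>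
        (\<exists>f. G_map G X a Y b f \<and> f ` topspace X = topspace Y))"

lemma flow_closed:
  assumes "flow G T X a" "topspace T = carrier G" "x \<in> topspace X" "g \<in> carrier G"
  shows "a x g \<in> topspace X"
proof -
  have "(\<lambda>(x, g). a x g) \<in> topspace (prod_topology X T) \<rightarrow> topspace X"
    using assms(1) by (simp add: flow_def continuous_map_def)
  then have "(\<lambda>(x, g). a x g) (x, g) \<in> topspace X"
    by (rule funcset_mem) (use assms in simp)
  then show ?thesis by simp
qed

lemma minimal_flow_embeds:
  fixes X :: "'x topology" and G :: "('g, 'm) monoid_scheme"
  assumes X: "minimal_flow G T X a" and T: "topspace T = carrier G"
  obtains e :: "'x \<Rightarrow> 'g set set" where "inj_on e (topspace X)"
proof -
  from X obtain x0 where x0: "x0 \<in> topspace X"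
    unfolding minimal_flow_def by blast
  have haus: "Hausdorff_space X" and dense: "X closure_of (a x0 ` carrier G) = topspace X"
    using X x0 by (auto simp: minimal_flow_def flow_def)
  define e where "e x = {A. A \<subseteq> carrier G \<and> x \<in> X closure_of (a x0 ` A)}" for x
  have "inj_on e (topspace X)"
  proof (rule inj_onI, rule ccontr)
    fix x y assume xy: "x \<in> topspace X" "y \<in> topspace X" "e x = e y" "x \<noteq> y"
    then obtain U V where UV: "openin X U" "openin X V" "x \<in> U" "y \<in> V" "disjnt U V"
      using haus unfolding Hausdorff_space_def by metis
    define A where "A = {g \<in> carrier G. a x0 g \<in> U}"
    have A: "a x0 ` A = U \<inter> a x0 ` carrier G"
      by (auto simp: A_def)
    have "x \<in> X closure_of (U \<inter> a x0 ` carrier G)"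
    proof -
      have "U \<inter> X closure_of (a x0 ` carrier G) \<subseteq> X closure_of (U \<inter> a x0 ` carrier G)"
        using UV(1) by (rule openin_Int_closure_of_subset)
      then show ?thesis using dense UV(3) xy(1) by auto
    qed
    then have "A \<in> e x"
      by (simp add: e_def A) (simp add: A_def)
    then have "y \<in> X closure_of (a x0 ` A)"
      using xy(3) by (auto simp: e_def)
    then show False
      using UV A unfolding in_closure_of disjnt_def by blast
  qed
  then show thesis by (rule that)
qed

lemma minimal_flow_transfer:
  assumes X: "minimal_flow G T X a" and T: "topspace T = carrier G"
    and f: "homeomorphic_maps X Y f f'"
  shows "minimal_flow G T Y (\<lambda>y g. f (a (f' y) g))"
proof -
  have hf: "homeomorphic_map X Y f"
    using f by (rule homeomorphic_maps_imp_map)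
  have cf: "continuous_map X Y f" and cf': "continuous_map Y X f'"
    and ff': "\<And>x. x \<in> topspace X \<Longrightarrow> f' (f x) = x" and f'f: "\<And>y. y \<in> topspace Y \<Longrightarrow> f (f' y) = y"
    using f by (auto simp: homeomorphic_maps_def)
  have in': "\<And>y. y \<in> topspace Y \<Longrightarrow> f' y \<in> topspace X"
    using cf' by (auto simp: continuous_map_def)
  have flow: "flow G T X a" using X by (simp add: minimal_flow_def)
  note cl = flow_closed[OF flow T]
  have hs: "X homeomorphic_space Y"
    using f unfolding homeomorphic_space_def by blast
  have "continuous_map (prod_topology Y T) X ((\<lambda>(x, g). a x g) \<circ> (\<lambda>(y, g). (f' y, g)))"
  proof (rule continuous_map_compose)
    show "continuous_map (prod_topology Y T) (prod_topology X T) (\<lambda>(y, g). (f' y, g))"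
      using cf' by (simp add: continuous_map_prod_top)
    show "continuous_map (prod_topology X T) X (\<lambda>(x, g). a x g)"
      using flow by (simp add: flow_def)
  qed
  then have "continuous_map (prod_topology Y T) Y
      (f \<circ> ((\<lambda>(x, g). a x g) \<circ> (\<lambda>(y, g). (f' y, g))))"
    using cf by (rule continuous_map_compose)
  then have cont: "continuous_map (prod_topology Y T) Y (\<lambda>(y, g). f (a (f' y) g))"
    by (simp add: comp_def case_prod_unfold)
  have "flow G T Y (\<lambda>y g. f (a (f' y) g))"
    unfolding flow_def
    using flow hs cont f'f ff' in' cl
    by (auto simp: flow_def homeomorphic_compact_space homeomorphic_Hausdorff_space)
  moreover have "topspace Y \<noteq> {}"
    using X hs by (metis homeomorphic_empty_space minimal_flow_def null_topspace_iff_trivial)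
  moreover have "Y closure_of ((\<lambda>g. f (a (f' y) g)) ` carrier G) = topspace Y"
    if y: "y \<in> topspace Y" for y
  proof -
    have "a (f' y) ` carrier G \<subseteq> topspace X"
      using cl in' y by blast
    then have "Y closure_of (f ` (a (f' y) ` carrier G)) = f ` (X closure_of (a (f' y) ` carrier G))"
      using hf by (metis homeomorphic_map_closure_of)
    also have "\<dots> = topspace Y"
      using X in'[OF y] hf by (simp add: minimal_flow_def homeomorphic_imp_surjective_map)
    finally show ?thesis by (simp add: image_image)
  qed
  ultimately show ?thesis
    unfolding minimal_flow_def by blast
qed

theorem universal_minimal_flow_onto:
  fixes Y :: "'y topology"
  assumes M: "universal_minimal_flow G T X a" and Y: "minimal_flow G T Y b"
    and T: "topspace T = carrier G"
  obtains p where "G_map G X a Y b p" "p ` topspace X = topspace Y"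
proof -
  obtain e :: "'y \<Rightarrow> 'a set set" where e: "inj_on e (topspace Y)"
    using minimal_flow_embeds[OF Y T] .
  define e' where "e' = inv_into (topspace Y) e"
  define Z where "Z = pullback_topology (e ` topspace Y) e' Y"
  have e'e: "e' (e y) = y" if "y \<in> topspace Y" for y
    using that e by (simp add: e'_def)
  have Z: "topspace Z = e ` topspace Y"
    by (auto simp: Z_def topspace_pullback_topology e'e)
  have c': "continuous_map Z Y e'"
    unfolding Z_def using continuous_map_pullback[of Y Y id] by simp
  have c: "continuous_map Y Z e"
    unfolding Z_def
  proof (rule continuous_map_pullback')
    show "continuous_map Y Y (e' \<circ> e)"
      by (rule continuous_map_eq[of _ _ id]) (auto simp: e'e)
  qed auto
  have h: "homeomorphic_maps Y Z e e'"
    using c c' Z e'e by (auto simp: homeomorphic_maps_def)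
  obtain f where f: "G_map G X a Z (\<lambda>z g. e (b (e' z) g)) f" "f ` topspace X = topspace Z"
    using M minimal_flow_transfer[OF Y T h] unfolding universal_minimal_flow_def by blast
  have fY: "e' (f x) \<in> topspace Y" if "x \<in> topspace X" for x
    using that f(2) Z e'e by (metis imageE imageI)
  have "flow G T Y b" using Y by (simp add: minimal_flow_def)
  note cl = flow_closed[OF this T]
  have "G_map G X a Y b (e' \<circ> f)"
    using f(1) c' fY cl
    by (auto simp: G_map_def e'e intro: continuous_map_compose)
  moreover have "(e' \<circ> f) ` topspace X = topspace Y"
  proof -
    have "(e' \<circ> f) ` topspace X = e' ` (e ` topspace Y)"
      by (simp only: image_comp[symmetric] f(2) Z)
    also have "\<dots> = (\<lambda>y. y) ` topspace Y"
      unfolding image_image by (rule image_cong) (simp_all add: e'e)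
    finally show ?thesis by simp
  qed
  ultimately show thesis by (rule that)
qed

lemma minimal_flow_of_quotient:
  assumes T: "topspace T = carrier G" and H: "H \<lhd> G"
    and X: "minimal_flow (G Mod H) (quotient_group_topology G T H) X a"
  shows "minimal_flow G T X (\<lambda>x g. a x (H #>\<^bsub>G\<^esub> g))"
proof -
  interpret normal H G by (rule H)
  let ?q = "\<lambda>g. H #>\<^bsub>G\<^esub> g"
  have flow: "flow (G Mod H) (quotient_group_topology G T H) X a"
    using X by (simp add: minimal_flow_def)
  have "continuous_map T (quotient_group_topology G T H) ?q"
    using quotient_map_quotient_group_topology[OF T] by (rule quotient_imp_continuous_map)
  then have "continuous_map (prod_topology X T) (prod_topology X (quotient_group_topology G T H))
      (\<lambda>(x, g). (id x, ?q g))"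
    by (simp only: continuous_map_prod_top) simp
  moreover have "continuous_map (prod_topology X (quotient_group_topology G T H)) X (\<lambda>(x, k). a x k)"
    using flow by (simp add: flow_def)
  ultimately have "continuous_map (prod_topology X T) X ((\<lambda>(x, k). a x k) \<circ> (\<lambda>(x, g). (id x, ?q g)))"
    by (rule continuous_map_compose)
  then have "continuous_map (prod_topology X T) X (\<lambda>(x, g). a x (?q g))"
    by (simp add: comp_def case_prod_unfold)
  moreover have "?q \<one>\<^bsub>G\<^esub> = H"
    using coset_mult_one subset by blast
  ultimately have "flow G T X (\<lambda>x g. a x (?q g))"
    using flow by (auto simp: flow_def carrier_FactGroup rcos_sum)
  moreover have "(\<lambda>g. a x (?q g)) ` carrier G = a x ` carrier (G Mod H)" for x
    by (auto simp: carrier_FactGroup)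
  ultimately show ?thesis
    using X by (simp add: minimal_flow_def)
qed

text \<open>
  The canonical map between the universal minimal flows of \<open>G\<close> and \<open>G Mod H\<close> is unique up to an
  automorphism of the former, so it may be taken to be any \<open>G\<close>-map; one exists.
\<close>

corollary universal_minimal_flow_quotient_map_exists:
  assumes "topological_group G T" "H \<lhd> G"
    and "universal_minimal_flow G T MG actG"
    and "universal_minimal_flow (G Mod H) (quotient_group_topology G T H) MK actK"
  obtains p where "G_map G MG actG MK (\<lambda>y g. actK y (H #>\<^bsub>G\<^esub> g)) p"
    "p ` topspace MG = topspace MK"
proof -
  have T: "topspace T = carrier G"
    using assms(1) by (simp add: topological_group_def)
  have "minimal_flow (G Mod H) (quotient_group_topology G T H) MK actK"
    using assms(4) by (simp add: universal_minimal_flow_def)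
  then have "minimal_flow G T MK (\<lambda>y g. actK y (H #>\<^bsub>G\<^esub> g))"
    by (rule minimal_flow_of_quotient[OF T assms(2)])
  from universal_minimal_flow_onto[OF assms(3) this T] show thesis
    using that .
qed

end

theory Submission
  imports Defs
begin

text \<open>
  For a metrizable universal minimal flow \<open>M\<close> of a group, distances between nearby points of \<open>M\<close>
  are controlled by small group elements: otherwise some sequence converges to a point \<open>p\<close>, while a
  Lipschitz function on the group, transported to \<open>M\<close> by universality and coalescence, separates
  its even terms from its odd terms (just as \<open>\<beta>\<nat>\<close> has no nontrivial convergent sequences).

  Hence the equivariant maps from \<open>M(H)\<close> to a flow are equicontinuous, so the points of \<open>M(G)\<close> in
  minimal \<open>H\<close>-subflows form a closed set. It is \<open>G\<close>-invariant, hence everything, and \<open>M(G)\<close> is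
  partitioned into minimal \<open>H\<close>-flows by a closed relation. The quotient is a minimal \<open>G/H\<close>-flow over
  \<open>M(G/H)\<close>, so it is \<open>M(G/H)\<close>, and the fibres are minimal.

  Finally, total boundedness for the metric defined by the Lipschitz functions on a flow passes
  from \<open>M(G/H)\<close> and from the fibres, which are images of \<open>M(H)\<close>, to \<open>M(G)\<close>. As Lipschitz functions
  separate the points of \<open>M(G)\<close>, finite nets yield countably many closed sets that separate
  points, whence metrizability.
\<close>

section \<open>Flows\<close>

text \<open>The obstacle is that M(G) is at first only a compact Hausdorff space: neither sequences
  nor a metric are available on it. Distances are therefore replaced by the relation
  \<open>near\<close>, which mentions only open sets and lengths of group elements. It is useful
  because equivariant maps preserve it with the same bound, Lipschitz functions differ by at most
  that bound at near points, and in a metrizable universal minimal flow every point has a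
  neighbourhood of points near it. One length function is chosen on G. Its restriction to H and its
  infimum over the cosets of H are length functions for H and G/H, so estimates made in the fibres
  and in the base can be added. Lipschitz functions have to be carried from the group to a flow
  without a Samuel compactification. The device is the flow of pairs of a point and a Lipschitz
  function on the group. A section of its projection attaches such a function to every point
  continuously and equivariantly. Sections exist by coalescence, which is proved with the Ellis
  semigroup.\<close>

lemma minimal_closed_set_exists:
  assumes X: "compact_space X" and A: "\<And>C. C \<in> \<A> \<Longrightarrow> closedin X C \<and> C \<noteq> {}"
    and Int: "\<And>\<C>. \<C> \<noteq> {} \<Longrightarrow> \<C> \<subseteq> \<A> \<Longrightarrow> \<Inter>\<C> \<noteq> {} \<Longrightarrow> \<Inter>\<C> \<in> \<A>"
    and C0: "C0 \<in> \<A>"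
  obtains C where "C \<in> \<A>" "C \<subseteq> C0" "\<And>D. D \<in> \<A> \<Longrightarrow> D \<subseteq> C \<Longrightarrow> D = C"
proof -
  \<comment> \<open>Zorn's lemma is applied to the complements, where chains are bounded by unions.
    The family \<open>\<A>\<close> is abstract because it serves for closed invariant sets and for
    closed subsemigroups alike.\<close>
  define \<B> where "\<B> = {topspace X - C | C. C \<in> \<A> \<and> C \<subseteq> C0}"
  have sub: "C \<subseteq> topspace X" if "C \<in> \<A>" for C
    using A[OF that] closedin_subset by blast
  have "\<exists>M\<in>\<B>. \<forall>Y\<in>\<B>. M \<subseteq> Y \<longrightarrow> Y = M"
  proof (rule subset_Zorn_nonempty)
    show "\<B> \<noteq> {}" using C0 by (auto simp: \<B>_def)
  next
    fix \<D> assume ne: "\<D> \<noteq> {}" and ch: "subset.chain \<B> \<D>"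
    then have D\<B>: "\<D> \<subseteq> \<B>" by (simp add: subset_chain_def)
    define \<C> where "\<C> = (\<lambda>U. topspace X - U) ` \<D>"
    have C: "C \<in> \<A> \<and> C \<subseteq> C0 \<and> topspace X - C \<in> \<D>" if C\<C>: "C \<in> \<C>" for C
    proof -
      obtain U where U: "U \<in> \<D>" "C = topspace X - U"
        using C\<C> by (auto simp: \<C>_def)
      obtain C' where C': "C' \<in> \<A>" "C' \<subseteq> C0" "U = topspace X - C'"
        using U(1) D\<B> by (auto simp: \<B>_def)
      then have "C = C'" "topspace X - C = U" using U sub[OF C'(1)] by auto
      then show ?thesis using U C' by simp
    qed
    \<comment> \<open>A finite nonempty subchain contains its own intersection, namely its smallest
      member, and that is nonempty.\<close>
    have fin: "\<Inter>\<F> \<noteq> {}" if \<F>: "finite \<F>" "\<F> \<subseteq> \<C>" for \<F>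
    proof (cases "\<F> = {}")
      case False
      have \<F>\<D>: "(\<lambda>C. topspace X - C) ` \<F> \<subseteq> \<D>" using C \<F>(2) by auto
      have "S \<subseteq> S' \<or> S' \<subseteq> S" if "S \<in> \<D>" "S' \<in> \<D>" for S S'
        using ch that by (simp add: subset_chain_def)
      then have "subset.chain \<B> ((\<lambda>C. topspace X - C) ` \<F>)"
        using \<F>\<D> D\<B> unfolding subset_chain_def by (metis subset_iff)
      then have "\<Union>((\<lambda>C. topspace X - C) ` \<F>) \<in> (\<lambda>C. topspace X - C) ` \<F>"
        using False \<F>(1) by (intro Union_in_chain) auto
      then obtain C where "C \<in> \<F>" and eq: "\<Union>((\<lambda>C. topspace X - C) ` \<F>) = topspace X - C"
        by auto
      have FX: "C \<subseteq> topspace X" "C \<noteq> {}" if "C \<in> \<F>" for C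
        using that \<F>(2) C[of C] sub[of C] A[of C] by auto
      have "C \<subseteq> topspace X" using FX(1)[OF \<open>C \<in> \<F>\<close>] .
      have "\<Inter>\<F> = topspace X - \<Union>((\<lambda>C. topspace X - C) ` \<F>)"
        using \<open>C \<in> \<F>\<close> \<open>C \<subseteq> topspace X\<close> by auto
      then have "\<Inter>\<F> = C"
        using eq \<open>C \<subseteq> topspace X\<close> double_diff[of C "topspace X" "topspace X"] by simp
      then show ?thesis using FX \<open>C \<in> \<F>\<close> by simp
    qed auto
    have ne': "\<C> \<noteq> {}" using ne by (simp add: \<C>_def)
    have C\<A>: "\<C> \<subseteq> \<A>" and CC0: "\<And>C. C \<in> \<C> \<Longrightarrow> C \<subseteq> C0" using C by auto
    have "\<forall>C\<in>\<C>. closedin X C" using A C\<A> by auto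
    then have "\<Inter>\<C> \<noteq> {}"
      using X fin unfolding compact_space_fip by simp
    then have "\<Inter>\<C> \<in> \<A>" using Int[OF ne'] C\<A> by simp
    moreover have "\<Inter>\<C> \<subseteq> C0" using CC0 ne' by blast
    moreover have "\<Union>\<D> = topspace X - \<Inter>\<C>"
    proof -
      have "U \<subseteq> topspace X" if "U \<in> \<D>" for U using that D\<B> by (auto simp: \<B>_def)
      then show ?thesis using ne by (auto simp: \<C>_def)
    qed
    ultimately show "\<Union>\<D> \<in> \<B>" unfolding \<B>_def by blast
  qed
  then obtain C where C: "C \<in> \<A>" "C \<subseteq> C0"
      and max: "\<And>Y. Y \<in> \<B> \<Longrightarrow> topspace X - C \<subseteq> Y \<Longrightarrow> Y = topspace X - C"
    by (auto simp: \<B>_def)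
  have "D = C" if "D \<in> \<A>" "D \<subseteq> C" for D
  proof -
    have "topspace X - D \<in> \<B>" using that C by (auto simp: \<B>_def)
    then have "topspace X - D = topspace X - C" using max that by blast
    then show ?thesis using sub that C by blast
  qed
  then show thesis using that C by blast
qed

section \<open>Subflows, minimal subflows and equivariant maps\<close>

lemma subflow:
  assumes X: "flow G T X a" and C: "closedin X C"
    and inv: "\<And>x g. x \<in> C \<Longrightarrow> g \<in> carrier G \<Longrightarrow> a x g \<in> C" and T: "topspace T = carrier G"
  shows "flow G T (subtopology X C) a"
proof -
  have CX: "C \<subseteq> topspace X" using C closedin_subset by blast
  have "continuous_map (prod_topology (subtopology X C) T) X (\<lambda>(x, g). a x g)"
    using X unfolding flow_def
    by (metis continuous_map_from_subtopology prod_topology_subtopology(1))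
  then have "continuous_map (prod_topology (subtopology X C) T) (subtopology X C) (\<lambda>(x, g). a x g)"
    by (rule continuous_map_into_subtopology) (use inv T in auto)
  then show ?thesis
    using X C CX unfolding flow_def
    by (auto simp: Hausdorff_space_subtopology closedin_compact_space compact_space_subtopology)
qed

lemma flow_act_continuous:
  assumes X: "flow G T X a" and T: "topspace T = carrier G" and g: "g \<in> carrier G"
  shows "continuous_map X X (\<lambda>x. a x g)"
proof -
  have "continuous_map X (prod_topology X T) (\<lambda>x. (x, g))"
    using g T by (simp add: continuous_map_pairedI)
  moreover have "continuous_map (prod_topology X T) X (\<lambda>(x, g). a x g)"
    using X by (simp add: flow_def)
  ultimately have "continuous_map X X ((\<lambda>(x, g). a x g) \<circ> (\<lambda>x. (x, g)))"
    by (rule continuous_map_compose)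
  then show ?thesis by (simp add: comp_def)
qed

lemma flow_invert:
  assumes X: "flow G T X a" and G: "Group.group G" and x: "x \<in> topspace X" and g: "g \<in> carrier G"
  shows "a (a x g) (inv\<^bsub>G\<^esub> g) = x" "a (a x (inv\<^bsub>G\<^esub> g)) g = x"
  using assms by (auto simp: flow_def group.inv_closed group.r_inv group.l_inv)

lemma orbit_closure_invariant:
  assumes X: "flow G T X a" and T: "topspace T = carrier G" and G: "Group.group G"
    and x: "x \<in> topspace X" and y: "y \<in> X closure_of (a x ` carrier G)" and g: "g \<in> carrier G"
  shows "a y g \<in> X closure_of (a x ` carrier G)"
proof -
  have "(\<lambda>x. a x g) ` (X closure_of (a x ` carrier G)) \<subseteq> X closure_of ((\<lambda>x. a x g) ` (a x ` carrier G))"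
    by (rule continuous_map_image_closure_subset[OF flow_act_continuous[OF X T g]])
  moreover have "(\<lambda>x. a x g) ` (a x ` carrier G) \<subseteq> a x ` carrier G"
    using X x g G unfolding flow_def by (auto simp: group.is_monoid monoid.m_closed)
  ultimately show ?thesis using y
    by (meson closure_of_mono image_subset_iff in_mono)
qed

text \<open>In a minimal closed invariant set each orbit closure is again closed, invariant and
  nonempty, hence everything. The bound \<open>C0\<close> matters when a minimal subflow is sought
  inside a translate of a given one.\<close>

lemma minimal_subflow_exists:
  assumes X: "flow G T X a" and T: "topspace T = carrier G" and G: "Group.group G"
    and C0: "closedin X C0" "C0 \<noteq> {}" "\<And>x g. x \<in> C0 \<Longrightarrow> g \<in> carrier G \<Longrightarrow> a x g \<in> C0"
  obtains C where "closedin X C" "C \<subseteq> C0" "minimal_flow G T (subtopology X C) a"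
    "\<And>x g. x \<in> C \<Longrightarrow> g \<in> carrier G \<Longrightarrow> a x g \<in> C"
proof -
  define \<A> where "\<A> = {C. closedin X C \<and> C \<noteq> {} \<and> (\<forall>x\<in>C. \<forall>g\<in>carrier G. a x g \<in> C)}"
  obtain C where C: "C \<in> \<A>" "C \<subseteq> C0" and min: "\<And>D. D \<in> \<A> \<Longrightarrow> D \<subseteq> C \<Longrightarrow> D = C"
  proof (rule minimal_closed_set_exists[of X \<A> C0])
    show "compact_space X" using X by (simp add: flow_def)
    show "\<Inter>\<C> \<in> \<A>" if "\<C> \<noteq> {}" "\<C> \<subseteq> \<A>" "\<Inter>\<C> \<noteq> {}" for \<C>
      using that by (auto simp: \<A>_def intro!: closedin_Inter)
  qed (use C0 in \<open>auto simp: \<A>_def\<close>)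
  then have inv: "\<And>x g. x \<in> C \<Longrightarrow> g \<in> carrier G \<Longrightarrow> a x g \<in> C" and cl: "closedin X C" and ne: "C \<noteq> {}"
    by (auto simp: \<A>_def)
  have CX: "C \<subseteq> topspace X" using cl closedin_subset by blast
  have "X closure_of (a x ` carrier G) = C" if x: "x \<in> C" for x
  proof (rule min)
    have "a x ` carrier G \<subseteq> C" using inv x by blast
    then show "X closure_of (a x ` carrier G) \<subseteq> C" using cl closure_of_minimal by blast
    have "a x ` carrier G \<noteq> {}" using G by (auto intro: group.is_monoid monoid.one_closed)
    moreover have "a x ` carrier G \<subseteq> topspace X" using inv x CX by blast
    ultimately have "X closure_of (a x ` carrier G) \<noteq> {}" 
      by (simp add: closure_of_eq_empty)
    then show "X closure_of (a x ` carrier G) \<in> \<A>"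
      using orbit_closure_invariant[OF X T G] x CX by (auto simp: \<A>_def)
  qed
  then have "minimal_flow G T (subtopology X C) a"
    using subflow[OF X cl inv T] ne CX inv
    by (auto simp: minimal_flow_def closure_of_subtopology inf.absorb2 image_subset_iff)
  then show thesis using that cl C(2) inv by blast
qed

lemma minimal_flow_subset:
  assumes X: "minimal_flow G T X a" and C: "closedin X C" "x \<in> C"
    and inv: "\<And>g. g \<in> carrier G \<Longrightarrow> a x g \<in> C"
  shows "C = topspace X"
proof
  show "C \<subseteq> topspace X" using C closedin_subset by blast
  have "X closure_of (a x ` carrier G) \<subseteq> C" using C inv by (intro closure_of_minimal) auto
  then show "topspace X \<subseteq> C"
    using X C closedin_subset unfolding minimal_flow_def by blast
qed

lemma G_map_onto_minimal:
  assumes X: "flow G T X a" and Y: "minimal_flow G T Y b" and f: "G_map G X a Y b f"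
    and ne: "topspace X \<noteq> {}" and T: "topspace T = carrier G"
  shows "f ` topspace X = topspace Y"
proof -
  have cf: "continuous_map X Y f" using f by (simp add: G_map_def)
  obtain x where x: "x \<in> topspace X" using ne by blast
  show ?thesis
  proof (rule minimal_flow_subset[OF Y])
    have "compactin Y (f ` topspace X)"
      using image_compactin[OF _ cf] X by (simp add: flow_def compact_space_def)
    then show "closedin Y (f ` topspace X)"
      using Y by (simp add: compactin_imp_closedin minimal_flow_def flow_def)
    show "f x \<in> f ` topspace X" using x by blast
    show "b (f x) g \<in> f ` topspace X" if "g \<in> carrier G" for g
      using f x that flow_closed[OF X T x that] unfolding G_map_def by (metis imageI)
  qed
qed

lemma G_map_compose:
  assumes "G_map G X a Y b f" "G_map G Y b Z c h"
  shows "G_map G X a Z c (h \<circ> f)"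
proof -
  have "continuous_map X Z (h \<circ> f)"
    using assms continuous_map_compose[of X Y f Z h] by (simp add: G_map_def)
  then show ?thesis
    using assms unfolding G_map_def by (auto simp: continuous_map_def Pi_iff)
qed

section \<open>Products of flows\<close>

text \<open>Used with the points of a flow as index set: there the orbit closure of the identity map
  is the Ellis semigroup.\<close>

lemma product_flow:
  assumes X: "flow G T X a" and T: "topspace T = carrier G"
  shows "flow G T (product_topology (\<lambda>_. X) I) (\<lambda>\<phi> g. \<lambda>i\<in>I. a (\<phi> i) g)"
proof -
  let ?P = "product_topology (\<lambda>_. X) I"
  have cl: "a x g \<in> topspace X" if "x \<in> topspace X" "g \<in> carrier G" for x g
    using flow_closed[OF X T that] .
  have "continuous_map (prod_topology ?P T) ?P (\<lambda>z. \<lambda>i\<in>I. a (fst z i) (snd z))"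
    unfolding continuous_map_componentwise
  proof (intro conjI ballI)
    fix k assume k: "k \<in> I"
    have "continuous_map (prod_topology ?P T) X ((\<lambda>\<phi>. \<phi> k) \<circ> fst)"
      using continuous_map_product_projection[OF k] continuous_map_fst by (rule continuous_map_compose[rotated])
    then have "continuous_map (prod_topology ?P T) (prod_topology X T) (\<lambda>z. (fst z k, snd z))"
      by (simp add: continuous_map_pairedI continuous_map_snd comp_def)
    moreover have "continuous_map (prod_topology X T) X (\<lambda>(x, g). a x g)"
      using X by (simp add: flow_def)
    ultimately have "continuous_map (prod_topology ?P T) X ((\<lambda>(x, g). a x g) \<circ> (\<lambda>z. (fst z k, snd z)))"
      by (rule continuous_map_compose)
    then show "continuous_map (prod_topology ?P T) X (\<lambda>z. (\<lambda>i\<in>I. a (fst z i) (snd z)) k)"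
      using k by (simp add: comp_def)
  qed auto
  then show ?thesis
    using X cl unfolding flow_def
    by (auto simp: compact_space_product_topology Hausdorff_space_product_topology case_prod_unfold
        PiE_iff extensional_def fun_eq_iff restrict_def)
qed

lemma prod_flow:
  assumes X: "flow G T X a" and Y: "flow G T Y b" and T: "topspace T = carrier G"
  shows "flow G T (prod_topology X Y) (\<lambda>z g. (a (fst z) g, b (snd z) g))"
proof -
  let ?Z = "prod_topology (prod_topology X Y) T"
  have p: "continuous_map ?Z (prod_topology X T) (\<lambda>z. (fst (fst z), snd z))"
    "continuous_map ?Z (prod_topology Y T) (\<lambda>z. (snd (fst z), snd z))"
    by (intro continuous_map_pairedI continuous_map_snd
        continuous_map_compose[OF continuous_map_fst continuous_map_fst, unfolded comp_def]
        continuous_map_compose[OF continuous_map_fst continuous_map_snd, unfolded comp_def])+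
  have q: "continuous_map (prod_topology X T) X (\<lambda>z. a (fst z) (snd z))"
    "continuous_map (prod_topology Y T) Y (\<lambda>z. b (fst z) (snd z))"
    using X Y by (simp_all add: flow_def case_prod_unfold)
  have "continuous_map ?Z (prod_topology X Y)
     (\<lambda>z. (a (fst (fst z)) (snd z), b (snd (fst z)) (snd z)))"
    using continuous_map_compose[OF p(1) q(1)] continuous_map_compose[OF p(2) q(2)]
    by (intro continuous_map_pairedI) (simp_all add: comp_def)
  then show ?thesis
    using X Y unfolding flow_def
    by (auto simp: compact_space_prod_topology Hausdorff_space_prod_topology case_prod_unfold)
qed

section \<open>Length functions\<close>

text \<open>The topology is the one of the left-invariant pseudometric \<open>\<rho> (inv g \<otimes> h)\<close>; condition
  \<open>length_conj\<close> amounts to continuity of right translations.\<close>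

locale length_group = group G for G (structure) +
  fixes T :: "'a topology" and \<rho> :: "'a \<Rightarrow> real"
  assumes topspace_eq: "topspace T = carrier G"
    and length_one: "\<rho> \<one> = 0"
    and length_inv: "g \<in> carrier G \<Longrightarrow> \<rho> (inv g) = \<rho> g"
    and length_mult: "g \<in> carrier G \<Longrightarrow> h \<in> carrier G \<Longrightarrow> \<rho> (g \<otimes> h) \<le> \<rho> g + \<rho> h"
    and length_conj: "h \<in> carrier G \<Longrightarrow> 0 < \<epsilon> \<Longrightarrow>
      \<exists>\<delta>>0. \<forall>u\<in>carrier G. \<rho> u < \<delta> \<longrightarrow> \<rho> (inv h \<otimes> u \<otimes> h) < \<epsilon>"
    and openin_iff: "openin T W \<longleftrightarrow>
      W \<subseteq> carrier G \<and> (\<forall>g\<in>W. \<exists>r>0. \<forall>u\<in>carrier G. \<rho> u < r \<longrightarrow> g \<otimes> u \<in> W)"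
begin

lemma length_nonneg: "g \<in> carrier G \<Longrightarrow> 0 \<le> \<rho> g"
  using length_mult[of g "inv g"] length_inv[of g] length_one by simp

lemma openin_length_ball_at:
  assumes g: "g \<in> carrier G"
  shows "openin T {h \<in> carrier G. \<rho> (inv g \<otimes> h) < r}"
  unfolding openin_iff
proof (intro conjI ballI)
  fix h assume "h \<in> {h \<in> carrier G. \<rho> (inv g \<otimes> h) < r}"
  then show "\<exists>r'>0. \<forall>u\<in>carrier G. \<rho> u < r' \<longrightarrow> h \<otimes> u \<in> {h \<in> carrier G. \<rho> (inv g \<otimes> h) < r}"
    using length_mult[of "inv g \<otimes> h"] g
    by (intro exI[of _ "r - \<rho> (inv g \<otimes> h)"]) (force simp: m_assoc)
qed auto

end

section \<open>Lengths from neighbourhood chains (Birkhoff-Kakutani)\<close>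

text \<open>\<open>x\<close> is the entry at which the partial sums cross half the total, so neither
  side weighs more than half. The split into three pieces matches the threefold products in the
  neighbourhood chain.\<close>

lemma list_split_half:
  fixes w :: "'b \<Rightarrow> real"
  assumes pos: "\<And>x. 0 \<le> w x" and s: "sum_list (map w l) = s" "0 < s"
  obtains a x b where "l = a @ x # b" "sum_list (map w a) \<le> s / 2" "sum_list (map w b) \<le> s / 2"
proof -
  \<comment> \<open>With an arbitrary threshold \<open>c\<close> the induction can hand the
    remainder \<open>c - w y\<close> to the tail.\<close>
  have "\<exists>a x b. l = a @ x # b \<and> sum_list (map w a) \<le> c \<and> sum_list (map w b) \<le> sum_list (map w l) - c"
    if "0 \<le> c" "c < sum_list (map w l)" for c
    using that
  proof (induction l arbitrary: c)
    case (Cons y l)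
    show ?case
    proof (cases "w y \<le> c \<and> c - w y < sum_list (map w l)")
      case True
      then obtain a x b where "l = a @ x # b" "sum_list (map w a) \<le> c - w y"
        "sum_list (map w b) \<le> sum_list (map w l) - (c - w y)"
        using Cons.IH[of "c - w y"] by auto
      then have "y # l = (y # a) @ x # b" "sum_list (map w (y # a)) \<le> c"
        "sum_list (map w b) \<le> sum_list (map w (y # l)) - c" by auto
      then show ?thesis by blast
    next
      case False
      then have "sum_list (map w l) \<le> sum_list (map w (y # l)) - c"
        using Cons.prems by auto
      then show ?thesis using Cons.prems by (intro exI[of _ "[]"]) auto
    qed
  qed auto
  from this[of "s / 2"] s that show thesis by auto
qed

text \<open>Below, the length of \<open>g\<close> is the infimum of the sums of \<open>(1/2) ^ n\<close> over the factorisations of \<open>g\<close>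
  into elements of the \<open>U n\<close>; this lemma bounds it from below.\<close>

lemma (in group) weighted_product_mem:
  fixes U :: "nat \<Rightarrow> 'a set"
  assumes U: "\<And>n. U n \<subseteq> carrier G" "\<And>n. \<one> \<in> U n"
    and U3: "\<And>n x y z. x \<in> U (Suc n) \<Longrightarrow> y \<in> U (Suc n) \<Longrightarrow> z \<in> U (Suc n) \<Longrightarrow> x \<otimes> (y \<otimes> z) \<in> U n"
    and l: "\<forall>(n, g) \<in> set l. g \<in> U n" "(\<Sum>(n, g)\<leftarrow>l. (1/2::real) ^ n) < (1/2) ^ k"
  shows "foldr (\<lambda>(n, g) h. g \<otimes> h) l \<one> \<in> U k"
proof -
  let ?w = "\<lambda>(n::nat, g::'a). (1/2::real) ^ n" and ?P = "\<lambda>l. foldr (\<lambda>(n::nat, g) h. g \<otimes> h) l \<one>"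
  have P: "?P l \<in> carrier G" if "\<forall>(n, g) \<in> set l. g \<in> U n" for l
    using that U by (induction l) (auto intro!: m_closed)
  have app: "?P (a @ b) = ?P a \<otimes> ?P b"
    if "\<forall>(n, g) \<in> set a. g \<in> U n" "\<forall>(n, g) \<in> set b. g \<in> U n" for a b
    using that(1)
  proof (induction a)
    case (Cons y a)
    then have "?P a \<in> carrier G" "snd y \<in> carrier G" using P[of a] by (auto dest: subsetD[OF U(1)])
    then show ?case using Cons P[OF that(2)] by (auto simp: m_assoc split: prod.splits)
  qed (use P[OF that(2)] in auto)
  show ?thesis using l
  proof (induction "length l" arbitrary: l k rule: less_induct)
    case less
    show ?case
    proof (cases "l = []")
      case False
      have pos: "0 \<le> ?w x" for x by (auto split: prod.splits)
      obtain y l' where "l = y # l'" using False by (cases l) auto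
      moreover have "0 \<le> sum_list (map ?w l')" by (rule sum_list_nonneg) (auto split: prod.splits)
      moreover have "0 < ?w y" by (auto split: prod.splits)
      ultimately have "0 < sum_list (map ?w l)" by simp
      then obtain a x b where s: "l = a @ x # b" and
        le: "sum_list (map ?w a) \<le> sum_list (map ?w l) / 2" "sum_list (map ?w b) \<le> sum_list (map ?w l) / 2"
        using list_split_half[of ?w l, OF pos refl] by blast
      obtain n g where x: "x = (n, g)" by force
      have mem: "\<forall>(n, g) \<in> set a. g \<in> U n" "\<forall>(n, g) \<in> set b. g \<in> U n" "g \<in> U n"
        using less.prems(1) s x by auto
      have na: "0 \<le> sum_list (map ?w a)" "0 \<le> sum_list (map ?w b)"
        by (auto intro!: sum_list_nonneg)
      \<comment> \<open>The middle factor alone weighs less than the whole, so its index exceeds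
        \<open>k\<close>. The outer pieces weigh less than half of \<open>(1/2) ^ k\<close>, so the
        induction hypothesis puts them into \<open>U (Suc k)\<close> as well.\<close>
      have "(1/2::real) ^ n < (1/2) ^ k"
        using less.prems(2) na
        unfolding s x map_append sum_list.append list.map sum_list.Cons case_prod_conv by linarith
      then have "k < n" by (simp add: power_strict_decreasing_iff)
      have mono: "U n \<subseteq> U m" if "m \<le> n" for m n
        using that
      proof (induction n rule: dec_induct)
        case (step n)
        have "U (Suc n) \<subseteq> U n" using U3[of _ n \<one> \<one>] U by (auto simp: subset_iff)
        then show ?case using step by blast
      qed auto
      have "g \<in> U (Suc k)" using mono[of "Suc k" n] \<open>k < n\<close> mem by auto
      moreover have "?P a \<in> U (Suc k)" "?P b \<in> U (Suc k)"
        using less.hyps[of a "Suc k"] less.hyps[of b "Suc k"] mem le less.prems(2) by (auto simp: s)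
      ultimately have "?P a \<otimes> (g \<otimes> ?P b) \<in> U k" by (intro U3)
      then show ?thesis using app[of a "x # b"] mem by (simp add: s x)
    qed (use U in auto)
  qed
qed

lemma topological_group_nhds_chain:
  assumes TG: "topological_group G T" and fc: "first_countable T"
  obtains U :: "nat \<Rightarrow> 'g set" where "\<And>n. openin T (U n)" "\<And>n. \<one>\<^bsub>G\<^esub> \<in> U n"
    "\<And>n x y z. x \<in> U (Suc n) \<Longrightarrow> y \<in> U (Suc n) \<Longrightarrow> z \<in> U (Suc n) \<Longrightarrow> x \<otimes>\<^bsub>G\<^esub> (y \<otimes>\<^bsub>G\<^esub> z) \<in> U n"
    "\<And>V. openin T V \<Longrightarrow> \<one>\<^bsub>G\<^esub> \<in> V \<Longrightarrow> \<exists>n. U n \<subseteq> V" "U 0 = carrier G"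
proof -
  interpret group G using TG by (simp add: topological_group_def)
  have T: "topspace T = carrier G" using TG by (simp add: topological_group_def)
  have mult: "\<exists>W. openin T W \<and> \<one>\<^bsub>G\<^esub> \<in> W \<and> (\<forall>x\<in>W. \<forall>y\<in>W. x \<otimes>\<^bsub>G\<^esub> y \<in> V)"
    if V: "openin T V" "\<one>\<^bsub>G\<^esub> \<in> V" for V
  proof -
    have "openin (prod_topology T T) {z \<in> topspace (prod_topology T T). (\<lambda>(g, h). g \<otimes>\<^bsub>G\<^esub> h) z \<in> V}"
      using TG V(1) unfolding topological_group_def continuous_map_def by blast
    moreover have "(\<one>\<^bsub>G\<^esub>, \<one>\<^bsub>G\<^esub>) \<in> {z \<in> topspace (prod_topology T T). (\<lambda>(g, h). g \<otimes>\<^bsub>G\<^esub> h) z \<in> V}"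
      using V T by simp
    ultimately obtain A B where AB: "openin T A" "openin T B" "\<one>\<^bsub>G\<^esub> \<in> A" "\<one>\<^bsub>G\<^esub> \<in> B"
      "A \<times> B \<subseteq> {z \<in> topspace (prod_topology T T). (\<lambda>(g, h). g \<otimes>\<^bsub>G\<^esub> h) z \<in> V}"
      unfolding openin_prod_topology_alt by meson
    then show ?thesis by (intro exI[of _ "A \<inter> B"]) auto
  qed
  obtain \<B> where \<B>: "countable \<B>" "\<And>V. V \<in> \<B> \<Longrightarrow> openin T V"
      "\<And>V. openin T V \<Longrightarrow> \<one>\<^bsub>G\<^esub> \<in> V \<Longrightarrow> \<exists>B\<in>\<B>. \<one>\<^bsub>G\<^esub> \<in> B \<and> B \<subseteq> V"
    using fc T unfolding first_countable_def by (metis one_closed)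
  let ?\<C> = "{B \<in> \<B>. \<one>\<^bsub>G\<^esub> \<in> B}"
  have "?\<C> \<noteq> {}" using \<B>(3)[of "carrier G"] T by (metis (no_types, lifting) empty_Collect_eq one_closed openin_topspace)
  moreover have "countable ?\<C>" using \<B>(1) by (rule countable_subset[rotated]) auto
  ultimately have B': "range (from_nat_into ?\<C>) = ?\<C>" by (rule range_from_nat_into)
  define B where "B = from_nat_into ?\<C>"
  have B: "range B = ?\<C>" unfolding B_def by (rule B')
  have "\<exists>U. \<forall>n. (openin T (U n) \<and> \<one>\<^bsub>G\<^esub> \<in> U n \<and> (n = 0 \<longrightarrow> U n = carrier G)) \<and>
     (U (Suc n) \<subseteq> B n \<and> (\<forall>x\<in>U (Suc n). \<forall>y\<in>U (Suc n). \<forall>z\<in>U (Suc n). x \<otimes>\<^bsub>G\<^esub> (y \<otimes>\<^bsub>G\<^esub> z) \<in> U n))"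
  proof (rule dependent_nat_choice)
    show "\<exists>x. openin T x \<and> \<one>\<^bsub>G\<^esub> \<in> x \<and> ((0::nat) = 0 \<longrightarrow> x = carrier G)"
      using T by (metis one_closed openin_topspace)
  next
    fix V and n :: nat assume V: "openin T V \<and> \<one>\<^bsub>G\<^esub> \<in> V \<and> (n = 0 \<longrightarrow> V = carrier G)"
    \<comment> \<open>Continuity of multiplication is used twice: in \<open>x(yz)\<close> the
      product \<open>yz\<close> lands in \<open>W1\<close>, and \<open>x\<close> times it in
      \<open>V\<close>. Intersecting with \<open>B n\<close> makes the chain a neighbourhood
      base.\<close>
    obtain W1 where W1: "openin T W1" "\<one>\<^bsub>G\<^esub> \<in> W1" "\<And>x y. x \<in> W1 \<Longrightarrow> y \<in> W1 \<Longrightarrow> x \<otimes>\<^bsub>G\<^esub> y \<in> V"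
      using mult[of V] V by blast
    obtain W2 where W2: "openin T W2" "\<one>\<^bsub>G\<^esub> \<in> W2" "\<And>x y. x \<in> W2 \<Longrightarrow> y \<in> W2 \<Longrightarrow> x \<otimes>\<^bsub>G\<^esub> y \<in> W1"
      using mult[of W1] W1 by blast
    have "B n \<in> ?\<C>" using B by blast
    then have "openin T (B n)" "\<one>\<^bsub>G\<^esub> \<in> B n" using \<B> by auto
    then show "\<exists>W. (openin T W \<and> \<one>\<^bsub>G\<^esub> \<in> W \<and> (Suc n = 0 \<longrightarrow> W = carrier G)) \<and>
         W \<subseteq> B n \<and> (\<forall>x\<in>W. \<forall>y\<in>W. \<forall>z\<in>W. x \<otimes>\<^bsub>G\<^esub> (y \<otimes>\<^bsub>G\<^esub> z) \<in> V)"
      using W1 W2 by (intro exI[of _ "W1 \<inter> W2 \<inter> B n"]) auto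
  qed
  then obtain U where U: "\<And>n. openin T (U n)" "\<And>n. \<one>\<^bsub>G\<^esub> \<in> U n" "U 0 = carrier G" "\<And>n. U (Suc n) \<subseteq> B n"
     "\<And>n x y z. x \<in> U (Suc n) \<Longrightarrow> y \<in> U (Suc n) \<Longrightarrow> z \<in> U (Suc n) \<Longrightarrow> x \<otimes>\<^bsub>G\<^esub> (y \<otimes>\<^bsub>G\<^esub> z) \<in> U n"
    by metis
  have "\<exists>n. U n \<subseteq> V" if V: "openin T V" "\<one>\<^bsub>G\<^esub> \<in> V" for V
  proof -
    obtain C where "C \<in> ?\<C>" "C \<subseteq> V" using \<B>(3)[OF V] by auto
    then obtain n where "B n \<subseteq> V" using B by (metis rangeE)
    then show ?thesis using U(4)[of n] by blast
  qed
  from that[of U, OF U(1,2,5) this U(3)] show thesis .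
qed

text \<open>Concatenating factorisations makes \<open>N\<close> subadditive. A one-letter
  factorisation bounds \<open>N\<close> above on \<open>U k\<close>, and
  \<open>weighted_product_mem\<close> puts every \<open>g\<close> with
  \<open>N g < (1/2) ^ k\<close> into \<open>U k\<close>. So the balls of \<open>N\<close> define
  the given neighbourhoods of the identity.\<close>

theorem Birkhoff_Kakutani:
  fixes G :: "('g, 'm) monoid_scheme"
  assumes TG: "topological_group G T" and fc: "first_countable T"
  obtains \<rho> where "length_group G T \<rho>"
proof -
  interpret group G using TG by (simp add: topological_group_def)
  have T: "topspace T = carrier G"
    and cm: "continuous_map (prod_topology T T) T (\<lambda>(g, h). g \<otimes>\<^bsub>G\<^esub> h)"
    and ci: "continuous_map T T (\<lambda>g. inv\<^bsub>G\<^esub> g)"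
    using TG by (auto simp: topological_group_def)
  have left: "continuous_map T T (\<lambda>u. g \<otimes>\<^bsub>G\<^esub> u)" and right: "continuous_map T T (\<lambda>u. u \<otimes>\<^bsub>G\<^esub> g)"
    if "g \<in> carrier G" for g
  proof -
    have "continuous_map T (prod_topology T T) (\<lambda>u. (g, u))" "continuous_map T (prod_topology T T) (\<lambda>u. (u, g))"
      using that T by (simp_all add: continuous_map_pairedI)
    from this[THEN continuous_map_compose[OF _ cm]]
    show "continuous_map T T (\<lambda>u. g \<otimes>\<^bsub>G\<^esub> u)" "continuous_map T T (\<lambda>u. u \<otimes>\<^bsub>G\<^esub> g)"
      by (simp_all add: comp_def)
  qed
  obtain U :: "nat \<Rightarrow> 'g set" where U: "\<And>n. openin T (U n)" "\<And>n. \<one>\<^bsub>G\<^esub> \<in> U n"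
    and U3: "\<And>n x y z. x \<in> U (Suc n) \<Longrightarrow> y \<in> U (Suc n) \<Longrightarrow> z \<in> U (Suc n) \<Longrightarrow> x \<otimes>\<^bsub>G\<^esub> (y \<otimes>\<^bsub>G\<^esub> z) \<in> U n"
    and base: "\<And>V. openin T V \<Longrightarrow> \<one>\<^bsub>G\<^esub> \<in> V \<Longrightarrow> \<exists>n. U n \<subseteq> V" and U0: "U 0 = carrier G"
    using topological_group_nhds_chain[OF TG fc] by blast
  have Uc: "U n \<subseteq> carrier G" for n using U(1)[of n] T openin_subset by metis
  define P where "P l = foldr (\<lambda>(n::nat, g) h. g \<otimes>\<^bsub>G\<^esub> h) l \<one>\<^bsub>G\<^esub>" for l
  define w where "w l = (\<Sum>(n, g)\<leftarrow>l. (1/2::real) ^ n)" for l :: "(nat \<times> 'g) list"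
  define L where "L g = {l. (\<forall>(n, g) \<in> set l. g \<in> U n) \<and> P l = g}" for g
  define N where "N g = Inf (w ` L g)" for g
  have w0: "0 \<le> w l" for l unfolding w_def by (rule sum_list_nonneg) auto
  have bdd: "bdd_below (w ` A)" for A using w0 by (intro bdd_belowI[of _ 0]) auto
  \<comment> \<open>\<open>U 0\<close> is the whole group, so every element has a factorisation and
    the infimum in \<open>N\<close> runs over a nonempty set.\<close>
  have Lne: "[(0, g)] \<in> L g" if "g \<in> carrier G" for g using that U0 by (simp add: L_def P_def)
  have Pc: "P l \<in> carrier G" if "\<forall>(n, g) \<in> set l. g \<in> U n" for l
    using that Uc unfolding P_def by (induction l) (auto intro!: m_closed)
  have app: "a @ b \<in> L (g \<otimes>\<^bsub>G\<^esub> h)" if "a \<in> L g" "b \<in> L h" for a b g h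
  proof -
    have bb: "\<forall>(n, g) \<in> set b. g \<in> U n" "P b = h" using that by (auto simp: L_def)
    have "P (a @ b) = P a \<otimes>\<^bsub>G\<^esub> P b" if "\<forall>(n, g) \<in> set a. g \<in> U n"
      using that
    proof (induction a)
      case (Cons y a)
      then have "P a \<in> carrier G" "snd y \<in> carrier G" using Pc[of a] by (auto dest: subsetD[OF Uc])
      then show ?case using Cons Pc[OF bb(1)] by (auto simp: P_def m_assoc split: prod.splits)
    qed (use Pc[OF bb(1)] in \<open>auto simp: P_def\<close>)
    then show ?thesis using that bb by (auto simp: L_def)
  qed
  have N0: "0 \<le> N g" if "g \<in> carrier G" for g
    unfolding N_def using Lne[OF that] w0 by (intro cInf_greatest) auto
  have Nle: "N g \<le> w l" if "l \<in> L g" for g l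
    unfolding N_def using that bdd by (auto intro: cInf_lower)
  have Nless: "\<exists>l\<in>L g. w l < r" if "N g < r" "g \<in> carrier G" for g r
    using that cInf_less_iff[OF _ bdd, of "L g" r] Lne[OF that(2)] by (auto simp: N_def)
  have Nmult: "N (g \<otimes>\<^bsub>G\<^esub> h) \<le> N g + N h" if gh: "g \<in> carrier G" "h \<in> carrier G" for g h
  proof (rule field_le_epsilon)
    fix e :: real assume "0 < e"
    then obtain a b where ab: "a \<in> L g" "b \<in> L h" "w a < N g + e/2" "w b < N h + e/2"
      using Nless[of g "N g + e/2"] Nless[of h "N h + e/2"] gh by auto
    have "N (g \<otimes>\<^bsub>G\<^esub> h) \<le> w (a @ b)" using app ab Nle by blast
    then show "N (g \<otimes>\<^bsub>G\<^esub> h) \<le> N g + N h + e" using ab by (simp add: w_def)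
  qed
  have N1: "N \<one>\<^bsub>G\<^esub> = 0"
  proof -
    have "[] \<in> L \<one>\<^bsub>G\<^esub>" by (simp add: L_def P_def)
    then show ?thesis using N0[of "\<one>\<^bsub>G\<^esub>"] Nle[of "[]" "\<one>\<^bsub>G\<^esub>"] by (simp add: w_def)
  qed
  have NU: "g \<in> U k" if gk: "N g < (1/2) ^ k" "g \<in> carrier G" for g k
  proof -
    obtain l where "l \<in> L g" "w l < (1/2) ^ k" using Nless[OF gk] by blast
    then show ?thesis
      using weighted_product_mem[of U l k] Uc U U3 by (auto simp: L_def w_def P_def)
  qed
  have UN: "N g \<le> (1/2) ^ k" if "g \<in> U k" for g k
  proof -
    have "[(k, g)] \<in> L g" using that subsetD[OF Uc that] by (simp add: L_def P_def)
    then show ?thesis using Nle[of "[(k, g)]" g] by (simp add: w_def)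
  qed
  \<comment> \<open>The sets \<open>U n\<close> need not be symmetric, so \<open>N\<close> is
    symmetrised by adding its value at the inverse.\<close>
  define \<rho> where "\<rho> g = N g + N (inv\<^bsub>G\<^esub> g)" for g
  have pU: "g \<in> U k" if "\<rho> g < (1/2) ^ k" "g \<in> carrier G" for g k
    using NU[of g k] that N0[of "inv\<^bsub>G\<^esub> g"] by (simp add: \<rho>_def)
  \<comment> \<open>\<open>nb\<close> and \<open>base'\<close> say that balls of
    \<open>\<rho>\<close> and open sets around the identity refine each other. Left translations
    carry this to all other points.\<close>
  have nb: "\<exists>O'. openin T O' \<and> \<one>\<^bsub>G\<^esub> \<in> O' \<and> (\<forall>u\<in>O'. \<rho> u < r)" if r: "0 < r" for r
  proof -
    obtain k where k: "(1/2::real) ^ k < r / 2"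
      using real_arch_pow_inv[of "r/2" "1/2"] r by auto
    have "openin T ({u \<in> topspace T. inv\<^bsub>G\<^esub> u \<in> U k} \<inter> U k)"
      using ci U(1) by (auto intro: openin_continuous_map_preimage)
    moreover have "\<one>\<^bsub>G\<^esub> \<in> {u \<in> topspace T. inv\<^bsub>G\<^esub> u \<in> U k} \<inter> U k" using U(2) T by simp
    moreover have "\<rho> u < r" if "u \<in> {u \<in> topspace T. inv\<^bsub>G\<^esub> u \<in> U k} \<inter> U k" for u
      using that UN[of u k] UN[of "inv\<^bsub>G\<^esub> u" k] k by (simp add: \<rho>_def)
    ultimately show ?thesis by meson
  qed
  have base': "\<exists>r>0. \<forall>u\<in>carrier G. \<rho> u < r \<longrightarrow> u \<in> V" if V: "openin T V" "\<one>\<^bsub>G\<^esub> \<in> V" for V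
  proof -
    obtain k where "U k \<subseteq> V" using base[OF V] by blast
    then show ?thesis using pU[of _ k] by (intro exI[of _ "(1/2) ^ k"]) auto
  qed
  have "length_group G T \<rho>"
  proof unfold_locales
    show "topspace T = carrier G" by (rule T)
    show "\<rho> \<one>\<^bsub>G\<^esub> = 0" by (simp add: \<rho>_def N1)
    show "\<rho> (inv\<^bsub>G\<^esub> g) = \<rho> g" if "g \<in> carrier G" for g using that by (simp add: \<rho>_def)
    show "\<rho> (g \<otimes>\<^bsub>G\<^esub> h) \<le> \<rho> g + \<rho> h" if "g \<in> carrier G" "h \<in> carrier G" for g h
      using Nmult[of g h] Nmult[of "inv\<^bsub>G\<^esub> h" "inv\<^bsub>G\<^esub> g"] that by (simp add: \<rho>_def inv_mult_group)
    show "\<exists>\<delta>>0. \<forall>u\<in>carrier G. \<rho> u < \<delta> \<longrightarrow> \<rho> (inv\<^bsub>G\<^esub> h \<otimes>\<^bsub>G\<^esub> u \<otimes>\<^bsub>G\<^esub> h) < \<epsilon>"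
      if h: "h \<in> carrier G" and e: "0 < \<epsilon>" for h \<epsilon>
    proof -
      obtain O' where O': "openin T O'" "\<one>\<^bsub>G\<^esub> \<in> O'" "\<And>u. u \<in> O' \<Longrightarrow> \<rho> u < \<epsilon>"
        using nb[OF e] by blast
      have "continuous_map T T ((\<lambda>u. u \<otimes>\<^bsub>G\<^esub> h) \<circ> (\<lambda>u. inv\<^bsub>G\<^esub> h \<otimes>\<^bsub>G\<^esub> u))"
        using left[of "inv\<^bsub>G\<^esub> h"] right[OF h] h by (intro continuous_map_compose) auto
      then have "openin T {u \<in> topspace T. inv\<^bsub>G\<^esub> h \<otimes>\<^bsub>G\<^esub> u \<otimes>\<^bsub>G\<^esub> h \<in> O'}"
        using O'(1) openin_continuous_map_preimage by (fastforce simp: comp_def)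
      moreover have "\<one>\<^bsub>G\<^esub> \<in> {u \<in> topspace T. inv\<^bsub>G\<^esub> h \<otimes>\<^bsub>G\<^esub> u \<otimes>\<^bsub>G\<^esub> h \<in> O'}"
        using h O'(2) T by simp
      ultimately show ?thesis using base' O'(3) by (metis (no_types, lifting) mem_Collect_eq)
    qed
    show "openin T W \<longleftrightarrow> W \<subseteq> carrier G \<and> (\<forall>g\<in>W. \<exists>r>0. \<forall>u\<in>carrier G. \<rho> u < r \<longrightarrow> g \<otimes>\<^bsub>G\<^esub> u \<in> W)" for W
    proof (intro iffI conjI ballI)
      assume W: "openin T W"
      then show Wc: "W \<subseteq> carrier G" using T openin_subset by metis
      fix g assume g: "g \<in> W"
      then have gc: "g \<in> carrier G" using Wc by blast
      have "openin T {u \<in> topspace T. g \<otimes>\<^bsub>G\<^esub> u \<in> W}"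
        by (rule openin_continuous_map_preimage[OF left[OF gc] W])
      then show "\<exists>r>0. \<forall>u\<in>carrier G. \<rho> u < r \<longrightarrow> g \<otimes>\<^bsub>G\<^esub> u \<in> W"
        using base'[of "{u \<in> topspace T. g \<otimes>\<^bsub>G\<^esub> u \<in> W}"] g gc T by auto
    next
      assume W: "W \<subseteq> carrier G \<and> (\<forall>g\<in>W. \<exists>r>0. \<forall>u\<in>carrier G. \<rho> u < r \<longrightarrow> g \<otimes>\<^bsub>G\<^esub> u \<in> W)"
      show "openin T W"
        unfolding openin_subopen[of T W]
      proof
        fix g assume g: "g \<in> W"
        then have gc: "g \<in> carrier G" using W by blast
        obtain r where r: "0 < r" "\<And>u. u \<in> carrier G \<Longrightarrow> \<rho> u < r \<Longrightarrow> g \<otimes>\<^bsub>G\<^esub> u \<in> W" using W g by blast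
        obtain O' where O': "openin T O'" "\<one>\<^bsub>G\<^esub> \<in> O'" "\<And>u. u \<in> O' \<Longrightarrow> \<rho> u < r"
          using nb[OF r(1)] by blast
        let ?V = "{x \<in> topspace T. inv\<^bsub>G\<^esub> g \<otimes>\<^bsub>G\<^esub> x \<in> O'}"
        have "openin T ?V" using gc O'(1) left[of "inv\<^bsub>G\<^esub> g"] by (intro openin_continuous_map_preimage) auto
        moreover have "g \<in> ?V" using gc O'(2) T by simp
        moreover have "?V \<subseteq> W"
        proof
          fix x assume x: "x \<in> ?V"
          then have "g \<otimes>\<^bsub>G\<^esub> (inv\<^bsub>G\<^esub> g \<otimes>\<^bsub>G\<^esub> x) \<in> W" using gc T O'(3) by (intro r(2)) auto
          then show "x \<in> W" using x gc T by (simp add: m_assoc[symmetric])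
        qed
        ultimately show "\<exists>V. openin T V \<and> g \<in> V \<and> V \<subseteq> W" by blast
      qed
    qed
  qed
  then show thesis by (rule that)
qed

section \<open>Lengths on subgroups and quotients\<close>

text \<open>The length itself is unchanged, so a function that is Lipschitz for the action of
  \<open>G\<close> is Lipschitz for that of \<open>H\<close> with the same constant.\<close>

lemma length_group_subgroup:
  fixes G (structure)
  assumes "length_group G T \<rho>" and H: "subgroup H G"
  shows "length_group (G\<lparr>carrier := H\<rparr>) (subtopology T H) \<rho>"
proof -
  interpret length_group G T \<rho> by fact
  interpret H: subgroup H G by fact
  interpret HG: group "G\<lparr>carrier := H\<rparr>" by (rule H.subgroup_is_group) (rule is_group)
  have inv: "inv\<^bsub>G\<lparr>carrier := H\<rparr>\<^esub> h = inv h" if "h \<in> H" for h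
    using that H by (simp add: m_inv_consistent)
  show ?thesis
  proof unfold_locales
    show "topspace (subtopology T H) = carrier (G\<lparr>carrier := H\<rparr>)"
      using H.subset by (auto simp: topspace_eq)
    show "\<exists>\<delta>>0. \<forall>u\<in>carrier (G\<lparr>carrier := H\<rparr>). \<rho> u < \<delta> \<longrightarrow> \<rho> (inv\<^bsub>G\<lparr>carrier := H\<rparr>\<^esub> h \<otimes>\<^bsub>G\<lparr>carrier := H\<rparr>\<^esub> u \<otimes>\<^bsub>G\<lparr>carrier := H\<rparr>\<^esub> h) < \<epsilon>"
      if "h \<in> carrier (G\<lparr>carrier := H\<rparr>)" "0 < \<epsilon>" for h \<epsilon>
      using length_conj[of h \<epsilon>] that inv by auto
    show "openin (subtopology T H) W \<longleftrightarrow> W \<subseteq> carrier (G\<lparr>carrier := H\<rparr>) \<and>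
       (\<forall>g\<in>W. \<exists>r>0. \<forall>u\<in>carrier (G\<lparr>carrier := H\<rparr>). \<rho> u < r \<longrightarrow> g \<otimes>\<^bsub>G\<lparr>carrier := H\<rparr>\<^esub> u \<in> W)" for W
    proof
      assume "openin (subtopology T H) W"
      then obtain V where "openin T V" "W = V \<inter> H" by (auto simp: openin_subtopology)
      then show "W \<subseteq> carrier (G\<lparr>carrier := H\<rparr>) \<and>
       (\<forall>g\<in>W. \<exists>r>0. \<forall>u\<in>carrier (G\<lparr>carrier := H\<rparr>). \<rho> u < r \<longrightarrow> g \<otimes>\<^bsub>G\<lparr>carrier := H\<rparr>\<^esub> u \<in> W)"
        unfolding openin_iff by auto (meson H.mem_carrier H.m_closed)
    next
      assume W: "W \<subseteq> carrier (G\<lparr>carrier := H\<rparr>) \<and>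
       (\<forall>g\<in>W. \<exists>r>0. \<forall>u\<in>carrier (G\<lparr>carrier := H\<rparr>). \<rho> u < r \<longrightarrow> g \<otimes>\<^bsub>G\<lparr>carrier := H\<rparr>\<^esub> u \<in> W)"
      show "openin (subtopology T H) W"
        unfolding openin_subopen[of "subtopology T H" W]
      proof
        fix g assume g: "g \<in> W"
        then have gH: "g \<in> H" "g \<in> carrier G" using W by auto
        obtain r where r: "0 < r" "\<And>u. u \<in> H \<Longrightarrow> \<rho> u < r \<Longrightarrow> g \<otimes> u \<in> W" using W g by auto
        let ?V = "{h \<in> carrier G. \<rho> (inv g \<otimes> h) < r} \<inter> H"
        have "openin (subtopology T H) ?V"
          using openin_length_ball_at[OF gH(2)] by (auto simp: openin_subtopology)
        moreover have "g \<in> ?V" using gH r(1) by (simp add: length_one)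
        moreover have "?V \<subseteq> W"
        proof
          fix x assume x: "x \<in> ?V"
          then have "g \<otimes> (inv g \<otimes> x) \<in> W" using gH by (intro r(2)) auto
          then show "x \<in> W" using x gH by (simp add: m_assoc[symmetric])
        qed
        ultimately show "\<exists>V. openin (subtopology T H) V \<and> g \<in> V \<and> V \<subseteq> W" by blast
      qed
    qed
  qed (use inv H.subset length_one length_inv length_mult in auto)
qed

text \<open>The new length of a coset is the infimum of \<open>\<rho>\<close> over it. A coset of
  length below \<open>r\<close> thus has a representative of length below \<open>r\<close> (the fact
  \<open>less\<close>), which reduces each axiom to the one for \<open>\<rho>\<close> up to an
  arbitrarily small error and later lifts nearness from the quotient.\<close>

lemma length_group_quotient:
  fixes G (structure)
  assumes "length_group G T \<rho>" and H: "H \<lhd> G"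
  shows "length_group (G Mod H) (quotient_group_topology G T H) (\<lambda>k. Inf (\<rho> ` k))"
proof -
  interpret length_group G T \<rho> by fact
  interpret normal H G by fact
  interpret K: group "G Mod H" by (rule factorgroup_is_group)
  define \<sigma> where "\<sigma> k = Inf (\<rho> ` k)" for k
  let ?q = "\<lambda>g. H #> g"
  have kc: "\<exists>g\<in>carrier G. k = ?q g" if "k \<in> carrier (G Mod H)" for k
    using that by (auto simp: carrier_FactGroup)
  have qc: "?q g \<in> carrier (G Mod H)" if "g \<in> carrier G" for g using that by (auto simp: carrier_FactGroup)
  have sub: "k \<subseteq> carrier G" if "k \<in> carrier (G Mod H)" for k
    using kc[OF that] r_coset_subset_G subset by blast
  have mem: "g \<in> ?q g" if "g \<in> carrier G" for g using that rcos_self subgroup_axioms by blast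
  have qq: "?q g = k" if "g \<in> k" "k \<in> carrier (G Mod H)" for g k
    using kc[OF that(2)] that(1) repr_independence subgroup_axioms by metis
  have bdd: "bdd_below (\<rho> ` k)" if "k \<in> carrier (G Mod H)" for k
    using sub[OF that] length_nonneg by (auto intro!: bdd_belowI[of _ 0])
  have ne: "k \<noteq> {}" if "k \<in> carrier (G Mod H)" for k using kc[OF that] mem by blast
  have le: "\<sigma> (?q g) \<le> \<rho> g" if "g \<in> carrier G" for g
    unfolding \<sigma>_def using that mem qc bdd by (intro cInf_lower) auto
  have less: "\<exists>g\<in>carrier G. ?q g = k \<and> \<rho> g < r" if "\<sigma> k < r" "k \<in> carrier (G Mod H)" for k r
    using that cInf_less_iff[OF _ bdd[OF that(2)], of r] ne[OF that(2)] sub[OF that(2)] qq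
    by (auto simp: \<sigma>_def)
  have mult: "?q g \<otimes>\<^bsub>G Mod H\<^esub> ?q h = ?q (g \<otimes> h)" if "g \<in> carrier G" "h \<in> carrier G" for g h
    using that by (simp add: rcos_sum)
  have inv: "inv\<^bsub>G Mod H\<^esub> (?q g) = ?q (inv g)" if "g \<in> carrier G" for g
    using that qc by (simp add: inv_FactGroup rcos_inv)
  have inv_le: "\<sigma> (inv\<^bsub>G Mod H\<^esub> k) \<le> \<sigma> k" if k: "k \<in> carrier (G Mod H)" for k
  proof (rule field_le_epsilon)
    fix e :: real assume "0 < e"
    then obtain g where g: "g \<in> carrier G" "?q g = k" "\<rho> g < \<sigma> k + e" using less[of k "\<sigma> k + e"] k by auto
    then show "\<sigma> (inv\<^bsub>G Mod H\<^esub> k) \<le> \<sigma> k + e"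
      using le[of "inv g"] inv[of g] length_inv[of g] by auto
  qed
  have "length_group (G Mod H) (quotient_group_topology G T H) \<sigma>"
  proof unfold_locales
    show "topspace (quotient_group_topology G T H) = carrier (G Mod H)"
      by (rule topspace_quotient_group_topology[OF topspace_eq])
    have "0 \<le> \<sigma> H" using ne[OF K.one_closed] length_nonneg subset
      unfolding \<sigma>_def by (intro cInf_greatest) auto
    then show "\<sigma> \<one>\<^bsub>G Mod H\<^esub> = 0"
      using le[of \<one>] length_one by (simp add: coset_mult_one subset)
    show "\<sigma> (inv\<^bsub>G Mod H\<^esub> k) = \<sigma> k" if "k \<in> carrier (G Mod H)" for k
      using inv_le[OF that] inv_le[of "inv\<^bsub>G Mod H\<^esub> k"] that by simp
    show "\<sigma> (k \<otimes>\<^bsub>G Mod H\<^esub> l) \<le> \<sigma> k + \<sigma> l" if kl: "k \<in> carrier (G Mod H)" "l \<in> carrier (G Mod H)" for k l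
    proof (rule field_le_epsilon)
      fix e :: real assume "0 < e"
      then obtain g h where "g \<in> carrier G" "?q g = k" "\<rho> g < \<sigma> k + e/2" "h \<in> carrier G" "?q h = l" "\<rho> h < \<sigma> l + e/2"
        using less[of k "\<sigma> k + e/2"] less[of l "\<sigma> l + e/2"] kl by auto
      then show "\<sigma> (k \<otimes>\<^bsub>G Mod H\<^esub> l) \<le> \<sigma> k + \<sigma> l + e"
        using le[of "g \<otimes> h"] mult[of g h] length_mult[of g h] by auto
    qed
    show "\<exists>\<delta>>0. \<forall>v\<in>carrier (G Mod H). \<sigma> v < \<delta> \<longrightarrow> \<sigma> (inv\<^bsub>G Mod H\<^esub> k \<otimes>\<^bsub>G Mod H\<^esub> v \<otimes>\<^bsub>G Mod H\<^esub> k) < \<epsilon>"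
      if k: "k \<in> carrier (G Mod H)" and e: "0 < \<epsilon>" for k \<epsilon>
    proof -
      obtain h where h: "h \<in> carrier G" "k = ?q h" using kc[OF k] by blast
      obtain \<delta> where d: "\<delta> > 0" "\<And>u. u \<in> carrier G \<Longrightarrow> \<rho> u < \<delta> \<Longrightarrow> \<rho> (inv h \<otimes> u \<otimes> h) < \<epsilon>"
        using length_conj[OF h(1) e] by blast
      have "\<sigma> (inv\<^bsub>G Mod H\<^esub> k \<otimes>\<^bsub>G Mod H\<^esub> v \<otimes>\<^bsub>G Mod H\<^esub> k) < \<epsilon>"
        if v: "v \<in> carrier (G Mod H)" "\<sigma> v < \<delta>" for v
      proof -
        obtain u where u: "u \<in> carrier G" "?q u = v" "\<rho> u < \<delta>" using less[OF v(2,1)] by blast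
        have "inv\<^bsub>G Mod H\<^esub> k \<otimes>\<^bsub>G Mod H\<^esub> v \<otimes>\<^bsub>G Mod H\<^esub> k = ?q (inv h) \<otimes>\<^bsub>G Mod H\<^esub> ?q u \<otimes>\<^bsub>G Mod H\<^esub> ?q h"
          using h u inv by simp
        also have "\<dots> = ?q (inv h \<otimes> u \<otimes> h)"
          using h(1) u(1) mult[of "inv h" u] mult[of "inv h \<otimes> u" h] by simp
        finally show ?thesis using le[of "inv h \<otimes> u \<otimes> h"] d(2)[OF u(1,3)] u h by simp
      qed
      then show ?thesis using d(1) by blast
    qed
    show "openin (quotient_group_topology G T H) W \<longleftrightarrow> W \<subseteq> carrier (G Mod H) \<and>
       (\<forall>k\<in>W. \<exists>r>0. \<forall>v\<in>carrier (G Mod H). \<sigma> v < r \<longrightarrow> k \<otimes>\<^bsub>G Mod H\<^esub> v \<in> W)" for W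
    proof -
      have "(\<forall>g\<in>{g \<in> carrier G. ?q g \<in> W}. \<exists>r>0. \<forall>u\<in>carrier G. \<rho> u < r \<longrightarrow> g \<otimes> u \<in> {g \<in> carrier G. ?q g \<in> W}) \<longleftrightarrow>
        (\<forall>k\<in>W. \<exists>r>0. \<forall>v\<in>carrier (G Mod H). \<sigma> v < r \<longrightarrow> k \<otimes>\<^bsub>G Mod H\<^esub> v \<in> W)" (is "?A \<longleftrightarrow> ?B")
        if W: "W \<subseteq> carrier (G Mod H)"
      proof
        assume A: ?A
        show ?B
        proof
          fix k assume k: "k \<in> W"
          then obtain g where g: "g \<in> carrier G" "k = ?q g" using W kc by blast
          then obtain r where r: "r > 0" "\<And>u. u \<in> carrier G \<Longrightarrow> \<rho> u < r \<Longrightarrow> ?q (g \<otimes> u) \<in> W"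
            using A k by blast
          have "k \<otimes>\<^bsub>G Mod H\<^esub> v \<in> W" if v: "v \<in> carrier (G Mod H)" "\<sigma> v < r" for v
            using less[OF v(2,1)] g mult r(2) by metis
          then show "\<exists>r>0. \<forall>v\<in>carrier (G Mod H). \<sigma> v < r \<longrightarrow> k \<otimes>\<^bsub>G Mod H\<^esub> v \<in> W" using r(1) by blast
        qed
      next
        assume B: ?B
        show ?A
        proof
          fix g assume g: "g \<in> {g \<in> carrier G. ?q g \<in> W}"
          then obtain r where r: "r > 0" "\<And>v. v \<in> carrier (G Mod H) \<Longrightarrow> \<sigma> v < r \<Longrightarrow> ?q g \<otimes>\<^bsub>G Mod H\<^esub> v \<in> W"
            using B by blast
          have "g \<otimes> u \<in> {g \<in> carrier G. ?q g \<in> W}" if "u \<in> carrier G" "\<rho> u < r" for u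
            using that g r(2)[of "?q u"] le[of u] qc[of u] mult[of g u] by auto
          then show "\<exists>r>0. \<forall>u\<in>carrier G. \<rho> u < r \<longrightarrow> g \<otimes> u \<in> {g \<in> carrier G. ?q g \<in> W}" using r(1) by blast
        qed
      qed
      then show ?thesis
        unfolding openin_quotient_group_topology[OF topspace_eq] openin_iff by auto
    qed
  qed
  then show ?thesis by (simp add: \<sigma>_def[abs_def])
qed

section \<open>Coalescence of universal minimal flows\<close>

text \<open>Only left multiplications are continuous. In a minimal closed subsemigroup
  \<open>S\<close>, the set \<open>uS\<close> is a closed subsemigroup and equals \<open>S\<close>,
  so \<open>uv = u\<close> has a solution in \<open>S\<close>. The solutions again form a closed
  subsemigroup, hence \<open>u\<close> is one of them.\<close>

lemma Ellis_Numakura: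
  assumes X: "compact_space X" "Hausdorff_space X" and ne: "topspace X \<noteq> {}"
    and cont: "\<And>x. x \<in> topspace X \<Longrightarrow> continuous_map X X (m x)"
    and assoc: "\<And>x y z. x \<in> topspace X \<Longrightarrow> y \<in> topspace X \<Longrightarrow> z \<in> topspace X \<Longrightarrow> m (m x y) z = m x (m y z)"
  shows "\<exists>u\<in>topspace X. m u u = u"
proof -
  have cl: "m x y \<in> topspace X" if "x \<in> topspace X" "y \<in> topspace X" for x y
    using cont[OF that(1)] that(2) by (auto simp: continuous_map_def)
  define \<A> where "\<A> = {S. closedin X S \<and> S \<noteq> {} \<and> (\<forall>x\<in>S. \<forall>y\<in>S. m x y \<in> S)}"
  have "closedin X C \<and> C \<noteq> {}" if "C \<in> \<A>" for C using that by (simp add: \<A>_def)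
  moreover have "\<Inter>\<C> \<in> \<A>" if "\<C> \<noteq> {}" "\<C> \<subseteq> \<A>" "\<Inter>\<C> \<noteq> {}" for \<C>
    using that by (auto simp: \<A>_def intro!: closedin_Inter)
  moreover have "topspace X \<in> \<A>" using ne cl by (simp add: \<A>_def)
  ultimately obtain S where S: "S \<in> \<A>" and min: "\<And>D. D \<in> \<A> \<Longrightarrow> D \<subseteq> S \<Longrightarrow> D = S"
    using minimal_closed_set_exists[OF X(1), of \<A> "topspace X"] by metis
  have Scl: "closedin X S" and Sm: "\<And>x y. x \<in> S \<Longrightarrow> y \<in> S \<Longrightarrow> m x y \<in> S" and SX: "S \<subseteq> topspace X"
    using S closedin_subset[of X S] by (simp_all add: \<A>_def)
  obtain u where u: "u \<in> S" using S by (auto simp: \<A>_def)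
  have uX: "u \<in> topspace X" using u SX by blast
  have "compactin X (m u ` S)"
    using closedin_compact_space[OF X(1) Scl] cont[OF uX] image_compactin by blast
  then have "closedin X (m u ` S)" using X(2) compactin_imp_closedin by blast
  moreover have "m (m u x) (m u y) = m u (m x (m u y))" if "x \<in> S" "y \<in> S" for x y
    using that SX uX cl by (intro assoc) auto
  ultimately have "m u ` S \<in> \<A>" using u Sm by (auto simp: \<A>_def)
  then have "m u ` S = S" using min Sm u by blast
  then obtain v where v: "v \<in> S" "m u v = u" using u by (metis imageE)
  let ?V = "{v \<in> S. m u v = u}"
  have "closedin X {x \<in> topspace X. m u x \<in> {u}}"
    using cont[OF uX] X(2) uX by (intro closedin_continuous_map_preimage) (auto simp: closedin_Hausdorff_singleton)
  then have "closedin X (S \<inter> {x \<in> topspace X. m u x \<in> {u}})" using Scl by blast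
  moreover have "S \<inter> {x \<in> topspace X. m u x \<in> {u}} = ?V" using SX by auto
  ultimately have "closedin X ?V" by simp
  moreover have "m u (m x y) = u" if "x \<in> ?V" "y \<in> ?V" for x y
    using that assoc[of u x y] subsetD[OF SX] uX by auto
  ultimately have "?V \<in> \<A>" using v Sm by (auto simp: \<A>_def)
  then have "?V = S" using min by blast
  then show ?thesis using u uX by blast
qed

text \<open>Assumption \<open>simple\<close> makes the semigroup right simple, and with an
  idempotent \<open>u\<close> it is a right group. As every \<open>x\<close> is of the form
  \<open>uy\<close>, \<open>u\<close> is a left unit. If \<open>\<alpha>\<beta> = u\<close> and
  \<open>\<beta>\<gamma> = u\<close>, then
  \<open>\<gamma> = \<alpha>\<beta>\<gamma> = \<alpha>u\<close>, so
  \<open>\<beta>\<alpha>z = \<beta>\<alpha>uz = \<beta>\<gamma>z = z\<close>: multiplication by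
  \<open>\<alpha>\<close> has a left inverse.\<close>

lemma left_multiplication_injective:
  assumes X: "compact_space X" "Hausdorff_space X" and ne: "topspace X \<noteq> {}"
    and cont: "\<And>x. x \<in> topspace X \<Longrightarrow> continuous_map X X (m x)"
    and assoc: "\<And>x y z. x \<in> topspace X \<Longrightarrow> y \<in> topspace X \<Longrightarrow> z \<in> topspace X \<Longrightarrow> m (m x y) z = m x (m y z)"
    and simple: "\<And>x. x \<in> topspace X \<Longrightarrow> m x ` topspace X = topspace X"
  shows "\<exists>u\<in>topspace X. \<forall>x\<in>topspace X. m u x = x"
    and "\<And>\<alpha>. \<alpha> \<in> topspace X \<Longrightarrow> inj_on (m \<alpha>) (topspace X)"
proof -
  let ?X = "topspace X"
  have cl: "m x y \<in> ?X" if "x \<in> ?X" "y \<in> ?X" for x y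
    using cont[OF that(1)] that(2) by (auto simp: continuous_map_def)
  have "\<exists>u\<in>?X. m u u = u"
    by (rule Ellis_Numakura[OF X ne]) (simp_all add: cont assoc)
  then obtain u where u: "u \<in> ?X" "m u u = u" by (rule bexE)
  have un: "m u x = x" if "x \<in> ?X" for x
  proof -
    have "x \<in> m u ` ?X" by (simp only: simple[OF u(1)] that)
    then obtain y where y: "x = m u y" "y \<in> ?X" by (rule imageE)
    have "m u x = m (m u u) y" using assoc[OF u(1) u(1) y(2)] y(1) by (simp only:)
    then show ?thesis by (simp only: u(2) y(1))
  qed
  have inv: "\<exists>\<beta>\<in>?X. m \<alpha> \<beta> = u \<and> m \<beta> u = \<beta>" if \<alpha>: "\<alpha> \<in> ?X" for \<alpha>
  proof -
    have "u \<in> m \<alpha> ` ?X" by (simp only: simple[OF \<alpha>] u(1))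
    then obtain \<beta> where \<beta>: "u = m \<alpha> \<beta>" "\<beta> \<in> ?X" by (rule imageE)
    have "m \<alpha> (m \<beta> u) = u"
      using assoc[OF \<alpha> \<beta>(2) u(1)] \<beta>(1) u(2) by metis
    moreover have "m (m \<beta> u) u = m \<beta> u"
      using assoc[OF \<beta>(2) u(1) u(1)] u(2) by metis
    ultimately show ?thesis using cl[OF \<beta>(2) u(1)] by blast
  qed
  show "\<exists>u\<in>?X. \<forall>x\<in>?X. m u x = x" using u(1) un by blast
  show "inj_on (m \<alpha>) ?X" if \<alpha>: "\<alpha> \<in> ?X" for \<alpha>
  proof (rule inj_onI)
    fix x y assume xy: "x \<in> ?X" "y \<in> ?X" "m \<alpha> x = m \<alpha> y"
    obtain \<beta> where \<beta>: "\<beta> \<in> ?X" "m \<alpha> \<beta> = u" using inv[OF \<alpha>] by blast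
    obtain \<gamma> where \<gamma>: "\<gamma> \<in> ?X" "m \<beta> \<gamma> = u" using inv[OF \<beta>(1)] by blast
    have "\<gamma> = m (m \<alpha> \<beta>) \<gamma>" using \<beta>(2) un \<gamma>(1) by simp
    also have "\<dots> = m \<alpha> u" unfolding assoc[OF \<alpha> \<beta>(1) \<gamma>(1)] \<gamma>(2) ..
    finally have \<gamma>': "\<gamma> = m \<alpha> u" .
    have *: "z = m \<beta> (m \<alpha> z)" if z: "z \<in> ?X" for z
    proof -
      have "z = m (m \<beta> \<gamma>) z" using \<gamma>(2) un z by simp
      also have "\<dots> = m \<beta> (m \<gamma> z)" by (rule assoc[OF \<beta>(1) \<gamma>(1) z])
      also have "m \<gamma> z = m \<alpha> (m u z)" unfolding \<gamma>' by (rule assoc[OF \<alpha> u(1) z])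
      also have "m u z = z" by (rule un[OF z])
      finally show ?thesis .
    qed
    show "x = y" using *[OF xy(1)] *[OF xy(2)] xy(3) by simp
  qed
qed

text \<open>A minimal subflow \<open>L\<close> of the Ellis semigroup is a right ideal whose
  endomorphisms are left multiplications, hence injective. Evaluation maps \<open>L\<close> onto
  \<open>X\<close>, and universality maps \<open>X\<close> to \<open>L\<close>, so
  \<open>\<phi>\<close> sits inside an injective endomorphism of \<open>L\<close>.\<close>

lemma universal_minimal_flow_coalescent:
  fixes X :: "'x topology"
  assumes M: "universal_minimal_flow G T X a" and T: "topspace T = carrier G" and G: "Group.group G"
    and \<phi>: "G_map G X a X a \<phi>"
  shows "inj_on \<phi> (topspace X)"
proof -
  interpret group G by fact
  have min: "minimal_flow G T X a" and fl: "flow G T X a" and H: "Hausdorff_space X"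
    and neX: "topspace X \<noteq> {}"
    using M by (auto simp: universal_minimal_flow_def minimal_flow_def flow_def)
  let ?P = "product_topology (\<lambda>_. X) (topspace X)"
  let ?b = "\<lambda>\<xi> g. \<lambda>i\<in>topspace X. a (\<xi> i) g"
  define idX where "idX = (\<lambda>x\<in>topspace X. x)"
  have Pfl: "flow G T ?P ?b" by (rule product_flow[OF fl T])
  have idP: "idX \<in> topspace ?P" by (simp add: idX_def)
  \<comment> \<open>The Ellis semigroup of \<open>X\<close>: the pointwise closure of the maps given
    by single group elements.\<close>
  define E where "E = ?P closure_of (?b idX ` carrier G)"
  have "?b idX ` carrier G \<subseteq> topspace ?P"
    using flow_closed[OF Pfl T idP] by blast
  then have "E \<noteq> {}" using closure_of_subset[of "?b idX ` carrier G" ?P] one_closed unfolding E_def by blast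
  moreover have "closedin ?P E" by (simp add: E_def)
  ultimately obtain L where L: "closedin ?P L" "L \<subseteq> E" "minimal_flow G T (subtopology ?P L) ?b"
    and Linv: "\<And>\<xi> g. \<xi> \<in> L \<Longrightarrow> g \<in> carrier G \<Longrightarrow> ?b \<xi> g \<in> L"
    using minimal_subflow_exists[OF Pfl T G, of E] orbit_closure_invariant[OF Pfl T G idP]
    unfolding E_def by blast
  let ?L = "subtopology ?P L"
  have LP: "L \<subseteq> topspace ?P" using L(1) closedin_subset by blast
  then have tL: "topspace ?L = L" by (simp add: Int_absorb1)
  have Lfl: "flow G T ?L ?b" and Lne: "topspace ?L \<noteq> {}" using L(3) by (auto simp: minimal_flow_def)
  have val: "\<xi> x \<in> topspace X" if "\<xi> \<in> topspace ?P" "x \<in> topspace X" for \<xi> x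
    using that by (auto simp: PiE_iff)
  \<comment> \<open>Composition is written with \<open>\<xi>\<close> acting first. In this order
    multiplication is continuous in its second argument and each \<open>m \<xi>\<close> commutes
    with the action.\<close>
  define m where "m \<xi> \<eta> = (\<lambda>x\<in>topspace X. \<eta> (\<xi> x))" for \<xi> \<eta> :: "'x \<Rightarrow> 'x"
  have mcont: "continuous_map ?P ?P (m \<xi>)" if "\<xi> \<in> topspace ?P" for \<xi>
    unfolding continuous_map_componentwise m_def
    using val[OF that] by (auto intro: continuous_map_product_projection)
  have mg: "m \<xi> (?b \<eta> g) = ?b (m \<xi> \<eta>) g" if "\<xi> \<in> topspace ?P" for \<xi> \<eta> g
    using val[OF that] by (auto simp: m_def fun_eq_iff)
  have mid: "m \<xi> idX = \<xi>" if "\<xi> \<in> topspace ?P" for \<xi>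
    using that val[OF that] by (auto simp: m_def idX_def fun_eq_iff PiE_iff extensional_def)
  have mL: "m \<xi> \<eta> \<in> L" if \<xi>: "\<xi> \<in> L" and \<eta>: "\<eta> \<in> E" for \<xi> \<eta>
  proof -
    have "m \<xi> ` E \<subseteq> ?P closure_of (m \<xi> ` (?b idX ` carrier G))"
      unfolding E_def by (rule continuous_map_image_closure_subset[OF mcont]) (use \<xi> LP in blast)
    also have "\<dots> \<subseteq> L"
    proof (rule closure_of_minimal[OF _ L(1)])
      show "m \<xi> ` (?b idX ` carrier G) \<subseteq> L"
        using mg[of \<xi> idX] mid[of \<xi>] Linv[OF \<xi>] \<xi> LP by (auto simp: image_iff)
    qed
    finally show ?thesis using \<eta> by blast
  qed
  have mLc: "continuous_map ?L ?L (m \<xi>)" if "\<xi> \<in> L" for \<xi>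
    using mcont[of \<xi>] that LP mL[OF that] L(2)
    by (intro continuous_map_into_subtopology continuous_map_from_subtopology) auto
  have mmap: "G_map G ?L ?b ?L ?b (m \<xi>)" if "\<xi> \<in> L" for \<xi>
    using mLc[OF that] mg[of \<xi>] that LP by (auto simp: G_map_def)
  have Ltop: "compact_space ?L" "Hausdorff_space ?L" using Lfl by (auto simp: flow_def)
  have Lc: "continuous_map ?L ?L (m x)" if "x \<in> topspace ?L" for x
    using mLc that tL by simp
  have Lassoc: "m (m x y) z = m x (m y z)" if "x \<in> topspace ?L" "y \<in> topspace ?L" "z \<in> topspace ?L" for x y z
    using that(1) val[of x] subsetD[OF LP] tL by (simp add: m_def fun_eq_iff)
  have Lsimple: "m x ` topspace ?L = topspace ?L" if "x \<in> topspace ?L" for x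
    using G_map_onto_minimal[OF Lfl L(3) _ Lne T] mmap that tL by simp
  note unit = left_multiplication_injective[of ?L m, OF Ltop Lne Lc Lassoc Lsimple]
  obtain u where u: "u \<in> topspace ?L" "\<And>x. x \<in> topspace ?L \<Longrightarrow> m u x = x"
    using unit(1) by blast
  note inj = unit(2)
  \<comment> \<open>As \<open>u\<close> is a left unit, an endomorphism of \<open>L\<close> is left multiplication by its value at \<open>u\<close>.\<close>
  have endo: "inj_on \<psi> L" if \<psi>: "G_map G ?L ?b ?L ?b \<psi>" for \<psi>
  proof -
    have \<psi>c: "continuous_map ?L ?L \<psi>" and \<psi>g: "\<And>\<xi> g. \<xi> \<in> L \<Longrightarrow> g \<in> carrier G \<Longrightarrow> \<psi> (?b \<xi> g) = ?b (\<psi> \<xi>) g"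
      using \<psi> tL by (auto simp: G_map_def)
    have \<psi>L: "\<psi> \<xi> \<in> L" if "\<xi> \<in> L" for \<xi> using \<psi>c that tL by (auto simp: continuous_map_def)
    have uL: "u \<in> L" "\<psi> u \<in> L" "u \<in> topspace ?P" "\<psi> u \<in> topspace ?P" using u(1) tL \<psi>L LP by auto
    let ?E = "subtopology ?P E"
    have oE: "?b idX ` carrier G \<subseteq> E"
      using closure_of_subset \<open>?b idX ` carrier G \<subseteq> topspace ?P\<close> unfolding E_def by blast
    \<comment> \<open>On the orbit of \<open>idX\<close> this is equivariance of
      \<open>\<psi>\<close>. Both sides are continuous in \<open>\<eta>\<close>, so it extends to
      the closure.\<close>
    have "\<psi> (m u \<eta>) = m (\<psi> u) \<eta>" if "\<eta> \<in> E" for \<eta>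
    proof (rule forall_in_closure_of_eq[of \<eta> ?E "?b idX ` carrier G" ?L])
      show "\<eta> \<in> ?E closure_of (?b idX ` carrier G)"
        using that oE by (simp add: closure_of_subtopology Int_absorb1 flip: E_def)
      show "Hausdorff_space ?L" using Lfl by (simp add: flow_def)
      have c: "continuous_map ?E ?L (m \<xi>)" if "\<xi> \<in> L" for \<xi>
        using mcont[of \<xi>] that LP mL[OF that]
        by (intro continuous_map_into_subtopology continuous_map_from_subtopology) auto
      show "continuous_map ?E ?L (\<lambda>\<eta>. \<psi> (m u \<eta>))"
        using continuous_map_compose[OF c[OF uL(1)] \<psi>c] by (simp add: comp_def)
      show "continuous_map ?E ?L (m (\<psi> u))" by (rule c[OF uL(2)])
      show "\<psi> (m u \<eta>) = m (\<psi> u) \<eta>" if "\<eta> \<in> ?b idX ` carrier G" for \<eta>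
        using that mg mid uL \<psi>g by auto
    qed
    then have "\<psi> \<xi> = m (\<psi> u) \<xi>" if "\<xi> \<in> L" for \<xi> using u(2)[of \<xi>] that L(2) unfolding tL by (metis subsetD)
    moreover have "inj_on (m (\<psi> u)) L" using inj[of "\<psi> u"] uL unfolding tL by blast
    ultimately show ?thesis by (simp add: inj_on_def)
  qed
  obtain f where f: "G_map G X a ?L ?b f" "f ` topspace X = topspace ?L"
    by (rule universal_minimal_flow_onto[OF M L(3) T])
  obtain x where x: "x \<in> topspace X" using neX by blast
  have ev: "G_map G ?L ?b X a (\<lambda>\<xi>. \<xi> x)"
    using x by (auto simp: G_map_def intro: continuous_map_from_subtopology continuous_map_product_projection)
  have onto: "(\<lambda>\<xi>. \<xi> x) ` L = topspace X"
    using G_map_onto_minimal[OF Lfl min ev Lne T] tL by simp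
  have "inj_on (f \<circ> (\<phi> \<circ> (\<lambda>\<xi>. \<xi> x))) L"
    using endo[OF G_map_compose[OF G_map_compose[OF ev \<phi>] f(1)]] .
  then have "inj_on (\<phi> \<circ> (\<lambda>\<xi>. \<xi> x)) L" by (rule inj_on_imageI2)
  then have "inj_on \<phi> ((\<lambda>\<xi>. \<xi> x) ` L)" by (auto simp: inj_on_def)
  then show ?thesis using onto by simp
qed

text \<open>Universality provides some map \<open>f\<close> into a minimal subflow of
  \<open>Z\<close>. By coalescence and compactness \<open>p \<circ> f\<close> is an automorphism of
  \<open>X\<close>, and composing its inverse with \<open>f\<close> gives a section.\<close>

lemma universal_minimal_flow_section:
  assumes M: "universal_minimal_flow G T X a" and T: "topspace T = carrier G" and G: "Group.group G"
    and Z: "flow G T Z b" "topspace Z \<noteq> {}" and p: "G_map G Z b X a p"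
  shows "\<exists>s. G_map G X a Z b s \<and> (\<forall>x\<in>topspace X. p (s x) = x)"
proof -
  have min: "minimal_flow G T X a" and fl: "flow G T X a" and H: "Hausdorff_space X" "compact_space X"
    and neX: "topspace X \<noteq> {}"
    using M by (auto simp: universal_minimal_flow_def minimal_flow_def flow_def)
  have Zcl: "b z g \<in> topspace Z" if "z \<in> topspace Z" "g \<in> carrier G" for z g
    by (rule flow_closed[OF Z(1) T that])
  obtain C where C: "closedin Z C" "minimal_flow G T (subtopology Z C) b"
    by (rule minimal_subflow_exists[OF Z(1) T G closedin_topspace Z(2) Zcl])
  obtain f where f: "G_map G X a (subtopology Z C) b f" "f ` topspace X = topspace (subtopology Z C)"
    by (rule universal_minimal_flow_onto[OF M C(2) T])
  then have f': "G_map G X a Z b f"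
    by (auto simp: G_map_def continuous_map_in_subtopology)
  have e: "G_map G X a X a (p \<circ> f)" by (rule G_map_compose[OF f' p])
  have inj: "inj_on (p \<circ> f) (topspace X)" by (rule universal_minimal_flow_coalescent[OF M T G e])
  have surj: "(p \<circ> f) ` topspace X = topspace X" by (rule G_map_onto_minimal[OF fl min e neX T])
  have ec: "continuous_map X X (p \<circ> f)" using e by (simp add: G_map_def)
  then have "homeomorphic_map X X (p \<circ> f)"
    using continuous_imp_homeomorphic_map[OF ec H(2,1) surj inj] by simp
  then obtain e' where e': "homeomorphic_maps X X (p \<circ> f) e'" by (auto simp: homeomorphic_map_maps)
  then have c: "continuous_map X X e'" and l: "\<And>x. x \<in> topspace X \<Longrightarrow> e' ((p \<circ> f) x) = x"
    and r: "\<And>x. x \<in> topspace X \<Longrightarrow> (p \<circ> f) (e' x) = x"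
    by (auto simp: homeomorphic_maps_def)
  have e'X: "e' x \<in> topspace X" if "x \<in> topspace X" for x using c that by (auto simp: continuous_map_def)
  have "e' (a x g) = a (e' x) g" if "x \<in> topspace X" "g \<in> carrier G" for x g
  proof -
    have "(p \<circ> f) (a (e' x) g) = a ((p \<circ> f) (e' x)) g" using e e'X that unfolding G_map_def by blast
    then show ?thesis using l[of "a (e' x) g"] r that e'X flow_closed[OF fl T] by metis
  qed
  then have "G_map G X a X a e'" using c by (simp add: G_map_def)
  from G_map_compose[OF this f'] show ?thesis using r by auto
qed

section \<open>Metrizable universal minimal flows\<close>

lemma continuous_map_realI:
  fixes f :: "'x \<Rightarrow> real"
  assumes "\<And>x e. x \<in> topspace X \<Longrightarrow> 0 < e \<Longrightarrow> \<exists>U. openin X U \<and> x \<in> U \<and> (\<forall>y\<in>U. \<bar>f y - f x\<bar> < e)"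
  shows "continuous_map X euclideanreal f"
  unfolding continuous_map_def
proof (intro conjI allI impI)
  fix V :: "real set" assume "openin euclideanreal V"
  then have V: "open V" by simp
  show "openin X {x \<in> topspace X. f x \<in> V}"
    unfolding openin_subopen[of X "{x \<in> topspace X. f x \<in> V}"]
  proof
    fix x assume x: "x \<in> {x \<in> topspace X. f x \<in> V}"
    then obtain e where e: "0 < e" "\<And>y. \<bar>y - f x\<bar> < e \<Longrightarrow> y \<in> V"
      using V unfolding open_dist dist_real_def by blast
    obtain U where "openin X U" "x \<in> U" "\<forall>y\<in>U. \<bar>f y - f x\<bar> < e" using assms[of x e] e(1) x by blast
    then show "\<exists>U. openin X U \<and> x \<in> U \<and> U \<subseteq> {x \<in> topspace X. f x \<in> V}"
      using e(2) openin_subset[of X U] by (intro exI[of _ U]) auto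
  qed
qed auto

section \<open>The flow of Lipschitz functions and nearness\<close>

context length_group
begin

text \<open>These are the 1-Lipschitz functions for the left-invariant pseudometric
  \<open>\<rho> (inv g \<otimes> h)\<close>. Cutting values off at \<open>r\<close> makes the space
  compact in the topology of pointwise convergence.\<close>

definition lipschitz_functions :: "real \<Rightarrow> ('a \<Rightarrow> real) set" where
  "lipschitz_functions r = {F \<in> carrier G \<rightarrow>\<^sub>E {0..r}.
     \<forall>g\<in>carrier G. \<forall>h\<in>carrier G. \<bar>F (g \<otimes> h) - F g\<bar> \<le> \<rho> h}"

definition lipschitz_space :: "real \<Rightarrow> ('a \<Rightarrow> real) topology" where
  "lipschitz_space r = subtopology (product_topology (\<lambda>_. top_of_set {0..r}) (carrier G)) (lipschitz_functions r)"

lemma topspace_lipschitz_space: "topspace (lipschitz_space r) = lipschitz_functions r"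
  by (auto simp: lipschitz_space_def lipschitz_functions_def)

lemma continuous_map_lipschitz_eval:
  assumes "g \<in> carrier G"
  shows "continuous_map (lipschitz_space r) euclideanreal (\<lambda>F. F g)"
proof -
  have "continuous_map (lipschitz_space r) (top_of_set {0..r}) (\<lambda>F. F g)"
    unfolding lipschitz_space_def
    by (intro continuous_map_from_subtopology continuous_map_product_projection assms)
  then show ?thesis by (simp add: continuous_map_in_subtopology)
qed

lemma closedin_lipschitz_functions:
  "closedin (product_topology (\<lambda>_. top_of_set {0..r}) (carrier G)) (lipschitz_functions r)"
proof -
  let ?P = "product_topology (\<lambda>_. top_of_set {0..r}) (carrier G)"
  have "continuous_map ?P (top_of_set {0..r}) (\<lambda>F. F g)" if "g \<in> carrier G" for g
    using that by (rule continuous_map_product_projection)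
  then have c: "continuous_map ?P euclideanreal (\<lambda>F. F g)" if "g \<in> carrier G" for g
    using that by (simp add: continuous_map_in_subtopology)
  have "closedin ?P {F \<in> topspace ?P. \<bar>F (g \<otimes> h) - F g\<bar> \<in> {..\<rho> h}}"
    if "g \<in> carrier G" "h \<in> carrier G" for g h
    using that by (intro closedin_continuous_map_preimage[where Y = euclideanreal]
        continuous_map_real_abs continuous_map_diff c) auto
  then have "closedin ?P (\<Inter>g\<in>carrier G. \<Inter>h\<in>carrier G. {F \<in> topspace ?P. \<bar>F (g \<otimes> h) - F g\<bar> \<in> {..\<rho> h}})"
    by (intro closedin_Inter) auto
  moreover have "(\<Inter>g\<in>carrier G. \<Inter>h\<in>carrier G. {F \<in> topspace ?P. \<bar>F (g \<otimes> h) - F g\<bar> \<in> {..\<rho> h}})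
     = lipschitz_functions r"
    using one_closed by (auto simp: lipschitz_functions_def)
  ultimately show ?thesis by simp
qed

text \<open>Joint continuity holds because the Lipschitz bound is common to all functions: moving
  \<open>g\<close> changes the value at \<open>g \<otimes> h\<close> by a small amount that does not
  depend on the function. Moving the function is controlled at the single coordinate
  \<open>g \<otimes> h\<close>.\<close>

lemma flow_lipschitz: "flow G T (lipschitz_space r) (\<lambda>F g. \<lambda>h\<in>carrier G. F (g \<otimes> h))"
proof -
  let ?P = "product_topology (\<lambda>_. top_of_set {0..r}) (carrier G)"
  let ?L = "lipschitz_space r"
  let ?c = "\<lambda>F g. \<lambda>h\<in>carrier G. F (g \<otimes> h)"
  have range: "F g \<in> {0..r}" if "F \<in> lipschitz_functions r" "g \<in> carrier G" for F g
    using that by (auto simp: lipschitz_functions_def)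
  have lip: "\<bar>F (g \<otimes> h) - F g\<bar> \<le> \<rho> h" if "F \<in> lipschitz_functions r" "g \<in> carrier G" "h \<in> carrier G" for F g h
    using that by (auto simp: lipschitz_functions_def)
  have act: "?c F g \<in> lipschitz_functions r" if "F \<in> lipschitz_functions r" "g \<in> carrier G" for F g
    using lip[OF that(1)] range[OF that(1)] that(2) by (auto simp: lipschitz_functions_def m_assoc[symmetric])
  have cont: "continuous_map (prod_topology ?L T) ?P (\<lambda>z. ?c (fst z) (snd z))"
    unfolding continuous_map_componentwise
  proof (intro conjI ballI)
    fix h assume h: "h \<in> carrier G"
    have "continuous_map (prod_topology ?L T) euclideanreal (\<lambda>z. fst z (snd z \<otimes> h))"
    proof (rule continuous_map_realI)
      fix z and e :: real assume z: "z \<in> topspace (prod_topology ?L T)" and e: "0 < e"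
      obtain F g where Fg: "z = (F, g)" "F \<in> lipschitz_functions r" "g \<in> carrier G"
        using z by (cases z) (auto simp: topspace_lipschitz_space topspace_eq)
      obtain \<delta> where \<delta>: "\<delta> > 0" "\<And>u. u \<in> carrier G \<Longrightarrow> \<rho> u < \<delta> \<Longrightarrow> \<rho> (inv h \<otimes> u \<otimes> h) < e / 2"
        using length_conj[OF h, of "e / 2"] e by auto
      define U where "U = {F' \<in> topspace ?L. F' (g \<otimes> h) \<in> {F (g \<otimes> h) - e / 2 <..< F (g \<otimes> h) + e / 2}}"
      define V where "V = {g' \<in> carrier G. \<rho> (inv g \<otimes> g') < \<delta>}"
      have "openin ?L U" unfolding U_def
        by (rule openin_continuous_map_preimage[OF continuous_map_lipschitz_eval]) (use Fg h in auto)
      moreover have "openin T V" unfolding V_def by (rule openin_length_ball_at[OF Fg(3)])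
      ultimately have "openin (prod_topology ?L T) (U \<times> V)" by (simp add: openin_prod_Times_iff)
      moreover have "z \<in> U \<times> V"
        using Fg e \<delta>(1) h by (simp add: U_def V_def topspace_lipschitz_space length_one)
      moreover have "\<bar>fst y (snd y \<otimes> h) - fst z (snd z \<otimes> h)\<bar> < e" if y: "y \<in> U \<times> V" for y
      proof -
        obtain F' g' where y': "y = (F', g')" "F' \<in> lipschitz_functions r" "g' \<in> carrier G"
          "\<rho> (inv g \<otimes> g') < \<delta>" "F' (g \<otimes> h) \<in> {F (g \<otimes> h) - e / 2 <..< F (g \<otimes> h) + e / 2}"
          using y unfolding U_def V_def topspace_lipschitz_space by (cases y) blast
        have cancel: "x \<otimes> (inv x \<otimes> z) = z" if "x \<in> carrier G" "z \<in> carrier G" for x z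
          using that by (simp add: m_assoc[symmetric])
        \<comment> \<open>The displacement from \<open>g \<otimes> h\<close> to
          \<open>g' \<otimes> h\<close> is the conjugate of a short element by \<open>h\<close>,
          short itself by \<open>length_conj\<close>.\<close>
        have "g' \<otimes> h = (g \<otimes> h) \<otimes> (inv h \<otimes> (inv g \<otimes> g') \<otimes> h)"
          using y'(3) Fg(3) h by (simp add: m_assoc cancel)
        then have "\<bar>F' (g' \<otimes> h) - F' (g \<otimes> h)\<bar> < e / 2"
          using lip[OF y'(2), of "g \<otimes> h" "inv h \<otimes> (inv g \<otimes> g') \<otimes> h"] \<delta>(2)[OF _ y'(4)] y'(3) Fg(3) h
          by simp
        moreover have "F (g \<otimes> h) - e / 2 < F' (g \<otimes> h)" "F' (g \<otimes> h) < F (g \<otimes> h) + e / 2"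
          using y'(5) by auto
        ultimately show ?thesis unfolding y'(1) Fg(1) fst_conv snd_conv by linarith
      qed
      ultimately show "\<exists>U. openin (prod_topology ?L T) U \<and> z \<in> U \<and>
          (\<forall>y\<in>U. \<bar>fst y (snd y \<otimes> h) - fst z (snd z \<otimes> h)\<bar> < e)"
        by blast
    qed
    then have "continuous_map (prod_topology ?L T) (top_of_set {0..r}) (\<lambda>z. fst z (snd z \<otimes> h))"
      by (rule continuous_map_into_subtopology)
        (use range h in \<open>auto simp: topspace_lipschitz_space topspace_eq\<close>)
    then show "continuous_map (prod_topology ?L T) (top_of_set {0..r}) (\<lambda>z. ?c (fst z) (snd z) h)"
      using h by simp
  qed auto
  have "continuous_map (prod_topology ?L T) ?L (\<lambda>z. ?c (fst z) (snd z))"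
    unfolding lipschitz_space_def[of r]
    by (rule continuous_map_into_subtopology[OF cont[unfolded lipschitz_space_def]])
      (use act in \<open>auto simp: topspace_eq\<close>)
  moreover have "compact_space ?L"
  proof -
    have "compact_space ?P"
      by (simp add: compact_space_product_topology compact_space_subtopology)
    then show ?thesis unfolding lipschitz_space_def
      using closedin_compact_space[OF _ closedin_lipschitz_functions] compact_space_subtopology by blast
  qed
  moreover have "Hausdorff_space ?L"
    unfolding lipschitz_space_def
    by (intro Hausdorff_space_subtopology) (simp add: Hausdorff_space_product_topology Hausdorff_space_subtopology)
  moreover have "?c F \<one> = F" if "F \<in> lipschitz_functions r" for F
    using that by (auto simp: lipschitz_functions_def PiE_iff extensional_def fun_eq_iff)
  moreover have "?c (?c F g) h = ?c F (g \<otimes> h)" if "g \<in> carrier G" "h \<in> carrier G" for F g h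
    using that by (auto simp: fun_eq_iff m_assoc)
  ultimately show ?thesis
    unfolding flow_def topspace_lipschitz_space case_prod_unfold by blast
qed

text \<open>The witness is the distance to \<open>S\<close>, truncated at \<open>r\<close>. For
  empty \<open>S\<close> the infimum says nothing and the constant \<open>r\<close> takes its
  place.\<close>

lemma distance_function:
  assumes S: "S \<subseteq> carrier G" and r: "0 \<le> r"
  obtains F where "F \<in> lipschitz_functions r" "\<And>s. s \<in> S \<Longrightarrow> F s = 0"
    "\<And>g. g \<in> carrier G \<Longrightarrow> (\<And>s. s \<in> S \<Longrightarrow> r \<le> \<rho> (inv s \<otimes> g)) \<Longrightarrow> F g = r"
proof (cases "S = {}")
  case True
  have "(\<lambda>g\<in>carrier G. r) \<in> lipschitz_functions r"
    using r length_nonneg by (auto simp: lipschitz_functions_def)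
  then show thesis using True by (intro that[of "\<lambda>g\<in>carrier G. r"]) auto
next
  case False
  define D where "D g = (INF s\<in>S. \<rho> (inv s \<otimes> g))" for g
  have bdd: "bdd_below ((\<lambda>s. \<rho> (inv s \<otimes> g)) ` S)" if "g \<in> carrier G" for g
    using S that length_nonneg by (intro bdd_belowI[of _ 0]) auto
  have D0: "0 \<le> D g" if "g \<in> carrier G" for g
    unfolding D_def using S that length_nonneg False by (intro cINF_greatest) auto
  have Dle: "D g \<le> \<rho> (inv s \<otimes> g)" if "g \<in> carrier G" "s \<in> S" for g s
    unfolding D_def using that bdd by (intro cINF_lower) auto
  have D1: "D (g \<otimes> h) \<le> D g + \<rho> h" if g: "g \<in> carrier G" and h: "h \<in> carrier G" for g h
  proof -
    have "D (g \<otimes> h) - \<rho> h \<le> \<rho> (inv s \<otimes> g)" if s: "s \<in> S" for s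
      using Dle[of "g \<otimes> h" s] length_mult[of "inv s \<otimes> g" h] g h s S by (auto simp: m_assoc)
    then have "D (g \<otimes> h) - \<rho> h \<le> D g" unfolding D_def[of g] using False by (intro cINF_greatest) auto
    then show ?thesis by simp
  qed
  have D2: "\<bar>D (g \<otimes> h) - D g\<bar> \<le> \<rho> h" if g: "g \<in> carrier G" and h: "h \<in> carrier G" for g h
    using D1[OF g h] D1[of "g \<otimes> h" "inv h"] g h length_inv[OF h] by (simp add: m_assoc)
  let ?F = "\<lambda>g\<in>carrier G. min r (D g)"
  have "\<bar>min r a - min r b\<bar> \<le> \<bar>a - b\<bar>" for a b :: real by linarith
  then have "\<bar>min r (D (g \<otimes> h)) - min r (D g)\<bar> \<le> \<rho> h" if "g \<in> carrier G" "h \<in> carrier G" for g h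
    using D2[OF that] by (rule order_trans)
  then have "?F \<in> lipschitz_functions r"
    using D0 r unfolding lipschitz_functions_def by auto
  moreover have "?F s = 0" if "s \<in> S" for s
    using Dle[of s s] D0[of s] that S r length_one by auto
  moreover have "?F g = r" if "g \<in> carrier G" "\<And>s. s \<in> S \<Longrightarrow> r \<le> \<rho> (inv s \<otimes> g)" for g
  proof -
    have "r \<le> D g" unfolding D_def using that False by (intro cINF_greatest) auto
    then show ?thesis using that by simp
  qed
  ultimately show thesis by (rule that)
qed

text \<open>The orbit of a point defines sets of group elements which a Lipschitz function on the group
  separates.  The functions arising this way form a flow over \<open>X\<close>, and a section of it
  transports the separation back to \<open>X\<close>.\<close>

lemma lipschitz_separation:
  assumes M: "universal_minimal_flow G T X a" and A: "openin X A" and B: "openin X B" and r: "0 \<le> r"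
    and sep: "\<And>x u. x \<in> A \<Longrightarrow> u \<in> carrier G \<Longrightarrow> \<rho> u < r \<Longrightarrow> a x u \<notin> B"
  shows "\<exists>f. continuous_map X euclideanreal f \<and>
    (\<forall>x\<in>topspace X. \<forall>g\<in>carrier G. \<bar>f (a x g) - f x\<bar> \<le> \<rho> g) \<and> (\<forall>x\<in>A. f x = 0) \<and> (\<forall>x\<in>B. f x = r)"
proof -
  note T = topspace_eq
  have fl: "flow G T X a" and "topspace X \<noteq> {}"
    using M by (auto simp: universal_minimal_flow_def minimal_flow_def)
  then obtain x0 where x0: "x0 \<in> topspace X" by blast
  let ?L = "lipschitz_space r"
  let ?c = "\<lambda>F g. \<lambda>h\<in>carrier G. F (g \<otimes> h)"
  let ?P = "prod_topology X ?L"
  let ?d = "\<lambda>z g. (a (fst z) g, ?c (snd z) g)"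
  have AX: "A \<subseteq> topspace X" and BX: "B \<subseteq> topspace X" using A B openin_subset by auto
  have one: "a x \<one> = x" if "x \<in> topspace X" for x using fl that by (simp add: flow_def)
  have assoc: "a (a x g) h = a x (g \<otimes> h)" if "x \<in> topspace X" "g \<in> carrier G" "h \<in> carrier G" for x g h
    using fl that by (simp add: flow_def)
  \<comment> \<open>Pairs of a point and a function that is 0 at the times its orbit is in
    \<open>A\<close> and \<open>r\<close> at the times it is in \<open>B\<close>. Openness of
    \<open>A\<close> and \<open>B\<close> makes these implications closed conditions.\<close>
  define Z where "Z = {z \<in> topspace ?P. \<forall>h\<in>carrier G.
      (a (fst z) h \<in> A \<longrightarrow> snd z h = 0) \<and> (a (fst z) h \<in> B \<longrightarrow> snd z h = r)}"
  have Pfl: "flow G T ?P ?d" by (rule prod_flow[OF fl flow_lipschitz T])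
  have c1: "continuous_map ?P X (\<lambda>z. a (fst z) h)" if "h \<in> carrier G" for h
    using continuous_map_compose[OF continuous_map_fst flow_act_continuous[OF fl T that]] by (simp add: comp_def)
  have c2: "continuous_map ?P euclideanreal (\<lambda>z. snd z h)" if "h \<in> carrier G" for h
    using continuous_map_compose[OF continuous_map_snd continuous_map_lipschitz_eval[OF that]] by (simp add: comp_def)
  have cl: "closedin ?P {z \<in> topspace ?P. a (fst z) h \<in> C \<longrightarrow> snd z h = v}"
    if h: "h \<in> carrier G" and C: "openin X C" for h C v
  proof -
    have "closedin ?P {z \<in> topspace ?P. a (fst z) h \<in> topspace X - C}"
      using C by (intro closedin_continuous_map_preimage[OF c1[OF h]]) auto
    moreover have "closedin ?P {z \<in> topspace ?P. snd z h \<in> {v}}"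
      by (intro closedin_continuous_map_preimage[OF c2[OF h]]) auto
    ultimately have "closedin ?P ({z \<in> topspace ?P. a (fst z) h \<in> topspace X - C} \<union> {z \<in> topspace ?P. snd z h \<in> {v}})"
      by (rule closedin_Un)
    moreover have "{z \<in> topspace ?P. a (fst z) h \<in> topspace X - C} \<union> {z \<in> topspace ?P. snd z h \<in> {v}} =
      {z \<in> topspace ?P. a (fst z) h \<in> C \<longrightarrow> snd z h = v}"
      using flow_closed[OF fl T _ h] by auto
    ultimately show ?thesis by simp
  qed
  have "closedin ?P (\<Inter>h\<in>carrier G. {z \<in> topspace ?P. a (fst z) h \<in> A \<longrightarrow> snd z h = 0} \<inter>
      {z \<in> topspace ?P. a (fst z) h \<in> B \<longrightarrow> snd z h = r})"
    using cl A B one_closed by (intro closedin_Inter) (auto intro: closedin_Int)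
  moreover have "\<dots> = Z" using one_closed by (auto simp: Z_def)
  ultimately have Zc: "closedin ?P Z" by simp
  then have ZP: "Z \<subseteq> topspace ?P" by (rule closedin_subset)
  have Zinv: "?d z g \<in> Z" if z: "z \<in> Z" and g: "g \<in> carrier G" for z g
  proof -
    have "?d z g \<in> topspace ?P" using flow_closed[OF Pfl T _ g] z ZP by blast
    moreover have "fst z \<in> topspace X" using z ZP by auto
    ultimately show ?thesis using z g assoc unfolding Z_def by auto
  qed
  have Zne: "Z \<noteq> {}"
  proof -
    \<comment> \<open>Over \<open>x0\<close> the function is the truncated distance to the times
      spent in \<open>A\<close>. By \<open>sep\<close>, the times spent in \<open>B\<close> are at
      distance at least \<open>r\<close> from them.\<close>
    define S where "S = {g \<in> carrier G. a x0 g \<in> A}"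
    obtain F where F: "F \<in> lipschitz_functions r" "\<And>s. s \<in> S \<Longrightarrow> F s = 0"
      "\<And>g. g \<in> carrier G \<Longrightarrow> (\<And>s. s \<in> S \<Longrightarrow> r \<le> \<rho> (inv s \<otimes> g)) \<Longrightarrow> F g = r"
      using distance_function[OF _ r, of S] by (auto simp: S_def)
    have "F h = r" if h: "h \<in> carrier G" "a x0 h \<in> B" for h
    proof (rule F(3)[OF h(1)])
      fix s assume s: "s \<in> S"
      then have "a (a x0 s) (inv s \<otimes> h) = a x0 h"
        using x0 h assoc[of x0 s "inv s \<otimes> h"] by (simp add: S_def m_assoc[symmetric])
      then show "r \<le> \<rho> (inv s \<otimes> h)"
        using sep[of "a x0 s" "inv s \<otimes> h"] s h by (force simp: S_def)
    qed
    then have "(x0, F) \<in> Z" using F(1,2) x0 by (simp add: Z_def S_def topspace_lipschitz_space)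
    then show ?thesis by blast
  qed
  have Zfl: "flow G T (subtopology ?P Z) ?d" by (rule subflow[OF Pfl Zc Zinv T])
  have tZ: "topspace (subtopology ?P Z) \<noteq> {}" using ZP Zne by (simp only: topspace_subtopology) blast
  have pr: "G_map G (subtopology ?P Z) ?d X a fst"
    by (simp add: G_map_def continuous_map_from_subtopology continuous_map_fst)
  obtain s where "G_map G X a (subtopology ?P Z) ?d s \<and> (\<forall>x\<in>topspace X. fst (s x) = x)"
    using universal_minimal_flow_section[OF M T is_group Zfl tZ pr] by (rule exE)
  then have s: "G_map G X a (subtopology ?P Z) ?d s" "\<And>x. x \<in> topspace X \<Longrightarrow> fst (s x) = x"
    by auto
  have sc: "continuous_map X ?P s" and sZ: "\<And>x. x \<in> topspace X \<Longrightarrow> s x \<in> Z"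
    and sg: "\<And>x g. x \<in> topspace X \<Longrightarrow> g \<in> carrier G \<Longrightarrow> s (a x g) = ?d (s x) g"
    using s(1) by (auto simp: G_map_def continuous_map_in_subtopology)
  have sF: "snd (s x) \<in> lipschitz_functions r" if "x \<in> topspace X" for x
    using sZ[OF that] ZP by (auto simp: topspace_lipschitz_space)
  \<comment> \<open>The function on \<open>X\<close> is the value at the identity of the function
    attached to \<open>x\<close>. By equivariance its value at \<open>a x g\<close> is the attached
    function at \<open>g\<close>, which gives the Lipschitz bound.\<close>
  show ?thesis
  proof (intro exI[of _ "\<lambda>x. snd (s x) \<one>"] conjI ballI)
    show "continuous_map X euclideanreal (\<lambda>x. snd (s x) \<one>)"
      using continuous_map_compose[OF sc c2[OF one_closed]] by (simp add: comp_def)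
    show "\<bar>snd (s (a x g)) \<one> - snd (s x) \<one>\<bar> \<le> \<rho> g" if "x \<in> topspace X" "g \<in> carrier G" for x g
    proof -
      have "\<bar>snd (s x) (\<one> \<otimes> g) - snd (s x) \<one>\<bar> \<le> \<rho> g"
        using sF[OF that(1)] that(2) one_closed unfolding lipschitz_functions_def by blast
      then show ?thesis using sg[OF that] that(2) by simp
    qed
    show "snd (s x) \<one> = 0" if "x \<in> A" for x
      using sZ[of x] s(2)[of x] one[of x] that AX by (auto simp: Z_def)
    show "snd (s x) \<one> = r" if "x \<in> B" for x
      using sZ[of x] s(2)[of x] one[of x] that BX by (auto simp: Z_def)
  qed
qed

text \<open>In the Samuel compactification of the group this says that the distance from \<open>p\<close> to \<open>q\<close>,
  in the lower semicontinuous metric extending a left-invariant one, is at most \<open>r\<close>.\<close>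

definition near :: "'x topology \<Rightarrow> ('x \<Rightarrow> 'a \<Rightarrow> 'x) \<Rightarrow> real \<Rightarrow> 'x \<Rightarrow> 'x \<Rightarrow> bool" where
  "near X a r p q \<longleftrightarrow> (\<forall>A B. openin X A \<longrightarrow> openin X B \<longrightarrow> p \<in> A \<longrightarrow> q \<in> B \<longrightarrow>
     (\<exists>x\<in>A. \<exists>u\<in>carrier G. \<rho> u < r \<and> a x u \<in> B))"

text \<open>A sequence converging to \<open>p\<close> with terms that are not near \<open>p\<close> thins out to one whose even and
  odd terms are separated by a continuous function.\<close>

lemma metrizable_imp_near_neighbourhood:
  assumes M: "universal_minimal_flow G T X a" and X: "metrizable_space X"
    and p: "p \<in> topspace X" and r: "0 < r"
  shows "\<exists>W. openin X W \<and> p \<in> W \<and> (\<forall>q\<in>W. near X a r p q)"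
proof (rule ccontr)
  assume neg: "\<not> ?thesis"
  have bad: "\<exists>q\<in>W. \<not> near X a r p q" if "openin X W" "p \<in> W" for W
    using neg that by blast
  have fl: "flow G T X a" using M by (auto simp: universal_minimal_flow_def minimal_flow_def)
  obtain S d where Sd: "Metric_space S d" "X = Metric_space.mtopology S d"
    using X unfolding metrizable_space_def by blast
  interpret Metric_space S d by (rule Sd(1))
  define N where "N n = mball p (1 / real (Suc n))" for n
  have pS: "p \<in> S" using p Sd(2) by simp
  have N: "openin X (N n)" "p \<in> N n" for n
    unfolding N_def Sd(2) using pS by auto
  have Nbase: "\<exists>k. \<forall>n\<ge>k. N n \<subseteq> V" if V: "openin X V" "p \<in> V" for V
  proof -
    obtain e where e: "e > 0" "mball p e \<subseteq> V" using V by (auto simp: Sd(2) openin_mtopology)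
    obtain k where k: "1 / real (Suc k) < e" using nat_approx_posE[OF e(1)] by blast
    have "N n \<subseteq> V" if "n \<ge> k" for n
    proof -
      have "1 / real (Suc n) \<le> 1 / real (Suc k)" using that by (simp add: frac_le)
      then have "N n \<subseteq> mball p e" unfolding N_def using k by (intro mball_subset_concentric) simp
      then show ?thesis using e(2) by blast
    qed
    then show ?thesis by blast
  qed
  \<comment> \<open>Failure of nearness is witnessed by open sets that are far in this sense;
    shrinking them keeps them far.\<close>
  define far where "far A B \<longleftrightarrow> (\<forall>x\<in>A. \<forall>u\<in>carrier G. \<rho> u < r \<longrightarrow> a x u \<notin> B)" for A B
  have step: "\<exists>B W'. openin X B \<and> B \<noteq> {} \<and> openin X W' \<and> p \<in> W' \<and> B \<subseteq> W \<inter> N n \<and> W' \<subseteq> W \<and> far W' B"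
    if W: "openin X W" "p \<in> W" for W n
  proof -
    have "openin X (W \<inter> N n)" "p \<in> W \<inter> N n" using W N by auto
    from bad[OF this] obtain q where q: "q \<in> W \<inter> N n" "\<not> near X a r p q" by blast
    then obtain A B where AB: "openin X A" "openin X B" "p \<in> A" "q \<in> B" "far A B"
      unfolding near_def far_def by blast
    have "openin X (B \<inter> (W \<inter> N n))" "openin X (A \<inter> W)" using AB W N by auto
    moreover have "q \<in> B \<inter> (W \<inter> N n)" "p \<in> A \<inter> W" using AB q W by auto
    moreover have "far (A \<inter> W) (B \<inter> (W \<inter> N n))" using AB(5) by (auto simp: far_def)
    ultimately show ?thesis
      by (intro exI[of _ "B \<inter> (W \<inter> N n)"] exI[of _ "A \<inter> W"]) auto
  qed
  \<comment> \<open>Each stage chooses a pair of an open set \<open>B n\<close> close to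
    \<open>p\<close> and a neighbourhood \<open>W n\<close> of \<open>p\<close> that is far from it.
    All later choices stay inside \<open>W n\<close>.\<close>
  have "\<exists>f. \<forall>n. (openin X (fst (f n)) \<and> fst (f n) \<noteq> {} \<and> openin X (snd (f n)) \<and> p \<in> snd (f n) \<and>
        fst (f n) \<subseteq> N n \<and> far (snd (f n)) (fst (f n))) \<and>
      (fst (f (Suc n)) \<subseteq> snd (f n) \<and> snd (f (Suc n)) \<subseteq> snd (f n))"
  proof (rule dependent_nat_choice)
    obtain B W' where "openin X B" "B \<noteq> {}" "openin X W'" "p \<in> W'" "B \<subseteq> topspace X \<inter> N 0" "far W' B"
      using step[OF openin_topspace p, of 0] by blast
    then show "\<exists>x. openin X (fst x) \<and> fst x \<noteq> {} \<and> openin X (snd x) \<and> p \<in> snd x \<and> fst x \<subseteq> N 0 \<and> far (snd x) (fst x)"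
      by (intro exI[of _ "(B, W')"]) simp
  next
    fix x and n
    assume x: "openin X (fst x) \<and> fst x \<noteq> {} \<and> openin X (snd x) \<and> p \<in> snd x \<and> fst x \<subseteq> N n \<and> far (snd x) (fst x)"
    then obtain B W' where "openin X B" "B \<noteq> {}" "openin X W'" "p \<in> W'" "B \<subseteq> snd x \<inter> N (Suc n)"
      "W' \<subseteq> snd x" "far W' B"
      using step[of "snd x" "Suc n"] by blast
    then show "\<exists>y. (openin X (fst y) \<and> fst y \<noteq> {} \<and> openin X (snd y) \<and> p \<in> snd y \<and> fst y \<subseteq> N (Suc n) \<and>
        far (snd y) (fst y)) \<and> fst y \<subseteq> snd x \<and> snd y \<subseteq> snd x"
      by (intro exI[of _ "(B, W')"]) simp
  qed
  then obtain f where f: "\<forall>n. (openin X (fst (f n)) \<and> fst (f n) \<noteq> {} \<and> openin X (snd (f n)) \<and> p \<in> snd (f n) \<and>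
        fst (f n) \<subseteq> N n \<and> far (snd (f n)) (fst (f n))) \<and>
      (fst (f (Suc n)) \<subseteq> snd (f n) \<and> snd (f (Suc n)) \<subseteq> snd (f n))"
    by (rule exE)
  define B where "B n = fst (f n)" for n
  define W where "W n = snd (f n)" for n
  have B: "openin X (B n)" "B n \<noteq> {}" "B n \<subseteq> N n" "far (W n) (B n)" "B (Suc n) \<subseteq> W n" "W (Suc n) \<subseteq> W n" for n
    using spec[OF f, of n] by (simp_all add: B_def W_def)
  have Wmono: "W n \<subseteq> W m" if "m \<le> n" for m n
    using that by (induction n rule: dec_induct) (use B(6) in blast)+
  have BW: "B n \<subseteq> W m" if mn: "m < n" for m n
  proof -
    obtain k where "n = Suc k" "m \<le> k" using less_imp_Suc_add[OF mn] by auto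
    then show ?thesis using B(5)[of k] Wmono[of m k] by blast
  qed
  have far1: "far (B n) (B m)" if "m < n" for m n
    using B(4)[of m] BW[OF that] unfolding far_def by blast
  \<comment> \<open>Moving back by the inverse, which has the same length, reverses the
    roles.\<close>
  have far2: "far (B m) (B n)" if "m < n" for m n
    unfolding far_def
  proof (intro ballI impI notI)
    fix x u assume x: "x \<in> B m" and u: "u \<in> carrier G" "\<rho> u < r" "a x u \<in> B n"
    have "x \<in> topspace X" using x B(1)[of m] openin_subset by blast
    then have "a (a x u) (inv u) = x" by (rule flow_invert(1)[OF fl is_group _ u(1)])
    then show False using far1[OF that] u x length_inv[OF u(1)] unfolding far_def by (metis inv_closed)
  qed
  have far: "far (B m) (B n)" if "m \<noteq> n" for m n
    using far1 far2 that by (meson linorder_neqE_nat)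
  \<comment> \<open>Far sets are collected by parity. A Lipschitz function is then 0 on the even
    ones and \<open>r\<close> on the odd ones, although both kinds accumulate at
    \<open>p\<close>.\<close>
  define B0 where "B0 = (\<Union>k. B (2 * k))"
  define B1 where "B1 = (\<Union>k. B (2 * k + 1))"
  have o: "openin X B0" "openin X B1" using B(1) by (auto simp: B0_def B1_def)
  have sep: "a x u \<notin> B1" if x: "x \<in> B0" "u \<in> carrier G" "\<rho> u < r" for x u
  proof
    assume "a x u \<in> B1"
    then obtain k l where "x \<in> B (2 * k)" "a x u \<in> B (2 * l + 1)" using x by (auto simp: B0_def B1_def)
    moreover have "2 * k \<noteq> 2 * l + 1" by presburger
    ultimately show False using far[of "2 * k" "2 * l + 1"] x unfolding far_def by blast
  qed
  obtain h where h: "continuous_map X euclideanreal h" "\<forall>x\<in>B0. h x = 0" "\<forall>x\<in>B1. h x = r"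
    using lipschitz_separation[OF M o less_imp_le[OF r] sep] by blast
  \<comment> \<open>An open interval of length \<open>r\<close> cannot contain both 0 and
    \<open>r\<close>, yet \<open>V\<close> contains \<open>B n\<close> for all large
    \<open>n\<close>.\<close>
  define V where "V = {x \<in> topspace X. h x \<in> {h p - r / 2 <..< h p + r / 2}}"
  have "openin X V" unfolding V_def by (rule openin_continuous_map_preimage[OF h(1)]) auto
  moreover have "p \<in> V" using p r by (simp add: V_def)
  ultimately obtain k where k: "\<And>n. n \<ge> k \<Longrightarrow> N n \<subseteq> V" using Nbase by metis
  obtain x y where xy: "x \<in> B (2 * k)" "y \<in> B (2 * k + 1)" using B(2) by blast
  then have "x \<in> B0" "y \<in> B1" unfolding B0_def B1_def by blast+
  moreover have "x \<in> V" "y \<in> V" using xy B(3) k[of "2 * k"] k[of "2 * k + 1"] by fastforce+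
  ultimately show False using h(2,3) r by (auto simp: V_def)
qed

lemma metrizable_imp_finite_near_net:
  assumes M: "universal_minimal_flow G T X a" and X: "metrizable_space X" and r: "0 < r"
  obtains P where "finite P" "P \<subseteq> topspace X" "\<And>q. q \<in> topspace X \<Longrightarrow> \<exists>p\<in>P. near X a r p q"
proof -
  have cpt: "compact_space X" using M by (simp add: universal_minimal_flow_def minimal_flow_def flow_def)
  obtain W where W: "\<And>p. p \<in> topspace X \<Longrightarrow> openin X (W p)" "\<And>p. p \<in> topspace X \<Longrightarrow> p \<in> W p"
    "\<And>p q. p \<in> topspace X \<Longrightarrow> q \<in> W p \<Longrightarrow> near X a r p q"
    using metrizable_imp_near_neighbourhood[OF M X _ r] by metis
  have "\<exists>\<F>. finite \<F> \<and> \<F> \<subseteq> W ` topspace X \<and> topspace X \<subseteq> \<Union>\<F>"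
    by (rule compactinD[OF cpt[unfolded compact_space_def]]) (use W in auto)
  then obtain \<F> where \<F>: "finite \<F>" "\<F> \<subseteq> W ` topspace X" "topspace X \<subseteq> \<Union>\<F>" by blast
  obtain P where P: "P \<subseteq> topspace X" "finite P" "\<F> = W ` P" using finite_subset_image[OF \<F>(1,2)] by blast
  show thesis
  proof (rule that[OF P(2,1)])
    show "\<exists>p\<in>P. near X a r p q" if "q \<in> topspace X" for q
      using that \<F>(3) P(1,3) W(3) by blast
  qed
qed

end

section \<open>Equivariant maps from a metrizable universal minimal flow\<close>

lemma continuous_mapI_local:
  assumes "\<And>x W. x \<in> topspace X \<Longrightarrow> openin Y W \<Longrightarrow> f x \<in> W \<Longrightarrow> \<exists>U. openin X U \<and> x \<in> U \<and> f ` U \<subseteq> W"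
    and f: "\<And>x. x \<in> topspace X \<Longrightarrow> f x \<in> topspace Y"
  shows "continuous_map X Y f"
  unfolding continuous_map_def
proof (intro conjI allI impI)
  show "f \<in> topspace X \<rightarrow> topspace Y" using f by auto
  fix W assume W: "openin Y W"
  show "openin X {x \<in> topspace X. f x \<in> W}"
    unfolding openin_subopen[of X "{x \<in> topspace X. f x \<in> W}"]
  proof
    fix x assume "x \<in> {x \<in> topspace X. f x \<in> W}"
    then obtain U where "openin X U" "x \<in> U" "f ` U \<subseteq> W" using assms(1)[OF _ W] by blast
    then show "\<exists>U. openin X U \<and> x \<in> U \<and> U \<subseteq> {x \<in> topspace X. f x \<in> W}"
      using openin_subset[of X U] by (intro exI[of _ U]) auto
  qed
qed

lemma compact_Hausdorff_shrink:
  assumes X: "compact_space X" "Hausdorff_space X" and W: "openin X W" "x \<in> W"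
  obtains V where "openin X V" "x \<in> V" "X closure_of V \<subseteq> W"
proof -
  have "regular_space X" using X by (rule compact_Hausdorff_imp_regular_space)
  moreover have "closedin X (topspace X - W)" "x \<in> topspace X - (topspace X - W)"
    using W openin_subset by auto
  ultimately obtain V where "openin X V" "x \<in> V" "disjnt (topspace X - W) (X closure_of V)"
    unfolding regular_space by blast
  moreover from this(3) have "X closure_of V \<subseteq> W"
    using closure_of_subset_topspace[of X V] by (auto simp: disjnt_def)
  ultimately show thesis using that by blast
qed

text \<open>Used with M(H) as source. Combined with universality, it makes the minimal
  \<open>H\<close>-subflows of a flow exactly the images of M(H), each being the orbit closure of
  any of its points.\<close>

lemma minimal_flow_image:
  assumes M: "minimal_flow G T M m" and X: "flow G T X a" and f: "G_map G M m X a f"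
    and T: "topspace T = carrier G"
  shows "closedin X (f ` topspace M)" "f ` topspace M \<subseteq> topspace X"
    and "p \<in> topspace M \<Longrightarrow> X closure_of (a (f p) ` carrier G) = f ` topspace M"
    and "minimal_flow G T (subtopology X (f ` topspace M)) a"
proof -
  let ?C = "f ` topspace M"
  have fl: "flow G T M m" and Mne: "topspace M \<noteq> {}" using M by (auto simp: minimal_flow_def)
  have c: "continuous_map M X f"
    and eq: "\<And>p g. p \<in> topspace M \<Longrightarrow> g \<in> carrier G \<Longrightarrow> f (m p g) = a (f p) g"
    using f by (auto simp: G_map_def)
  have "compactin X ?C" using image_compactin[OF _ c] fl by (simp add: flow_def compact_space_def)
  then show cl: "closedin X ?C" using X by (simp add: compactin_imp_closedin flow_def)
  then show sub: "?C \<subseteq> topspace X" by (rule closedin_subset)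
  have inv: "a x g \<in> ?C" if "x \<in> ?C" "g \<in> carrier G" for x g
    using that eq flow_closed[OF fl T] by (metis (no_types, lifting) image_iff)
  show orb: "X closure_of (a (f p) ` carrier G) = ?C" if p: "p \<in> topspace M" for p
  proof
    have "a (f p) ` carrier G \<subseteq> ?C" using inv p by blast
    then show "X closure_of (a (f p) ` carrier G) \<subseteq> ?C" using cl by (rule closure_of_minimal)
    have "?C = f ` (M closure_of (m p ` carrier G))" using M p by (simp add: minimal_flow_def)
    also have "\<dots> \<subseteq> X closure_of (f ` (m p ` carrier G))" by (rule continuous_map_image_closure_subset[OF c])
    also have "f ` (m p ` carrier G) = a (f p) ` carrier G" using eq p by (auto simp: image_iff)
    finally show "?C \<subseteq> X closure_of (a (f p) ` carrier G)" .
  qed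
  have "subtopology X ?C closure_of (a x ` carrier G) = topspace (subtopology X ?C)" if "x \<in> ?C" for x
  proof -
    have "a x ` carrier G \<subseteq> ?C" using inv that by blast
    then show ?thesis using orb that sub by (auto simp: closure_of_subtopology Int_absorb1 Int_absorb2)
  qed
  moreover have "topspace (subtopology X ?C) = ?C" using sub by auto
  ultimately show "minimal_flow G T (subtopology X ?C) a"
    using subflow[OF X cl inv T] Mne unfolding minimal_flow_def by auto
qed

context length_group
begin

text \<open>Test sets are pulled back along \<open>f\<close>. That \<open>r\<close> is the same for
  every equivariant \<open>f\<close> is the equicontinuity of the whole family.\<close>

lemma near_image:
  assumes near: "near X a r p q" and f: "G_map G X a Y b f" and pq: "p \<in> topspace X" "q \<in> topspace X"
  shows "near Y b r (f p) (f q)"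
  unfolding near_def
proof (intro allI impI)
  fix A B assume AB: "openin Y A" "openin Y B" "f p \<in> A" "f q \<in> B"
  have c: "continuous_map X Y f" using f by (simp add: G_map_def)
  have "openin X {x \<in> topspace X. f x \<in> A}" "openin X {x \<in> topspace X. f x \<in> B}"
    using openin_continuous_map_preimage[OF c] AB by auto
  moreover have "p \<in> {x \<in> topspace X. f x \<in> A}" "q \<in> {x \<in> topspace X. f x \<in> B}" using pq AB by auto
  ultimately obtain x u where "x \<in> topspace X" "f x \<in> A" "u \<in> carrier G" "\<rho> u < r" "f (a x u) \<in> B"
    using near unfolding near_def by blast
  then show "\<exists>x\<in>A. \<exists>u\<in>carrier G. \<rho> u < r \<and> b x u \<in> B"
    using f unfolding G_map_def by metis
qed

lemma flow_small_action:
  assumes X: "flow G T X a" and W: "openin X W" "x \<in> W"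
  obtains V r where "openin X V" "x \<in> V" "0 < r"
    "\<And>y u. y \<in> V \<Longrightarrow> u \<in> carrier G \<Longrightarrow> \<rho> u < r \<Longrightarrow> a y u \<in> W"
proof -
  have xX: "x \<in> topspace X" using W openin_subset by blast
  have c: "continuous_map (prod_topology X T) X (\<lambda>(x, g). a x g)" and one: "a x \<one> = x"
    using X xX by (auto simp: flow_def)
  have "openin (prod_topology X T) {z \<in> topspace (prod_topology X T). (\<lambda>(x, g). a x g) z \<in> W}"
    by (rule openin_continuous_map_preimage[OF c W(1)])
  moreover have "(x, \<one>) \<in> {z \<in> topspace (prod_topology X T). (\<lambda>(x, g). a x g) z \<in> W}"
    using xX W one by (simp add: topspace_eq)
  ultimately obtain V U where VU: "openin X V" "openin T U" "x \<in> V" "\<one> \<in> U"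
    "V \<times> U \<subseteq> {z \<in> topspace (prod_topology X T). (\<lambda>(x, g). a x g) z \<in> W}"
    unfolding openin_prod_topology_alt by meson
  obtain r where r: "0 < r" "\<And>u. u \<in> carrier G \<Longrightarrow> \<rho> u < r \<Longrightarrow> \<one> \<otimes> u \<in> U"
    using VU(2,4) unfolding openin_iff by blast
  show thesis
  proof (rule that[OF VU(1,3) r(1)])
    fix y u assume "y \<in> V" "u \<in> carrier G" "\<rho> u < r"
    then have "(y, u) \<in> V \<times> U" using r(2)[of u] by simp
    from subsetD[OF VU(5) this] show "a y u \<in> W" by simp
  qed
qed

text \<open>A point near \<open>y\<close> is only a limit of short translates of points close to
  \<open>y\<close>. Hence these translates are kept in a smaller set \<open>W'\<close> whose closure
  lies in \<open>W\<close>.\<close>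

lemma near_small:
  assumes X: "flow G T X a" and W: "openin X W" "x \<in> W"
  obtains V r where "openin X V" "x \<in> V" "0 < r"
    "\<And>y z. y \<in> V \<Longrightarrow> z \<in> topspace X \<Longrightarrow> near X a r y z \<Longrightarrow> z \<in> W"
proof -
  obtain W' where W': "openin X W'" "x \<in> W'" "X closure_of W' \<subseteq> W"
    using compact_Hausdorff_shrink[OF _ _ W] X by (auto simp: flow_def)
  obtain V r where V: "openin X V" "x \<in> V" "0 < r"
    and act: "\<And>y u. y \<in> V \<Longrightarrow> u \<in> carrier G \<Longrightarrow> \<rho> u < r \<Longrightarrow> a y u \<in> W'"
    using flow_small_action[OF X W'(1,2)] by metis
  show thesis
  proof (rule that[OF V])
    fix y z assume y: "y \<in> V" and z: "z \<in> topspace X" "near X a r y z"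
    show "z \<in> W"
    proof (rule ccontr)
      assume "z \<notin> W"
      then have "z \<in> topspace X - X closure_of W'" "openin X (topspace X - X closure_of W')"
        using z W' by auto
      then obtain w u where "w \<in> V" "u \<in> carrier G" "\<rho> u < r" "a w u \<in> topspace X - X closure_of W'"
        using z(2) V(1) y unfolding near_def by meson
      then show False using act[of w u] closure_of_subset[of W' X] W'(1) openin_subset by blast
    qed
  qed
qed

section \<open>Compactness of the space of equivariant maps\<close>

definition G_map_set :: "'y topology \<Rightarrow> ('y \<Rightarrow> 'a \<Rightarrow> 'y) \<Rightarrow> 'x topology \<Rightarrow> ('x \<Rightarrow> 'a \<Rightarrow> 'x) \<Rightarrow> ('y \<Rightarrow> 'x) set" where
  "G_map_set M m X a = {\<phi> \<in> topspace (product_topology (\<lambda>_. X) (topspace M)). G_map G M m X a \<phi>}"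

text \<open>Equivariance survives pointwise limits one coordinate at a time. Continuity survives
  because all the maps are equicontinuous: a neighbourhood \<open>U\<close> of points near
  \<open>p\<close> works for every one of them.\<close>

lemma closedin_G_map_set:
  assumes M: "universal_minimal_flow G T M m" "metrizable_space M" and X: "flow G T X a"
  shows "closedin (product_topology (\<lambda>_. X) (topspace M)) (G_map_set M m X a)"
proof -
  let ?P = "product_topology (\<lambda>_. X) (topspace M)"
  let ?S = "G_map_set M m X a"
  have Mfl: "flow G T M m" using M by (simp add: universal_minimal_flow_def minimal_flow_def)
  have XH: "compact_space X" "Hausdorff_space X" using X by (auto simp: flow_def)
  have proj: "continuous_map ?P X (\<lambda>\<phi>. \<phi> p)" if "p \<in> topspace M" for p
    by (rule continuous_map_product_projection[OF that])
  have "\<phi> \<in> ?S" if \<phi>: "\<phi> \<in> ?P closure_of ?S" for \<phi>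
  proof -
    have \<phi>P: "\<phi> \<in> topspace ?P" using \<phi> by (rule in_closure_of[THEN iffD1, THEN conjunct1])
    have "\<phi> (m p g) = a (\<phi> p) g" if pg: "p \<in> topspace M" "g \<in> carrier G" for p g
    proof (rule forall_in_closure_of_eq[OF \<phi> XH(2)])
      show "continuous_map ?P X (\<lambda>\<phi>. \<phi> (m p g))"
        using flow_closed[OF Mfl topspace_eq pg] by (rule proj)
      show "continuous_map ?P X (\<lambda>\<phi>. a (\<phi> p) g)"
        using continuous_map_compose[OF proj[OF pg(1)] flow_act_continuous[OF X topspace_eq pg(2)]]
        by (simp add: comp_def)
      show "\<psi> (m p g) = a (\<psi> p) g" if "\<psi> \<in> ?S" for \<psi>
        using that pg by (simp add: G_map_set_def G_map_def)
    qed
    moreover have "continuous_map M X \<phi>"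
    proof (rule continuous_mapI_local)
      show "\<phi> p \<in> topspace X" if "p \<in> topspace M" for p using \<phi>P that by (auto simp: PiE_iff)
      fix p W assume p: "p \<in> topspace M" and W: "openin X W" "\<phi> p \<in> W"
      obtain W1 where W1: "openin X W1" "\<phi> p \<in> W1" "X closure_of W1 \<subseteq> W"
        using compact_Hausdorff_shrink[OF XH W] .
      obtain V r where V: "openin X V" "\<phi> p \<in> V" "0 < r"
        and small: "\<And>y z. y \<in> V \<Longrightarrow> z \<in> topspace X \<Longrightarrow> near X a r y z \<Longrightarrow> z \<in> W1"
        using near_small[OF X W1(1,2)] by metis
      obtain U where U: "openin M U" "p \<in> U" "\<And>q. q \<in> U \<Longrightarrow> near M m r p q"
        using metrizable_imp_near_neighbourhood[OF M p V(3)] by blast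
      have UM: "U \<subseteq> topspace M" using U(1) by (rule openin_subset)
      have "\<phi> q \<in> X closure_of W1" if q: "q \<in> U" for q
      proof (rule ccontr)
        assume no: "\<phi> q \<notin> X closure_of W1"
        have qM: "q \<in> topspace M" using q UM by blast
        \<comment> \<open>Approximating \<open>\<phi>\<close> at the two coordinates
          \<open>p\<close> and \<open>q\<close> by an actual map \<open>\<psi>\<close> transfers
          nearness. It forces \<open>\<psi> q\<close> into \<open>W1\<close>, which \<open>N\<close>
          forbids.\<close>
        define N where "N = {\<psi> \<in> topspace ?P. \<psi> p \<in> V} \<inter> {\<psi> \<in> topspace ?P. \<psi> q \<in> topspace X - X closure_of W1}"
        have "openin ?P N"
          unfolding N_def using proj p qM V(1) by (intro openin_Int openin_continuous_map_preimage) auto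
        moreover have "\<phi> \<in> N" using \<phi>P V(2) no qM p by (auto simp: N_def PiE_iff)
        moreover have "\<forall>U. \<phi> \<in> U \<and> openin ?P U \<longrightarrow> (\<exists>\<psi>. \<psi> \<in> ?S \<and> \<psi> \<in> U)"
          using \<phi> by (simp only: in_closure_of) simp
        ultimately obtain \<psi> where \<psi>: "\<psi> \<in> ?S" "\<psi> \<in> N" by meson
        have \<psi>N: "\<psi> p \<in> V" "\<psi> q \<in> topspace X - X closure_of W1"
          using \<psi>(2) unfolding N_def by auto
        have "G_map G M m X a \<psi>" using \<psi>(1) by (simp add: G_map_set_def)
        then have "near X a r (\<psi> p) (\<psi> q)"
          by (rule near_image[OF U(3)[OF q] _ p qM])
        then have "\<psi> q \<in> W1" using small \<psi>N by blast
        then show False using \<psi>N(2) closure_of_subset[of W1 X] W1(1) openin_subset by blast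
      qed
      then show "\<exists>U. openin M U \<and> p \<in> U \<and> \<phi> ` U \<subseteq> W" using U(1,2) W1(3) by blast
    qed
    ultimately show ?thesis using \<phi>P by (simp add: G_map_set_def G_map_def)
  qed
  then have "?P closure_of ?S \<subseteq> ?S" by blast
  moreover have "?S \<subseteq> topspace ?P" by (auto simp: G_map_set_def)
  ultimately show ?thesis using closure_of_subset_eq by blast
qed

text \<open>As in the Arzela-Ascoli theorem, pointwise convergence of equicontinuous maps already
  makes evaluation jointly continuous: the map moves its value at \<open>snd z\<close> slightly, and
  nearness controls the change to other points.\<close>

lemma continuous_map_G_map_eval:
  assumes M: "universal_minimal_flow G T M m" "metrizable_space M" and X: "flow G T X a"
  shows "continuous_map (prod_topology (subtopology (product_topology (\<lambda>_. X) (topspace M)) (G_map_set M m X a)) M)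
    X (\<lambda>z. fst z (snd z))"
proof -
  let ?P = "product_topology (\<lambda>_. X) (topspace M)"
  let ?S = "G_map_set M m X a"
  have tS: "topspace (subtopology ?P ?S) = ?S" by (auto simp: G_map_set_def)
  show ?thesis
  proof (rule continuous_mapI_local)
    fix z assume "z \<in> topspace (prod_topology (subtopology ?P ?S) M)"
    then have z: "fst z \<in> ?S" "snd z \<in> topspace M" using tS by auto
    then show "fst z (snd z) \<in> topspace X" by (auto simp: G_map_set_def PiE_iff)
    fix W assume W: "openin X W" "fst z (snd z) \<in> W"
    obtain V r where V: "openin X V" "fst z (snd z) \<in> V" "0 < r"
      and small: "\<And>y w. y \<in> V \<Longrightarrow> w \<in> topspace X \<Longrightarrow> near X a r y w \<Longrightarrow> w \<in> W"
      using near_small[OF X W] by metis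
    obtain U where U: "openin M U" "snd z \<in> U" "\<And>q. q \<in> U \<Longrightarrow> near M m r (snd z) q"
      using metrizable_imp_near_neighbourhood[OF M z(2) V(3)] by blast
    let ?N = "{\<psi> \<in> topspace (subtopology ?P ?S). \<psi> (snd z) \<in> V}"
    have "openin (subtopology ?P ?S) ?N"
      by (rule openin_continuous_map_preimage[OF continuous_map_from_subtopology V(1)])
        (rule continuous_map_product_projection[OF z(2)])
    then have "openin (prod_topology (subtopology ?P ?S) M) (?N \<times> U)" using U(1) by (simp add: openin_prod_Times_iff)
    moreover have "z \<in> ?N \<times> U" using z V(2) U(2) tS by (cases z) auto
    moreover have "fst w (snd w) \<in> W" if w: "w \<in> ?N \<times> U" for w
    proof -
      have w': "fst w \<in> ?S" "fst w (snd z) \<in> V" "snd w \<in> U" using w tS by auto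
      then have wM: "snd w \<in> topspace M" using U(1) openin_subset by blast
      have "G_map G M m X a (fst w)" using w'(1) by (simp add: G_map_set_def)
      then have "near X a r (fst w (snd z)) (fst w (snd w))"
        by (rule near_image[OF U(3)[OF w'(3)] _ z(2) wM])
      moreover have "fst w (snd w) \<in> topspace X" using w'(1) wM by (auto simp: G_map_set_def PiE_iff)
      ultimately show ?thesis using small w'(2) by blast
    qed
    ultimately show "\<exists>U. openin (prod_topology (subtopology ?P ?S) M) U \<and> z \<in> U \<and> (\<lambda>z. fst z (snd z)) ` U \<subseteq> W"
      by blast
  qed
qed

text \<open>Both sets are images of a compact space under evaluation. The second one is the union of all
  minimal subflows, the first one the relation of lying in a common minimal subflow.\<close>

lemma closedin_minimal_relation:
  assumes M: "universal_minimal_flow G T M m" "metrizable_space M" and X: "flow G T X a"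
  shows "closedin (prod_topology X X)
      {(\<phi> p, \<phi> q) | \<phi> p q. G_map G M m X a \<phi> \<and> p \<in> topspace M \<and> q \<in> topspace M}" (is "closedin _ ?R")
    and "closedin X {\<phi> p | \<phi> p. G_map G M m X a \<phi> \<and> p \<in> topspace M}" (is "closedin _ ?A")
proof -
  let ?P = "product_topology (\<lambda>_. X) (topspace M)"
  let ?S = "G_map_set M m X a"
  let ?H = "subtopology ?P ?S"
  have Mfl: "flow G T M m" using M by (simp add: universal_minimal_flow_def minimal_flow_def)
  then have Mc: "compact_space M" by (simp add: flow_def)
  have XH: "compact_space X" "Hausdorff_space X" using X by (auto simp: flow_def)
  have tS: "topspace ?H = ?S" by (auto simp: G_map_set_def)
  have "compact_space ?P" using XH(1) by (simp add: compact_space_product_topology)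
  then have Hc: "compact_space ?H"
    using closedin_compact_space[OF _ closedin_G_map_set[OF M X]] compact_space_subtopology by blast
  have ev: "continuous_map (prod_topology ?H M) X (\<lambda>z. fst z (snd z))"
    by (rule continuous_map_G_map_eval[OF M X])
  \<comment> \<open>\<open>G_map\<close> says nothing about values outside
    \<open>topspace M\<close>; the restriction gives a representative in the product space.\<close>
  have restr: "\<exists>\<psi>\<in>?S. \<forall>p\<in>topspace M. \<psi> p = \<phi> p" if \<phi>: "G_map G M m X a \<phi>" for \<phi>
  proof (rule bexI[of _ "restrict \<phi> (topspace M)"])
    have c: "continuous_map M X \<phi>" using \<phi> by (simp add: G_map_def)
    have "continuous_map M X (restrict \<phi> (topspace M))"
      by (rule continuous_map_eq[OF c]) simp
    moreover have "restrict \<phi> (topspace M) (m p g) = a (restrict \<phi> (topspace M) p) g"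
      if "p \<in> topspace M" "g \<in> carrier G" for p g
      using \<phi> that flow_closed[OF Mfl topspace_eq that] by (simp add: G_map_def)
    ultimately have "G_map G M m X a (restrict \<phi> (topspace M))"
      unfolding G_map_def by blast
    moreover have "restrict \<phi> (topspace M) \<in> topspace ?P"
      using c by (auto simp: continuous_map_def)
    ultimately show "restrict \<phi> (topspace M) \<in> ?S" unfolding G_map_set_def by blast
  qed simp
  let ?K = "prod_topology ?H (prod_topology M M)"
  have "continuous_map ?K (prod_topology ?H M) (\<lambda>z. (fst z, fst (snd z)))"
    "continuous_map ?K (prod_topology ?H M) (\<lambda>z. (fst z, snd (snd z)))"
    by (intro continuous_map_pairedI continuous_map_fst
        continuous_map_compose[OF continuous_map_snd continuous_map_fst, unfolded comp_def]
        continuous_map_compose[OF continuous_map_snd continuous_map_snd, unfolded comp_def])+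
  from this[THEN continuous_map_compose[OF _ ev]]
  have "continuous_map ?K (prod_topology X X) (\<lambda>z. (fst z (fst (snd z)), fst z (snd (snd z))))"
    by (intro continuous_map_pairedI) (simp_all add: comp_def)
  moreover have "compact_space ?K" using Hc Mc by (simp add: compact_space_prod_topology)
  then have "compactin ?K (topspace ?K)" by (simp only: compact_space_def)
  ultimately have "compactin (prod_topology X X) ((\<lambda>z. (fst z (fst (snd z)), fst z (snd (snd z)))) ` topspace ?K)"
    by (rule image_compactin[rotated])
  moreover have "(\<lambda>z. (fst z (fst (snd z)), fst z (snd (snd z)))) ` topspace ?K = ?R"
  proof
    show "(\<lambda>z. (fst z (fst (snd z)), fst z (snd (snd z)))) ` topspace ?K \<subseteq> ?R"
      using tS by (force simp: G_map_set_def)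
    show "?R \<subseteq> (\<lambda>z. (fst z (fst (snd z)), fst z (snd (snd z)))) ` topspace ?K"
    proof
      fix w assume "w \<in> ?R"
      then obtain \<phi> p q where w: "w = (\<phi> p, \<phi> q)" "G_map G M m X a \<phi>" "p \<in> topspace M" "q \<in> topspace M" by blast
      then obtain \<psi> where "\<psi> \<in> ?S" "\<psi> p = \<phi> p" "\<psi> q = \<phi> q" using restr by metis
      then show "w \<in> (\<lambda>z. (fst z (fst (snd z)), fst z (snd (snd z)))) ` topspace ?K"
        using w tS by (intro image_eqI[of _ _ "(\<psi>, p, q)"]) auto
    qed
  qed
  ultimately have Rc: "compactin (prod_topology X X) ?R" by simp
  then show "closedin (prod_topology X X) ?R"
    using XH(2) by (simp add: compactin_imp_closedin Hausdorff_space_prod_topology)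
  have "compactin X (fst ` ?R)" using Rc continuous_map_fst by (rule image_compactin)
  moreover have "fst ` ?R = ?A" by force
  ultimately show "closedin X ?A" using XH(2) by (simp add: compactin_imp_closedin)
qed

end

section \<open>Group extensions\<close>

abbreviation orbit_closure :: "'x topology \<Rightarrow> ('x \<Rightarrow> 'g \<Rightarrow> 'x) \<Rightarrow> 'g set \<Rightarrow> 'x \<Rightarrow> 'x set" where
  "orbit_closure X a S x \<equiv> X closure_of (a x ` S)"

lemma flow_subgroup:
  assumes X: "flow G T X a" and H: "subgroup H G"
  shows "flow (G\<lparr>carrier := H\<rparr>) (subtopology T H) X a"
proof -
  have "continuous_map (prod_topology X (subtopology T H)) X (\<lambda>(x, g). a x g)"
    using X unfolding flow_def prod_topology_subtopology(2)
    by (intro continuous_map_from_subtopology) simp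
  then show ?thesis
    using X subgroup.mem_carrier[OF H] unfolding flow_def by auto
qed

lemma (in normal) conj_mem:
  assumes "g \<in> carrier G" "h \<in> H"
  shows "\<exists>h'\<in>H. h \<otimes> g = g \<otimes> h'"
proof -
  have eq: "H #> g = g <# H" using coset_eq assms(1) by blast
  have "h \<otimes> g \<in> g <# H" unfolding eq[symmetric] using assms by (auto simp: r_coset_def)
  then show "\<exists>h'\<in>H. h \<otimes> g = g \<otimes> h'" by (auto simp: l_coset_def)
qed

lemma orbit_closure_translate:
  fixes G (structure) and X :: "'x topology"
  assumes X: "flow G T X a" and T: "topspace T = carrier G" and H: "H \<lhd> G"
    and x: "x \<in> topspace X" and y: "y \<in> orbit_closure X a H x" and g: "g \<in> carrier G"
  shows "a y g \<in> orbit_closure X a H (a x g)"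
proof -
  interpret normal H G by (rule H)
  have "(\<lambda>x. a x g) ` (orbit_closure X a H x) \<subseteq> X closure_of ((\<lambda>x. a x g) ` (a x ` H))"
    by (rule continuous_map_image_closure_subset[OF flow_act_continuous[OF X T g]])
  moreover have "(\<lambda>x. a x g) ` (a x ` H) \<subseteq> a (a x g) ` H"
  proof clarify
    fix h assume h: "h \<in> H"
    obtain h' where "h' \<in> H" "h \<otimes> g = g \<otimes> h'" using conj_mem[OF g h] by blast
    then have "a (a x h) g = a (a x g) h'" using X x g h by (auto simp: flow_def)
    then show "a (a x h) g \<in> a (a x g) ` H" using \<open>h' \<in> H\<close> by blast
  qed
  ultimately show ?thesis using y closure_of_mono by blast
qed

text \<open>The points lying in minimal \<open>H\<close>-subflows form a closed set, which is \<open>G\<close>-invariant since \<open>H\<close>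
  is normal; hence these are all points of the minimal flow \<open>X\<close>.\<close>

lemma normal_orbit_closures:
  fixes G (structure) and X :: "'x topology"
  assumes LG: "length_group G T \<rho>" and H: "H \<lhd> G"
    and M: "universal_minimal_flow (G\<lparr>carrier := H\<rparr>) (subtopology T H) M m" "metrizable_space M"
    and X: "minimal_flow G T X a"
  shows "x \<in> topspace X \<Longrightarrow> \<exists>\<phi>. \<exists>p\<in>topspace M. G_map (G\<lparr>carrier := H\<rparr>) M m X a \<phi> \<and> \<phi> p = x \<and>
      orbit_closure X a H x = \<phi> ` topspace M"
    and "x \<in> topspace X \<Longrightarrow> minimal_flow (G\<lparr>carrier := H\<rparr>) (subtopology T H) (subtopology X (orbit_closure X a H x)) a"
    and "x \<in> topspace X \<Longrightarrow> y \<in> orbit_closure X a H x \<Longrightarrow> orbit_closure X a H y = orbit_closure X a H x"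
    and "closedin (prod_topology X X) {(x, y). x \<in> topspace X \<and> y \<in> orbit_closure X a H x}"
proof -
  interpret length_group G T \<rho> by (rule LG)
  interpret normal H G by (rule H)
  let ?H = "G\<lparr>carrier := H\<rparr>" and ?TH = "subtopology T H"
  have sH: "subgroup H G" by (rule subgroup_axioms)
  interpret LH: length_group ?H ?TH \<rho> by (rule length_group_subgroup[OF LG sH])
  have TH: "topspace ?TH = carrier ?H" by (rule LH.topspace_eq)
  have fl: "flow G T X a" and neX: "topspace X \<noteq> {}" using X by (auto simp: minimal_flow_def)
  have flH: "flow ?H ?TH X a" by (rule flow_subgroup[OF fl sH])
  have Mmin: "minimal_flow ?H ?TH M m" using M by (simp add: universal_minimal_flow_def)
  define A where "A = {\<phi> p | \<phi> p. G_map ?H M m X a \<phi> \<and> p \<in> topspace M}"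
  have Acl: "closedin X A" unfolding A_def by (rule LH.closedin_minimal_relation(2)[OF M flH])
  \<comment> \<open>By universality each minimal \<open>H\<close>-subflow is an image of M(H), so
    \<open>A\<close> is the union of all of them.\<close>
  have minA: "C \<subseteq> A" if C: "minimal_flow ?H ?TH (subtopology X C) a" "C \<subseteq> topspace X" for C
  proof -
    obtain f where f: "G_map ?H M m (subtopology X C) a f" "f ` topspace M = topspace (subtopology X C)"
      by (rule universal_minimal_flow_onto[OF M(1) C(1) TH])
    have "G_map ?H M m X a f" using f(1) by (auto simp: G_map_def continuous_map_in_subtopology)
    moreover have "f ` topspace M = C" using f(2) C(2) by auto
    ultimately show ?thesis unfolding A_def by blast
  qed
  have orb: "closedin X (\<phi> ` topspace M)" "\<phi> ` topspace M \<subseteq> topspace X"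
      "minimal_flow ?H ?TH (subtopology X (\<phi> ` topspace M)) a"
      "\<And>p. p \<in> topspace M \<Longrightarrow> orbit_closure X a H (\<phi> p) = \<phi> ` topspace M"
    if "G_map ?H M m X a \<phi>" for \<phi>
    using minimal_flow_image[OF Mmin flH that TH] by simp_all
  have "a x g \<in> A" if x: "x \<in> A" and g: "g \<in> carrier G" for x g
  proof -
    obtain \<phi> p where \<phi>: "G_map ?H M m X a \<phi>" "p \<in> topspace M" "x = \<phi> p" using x unfolding A_def by blast
    define C where "C = \<phi> ` topspace M"
    have C: "closedin X C" "C \<subseteq> topspace X" "minimal_flow ?H ?TH (subtopology X C) a" "x \<in> C"
      using orb[OF \<phi>(1)] \<phi> by (auto simp: C_def)
    have inv: "a y h \<in> C" if "y \<in> C" "h \<in> H" for y h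
    proof -
      have "flow ?H ?TH (subtopology X C) a" using C(3) by (simp add: minimal_flow_def)
      from flow_closed[OF this TH, of y h] show ?thesis using that C(2) by auto
    qed
    \<comment> \<open>The translate of \<open>C\<close> by \<open>g\<close>, written as a preimage
      so that it is visibly closed. It is \<open>H\<close>-invariant because
      \<open>h \<otimes> inv g\<close> equals \<open>inv g \<otimes> k\<close> for some
      \<open>k\<close> in \<open>H\<close>.\<close>
    define Cg where "Cg = {y \<in> topspace X. a y (inv g) \<in> C}"
    have ginv: "inv g \<in> carrier G" using g by simp
    have "closedin X Cg"
      unfolding Cg_def by (rule closedin_continuous_map_preimage[OF flow_act_continuous[OF fl topspace_eq ginv] C(1)])
    moreover have xg: "a x g \<in> Cg"
      using flow_invert(1)[OF fl is_group _ g, of x] flow_closed[OF fl topspace_eq _ g, of x] C(2,4)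
      unfolding Cg_def by auto
    moreover have "a y h \<in> Cg" if y: "y \<in> Cg" and h: "h \<in> carrier ?H" for y h
    proof -
      have h': "h \<in> H" using h by simp
      obtain k where k: "k \<in> H" "h \<otimes> inv g = inv g \<otimes> k" using conj_mem[OF ginv h'] by blast
      have yX: "y \<in> topspace X" using y by (simp add: Cg_def)
      have "a (a y h) (inv g) = a (a y (inv g)) k"
        using fl yX h' k ginv by (simp add: flow_def)
      then show ?thesis using inv[of "a y (inv g)" k] y k(1) flow_closed[OF flH TH yX h] by (simp add: Cg_def)
    qed
    ultimately obtain C' where C': "closedin X C'" "C' \<subseteq> Cg" "minimal_flow ?H ?TH (subtopology X C') a"
      "\<And>y h. y \<in> C' \<Longrightarrow> h \<in> carrier ?H \<Longrightarrow> a y h \<in> C'"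
      using minimal_subflow_exists[OF flH TH LH.is_group, of Cg] by blast
    \<comment> \<open>Translating \<open>C'\<close> back by \<open>g\<close> gives an \<open>H\<close>-subflow of \<open>C\<close>, hence \<open>C\<close>.\<close>
    define E where "E = {y \<in> topspace X. a y g \<in> C'}"
    have "closedin X E"
      unfolding E_def by (rule closedin_continuous_map_preimage[OF flow_act_continuous[OF fl topspace_eq g] C'(1)])
    have C'X: "C' \<subseteq> topspace X" using C'(1) by (rule closedin_subset)
    have EC: "E \<subseteq> C"
    proof
      fix y assume y: "y \<in> E"
      then have "a (a y g) (inv g) \<in> C" using C'(2) by (auto simp: E_def Cg_def)
      then show "y \<in> C" using flow_invert(1)[OF fl is_group _ g, of y] y by (simp add: E_def)
    qed
    have "topspace (subtopology X C') \<noteq> {}" using C'(3) by (simp add: minimal_flow_def)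
    then obtain y' where y': "y' \<in> C'" "y' \<in> topspace X" by auto
    define y where "y = a y' (inv g)"
    have yX: "y \<in> topspace X" unfolding y_def by (rule flow_closed[OF fl topspace_eq y'(2) ginv])
    have yE: "y \<in> E"
      using yX flow_invert(2)[OF fl is_group y'(2) g] y'(1) by (simp add: E_def y_def)
    have "E = topspace (subtopology X C)"
    proof (rule minimal_flow_subset[OF C(3)])
      show "closedin (subtopology X C) E"
        using \<open>closedin X E\<close> EC by (simp add: closedin_subset_topspace)
      show "y \<in> E" by (rule yE)
      fix h assume h: "h \<in> carrier ?H"
      then have h': "h \<in> H" by simp
      obtain k where k: "k \<in> H" "h \<otimes> g = g \<otimes> k" using conj_mem[OF g h'] by blast
      have "a (a y h) g = a (a y g) k" using fl yX h' k g by (simp add: flow_def)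
      moreover have "a (a y g) k \<in> C'" using C'(4)[of "a y g" k] yE k(1) by (simp add: E_def)
      ultimately show "a y h \<in> E" using flow_closed[OF flH TH yX h] by (simp add: E_def)
    qed
    then have "x \<in> E" using C(2,4) by auto
    then have "a x g \<in> C'" by (simp add: E_def)
    then show "a x g \<in> A" using minA[OF C'(3) C'X] by blast
  qed
  moreover have "A \<noteq> {}"
  proof -
    obtain C where C: "closedin X C" "minimal_flow ?H ?TH (subtopology X C) a"
      using minimal_subflow_exists[OF flH TH LH.is_group closedin_topspace neX flow_closed[OF flH TH]] by metis
    then have "C \<noteq> {}" "C \<subseteq> topspace X" using closedin_subset by (auto simp: minimal_flow_def)
    then show ?thesis using minA[OF C(2)] by blast
  qed
  ultimately have A: "A = topspace X" using minimal_flow_subset[OF X Acl] by blast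
  show rep: "\<exists>\<phi>. \<exists>p\<in>topspace M. G_map ?H M m X a \<phi> \<and> \<phi> p = x \<and> orbit_closure X a H x = \<phi> ` topspace M"
    if "x \<in> topspace X" for x
  proof -
    have "x \<in> A" using that A by simp
    then obtain \<phi> p where "G_map ?H M m X a \<phi>" "p \<in> topspace M" "x = \<phi> p" unfolding A_def by blast
    then show ?thesis using orb(4) by blast
  qed
  show "minimal_flow ?H ?TH (subtopology X (orbit_closure X a H x)) a" if x: "x \<in> topspace X" for x
    using rep[OF x] orb(3) by metis
  show "orbit_closure X a H y = orbit_closure X a H x"
    if x: "x \<in> topspace X" and y: "y \<in> orbit_closure X a H x" for x y
  proof -
    obtain \<phi> where "G_map ?H M m X a \<phi>" "orbit_closure X a H x = \<phi> ` topspace M" using rep[OF x] by blast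
    then show ?thesis using orb(4)[of \<phi>] y by auto
  qed
  have "{(\<phi> p, \<phi> q) | \<phi> p q. G_map ?H M m X a \<phi> \<and> p \<in> topspace M \<and> q \<in> topspace M} =
    {(x, y). x \<in> topspace X \<and> y \<in> orbit_closure X a H x}" (is "?R = ?D")
  proof
    show "?R \<subseteq> ?D" using orb(2,4) by blast
    show "?D \<subseteq> ?R"
    proof clarify
      fix x y assume x: "x \<in> topspace X" and y: "y \<in> orbit_closure X a H x"
      obtain \<phi> p where "p \<in> topspace M" "G_map ?H M m X a \<phi>" "\<phi> p = x" "orbit_closure X a H x = \<phi> ` topspace M"
        using rep[OF x] by blast
      moreover then obtain q where "q \<in> topspace M" "y = \<phi> q" using y by auto
      ultimately show "\<exists>\<phi> p q. (x, y) = (\<phi> p, \<phi> q) \<and> G_map ?H M m X a \<phi> \<and> p \<in> topspace M \<and> q \<in> topspace M"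
        by blast
    qed
  qed
  then show "closedin (prod_topology X X) ?D"
    using LH.closedin_minimal_relation(1)[OF M flH] by simp
qed

section \<open>The space of orbit closures as a flow of the quotient group\<close>

text \<open>The quotient topology on the image of \<open>f\<close>. It will be used with
  \<open>f\<close> sending a point to its \<open>H\<close>-orbit closure, so that the points of the
  quotient are the closures themselves.\<close>

definition image_topology :: "'x topology \<Rightarrow> ('x \<Rightarrow> 'y) \<Rightarrow> 'y topology" where
  "image_topology X f = topology (\<lambda>U. U \<subseteq> f ` topspace X \<and> openin X {x \<in> topspace X. f x \<in> U})"

lemma openin_image_topology:
  "openin (image_topology X f) U \<longleftrightarrow> U \<subseteq> f ` topspace X \<and> openin X {x \<in> topspace X. f x \<in> U}"
proof -
  have "istopology (\<lambda>U. U \<subseteq> f ` topspace X \<and> openin X {x \<in> topspace X. f x \<in> U})"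
    unfolding istopology_def
  proof (intro conjI allI impI; (elim conjE)?)
    fix U V
    assume "openin X {x \<in> topspace X. f x \<in> U}" "openin X {x \<in> topspace X. f x \<in> V}"
    then have "openin X ({x \<in> topspace X. f x \<in> U} \<inter> {x \<in> topspace X. f x \<in> V})" by (rule openin_Int)
    also have "{x \<in> topspace X. f x \<in> U} \<inter> {x \<in> topspace X. f x \<in> V} = {x \<in> topspace X. f x \<in> U \<inter> V}"
      by blast
    finally show "openin X {x \<in> topspace X. f x \<in> U \<inter> V}" .
  next
    fix \<U>
    assume "\<forall>U\<in>\<U>. U \<subseteq> f ` topspace X \<and> openin X {x \<in> topspace X. f x \<in> U}"
    then have "openin X (\<Union>U\<in>\<U>. {x \<in> topspace X. f x \<in> U})" by blast
    also have "(\<Union>U\<in>\<U>. {x \<in> topspace X. f x \<in> U}) = {x \<in> topspace X. f x \<in> \<Union>\<U>}" by blast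
    finally show "openin X {x \<in> topspace X. f x \<in> \<Union>\<U>}" .
  qed blast+
  then show ?thesis by (simp add: image_topology_def topology_inverse')
qed

lemma topspace_image_topology: "topspace (image_topology X f) = f ` topspace X"
proof
  show "topspace (image_topology X f) \<subseteq> f ` topspace X"
    using openin_topspace[of "image_topology X f"] unfolding openin_image_topology by blast
  have "{x \<in> topspace X. f x \<in> f ` topspace X} = topspace X" by blast
  then have "openin (image_topology X f) (f ` topspace X)" by (simp add: openin_image_topology)
  then show "f ` topspace X \<subseteq> topspace (image_topology X f)" by (rule openin_subset)
qed

lemma quotient_map_image_topology: "quotient_map X (image_topology X f) f"
  by (auto simp: quotient_map_def topspace_image_topology openin_image_topology)

lemma (in length_group) openin_left_translate:
  assumes B: "openin T B" and h: "h \<in> carrier G"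
  shows "openin T {g \<in> carrier G. h \<otimes> g \<in> B}"
  using B h unfolding openin_iff by (auto simp: m_assoc[symmetric])

text \<open>The saturation of \<open>B\<close> is a union of left translates of \<open>B\<close>.
  Openness is what lets continuity of the action pass to the quotient in both variables at
  once.\<close>

lemma (in length_group) openin_quotient_image:
  assumes B: "openin T B" and H: "H \<lhd> G"
  shows "openin (quotient_group_topology G T H) ((\<lambda>g. H #> g) ` B)"
proof -
  interpret normal H G by (rule H)
  have Bc: "B \<subseteq> carrier G" using B unfolding openin_iff by blast
  have "{g \<in> carrier G. H #> g \<in> (\<lambda>g. H #> g) ` B} = (\<Union>h\<in>H. {g \<in> carrier G. h \<otimes> g \<in> B})"
  proof
    show "{g \<in> carrier G. H #> g \<in> (\<lambda>g. H #> g) ` B} \<subseteq> (\<Union>h\<in>H. {g \<in> carrier G. h \<otimes> g \<in> B})"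
    proof clarify
      fix g b assume g: "g \<in> carrier G" and b: "b \<in> B" "H #> g = H #> b"
      have "b \<in> H #> g" unfolding b(2) using b Bc by (auto intro!: rcos_self[OF _ subgroup_axioms])
      then show "g \<in> (\<Union>h\<in>H. {g \<in> carrier G. h \<otimes> g \<in> B})" using g b(1) by (auto simp: r_coset_def)
    qed
    show "(\<Union>h\<in>H. {g \<in> carrier G. h \<otimes> g \<in> B}) \<subseteq> {g \<in> carrier G. H #> g \<in> (\<lambda>g. H #> g) ` B}"
    proof clarify
      fix h g assume h: "h \<in> H" and g: "g \<in> carrier G" "h \<otimes> g \<in> B"
      have "h \<otimes> g \<in> H #> g" using h by (auto simp: r_coset_def)
      then have "H #> g = H #> (h \<otimes> g)" using repr_independence[OF _ g(1) subgroup_axioms] by blast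
      then show "H #> g \<in> (\<lambda>g. H #> g) ` B" using g by blast
    qed
  qed
  moreover have "openin T (\<Union>h\<in>H. {g \<in> carrier G. h \<otimes> g \<in> B})"
    using openin_left_translate[OF B] by (intro openin_Union) auto
  ultimately show ?thesis
    unfolding openin_quotient_group_topology[OF topspace_eq] using Bc by (auto simp: carrier_FactGroup)
qed

text \<open>The space of \<open>H\<close>-orbit closures is a minimal flow of the quotient group, so by universality and
  coalescence the orbit closures are exactly the fibres over the universal minimal flow of the
  quotient.\<close>

theorem quotient_map_fibres:
  fixes G (structure) and X :: "'x topology" and MK :: "'k topology"
  assumes LG: "length_group G T \<rho>" and H: "H \<lhd> G"
    and M: "universal_minimal_flow (G\<lparr>carrier := H\<rparr>) (subtopology T H) M m" "metrizable_space M"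
    and X: "minimal_flow G T X a"
    and K: "universal_minimal_flow (G Mod H) (quotient_group_topology G T H) MK b"
    and p: "G_map G X a MK (\<lambda>y g. b y (H #> g)) p"
    and x: "x \<in> topspace X"
  shows "{z \<in> topspace X. p z = p x} = orbit_closure X a H x"
proof -
  interpret length_group G T \<rho> by (rule LG)
  interpret normal H G by (rule H)
  let ?TK = "quotient_group_topology G T H"
  interpret LK: length_group "G Mod H" ?TK "\<lambda>k. Inf (\<rho> ` k)" by (rule length_group_quotient[OF LG H])
  note orb = normal_orbit_closures[OF LG H M X]
  have fl: "flow G T X a" and neX: "topspace X \<noteq> {}" using X by (auto simp: minimal_flow_def)
  have Kfl: "flow (G Mod H) ?TK MK b" and Kmin: "minimal_flow (G Mod H) ?TK MK b"
    using K by (auto simp: universal_minimal_flow_def minimal_flow_def)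
  have XH: "compact_space X" "Hausdorff_space X" using fl by (auto simp: flow_def)
  have one: "a z \<one> = z" if "z \<in> topspace X" for z using fl that by (simp add: flow_def)
  have assoc: "a (a z g) h = a z (g \<otimes> h)" if "z \<in> topspace X" "g \<in> carrier G" "h \<in> carrier G" for z g h
    using fl that by (simp add: flow_def)
  have acl: "a z g \<in> topspace X" if "z \<in> topspace X" "g \<in> carrier G" for z g
    by (rule flow_closed[OF fl topspace_eq that])
  define D where "D = orbit_closure X a H"
  define Q where "Q = image_topology X D"
  have tQ: "topspace Q = D ` topspace X" by (simp add: Q_def topspace_image_topology)
  have Dq: "quotient_map X Q D" unfolding Q_def by (rule quotient_map_image_topology)
  then have Dc: "continuous_map X Q D" by (rule quotient_imp_continuous_map)
  have Dself: "z \<in> D z" if z: "z \<in> topspace X" for z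
  proof -
    have "z \<in> a z ` H" using one[OF z] one_closed by (metis image_eqI)
    moreover have "a z ` H \<subseteq> topspace X" using acl[OF z] subset by blast
    ultimately show ?thesis unfolding D_def using closure_of_subset by blast
  qed
  have Deq: "D y = D z" if "z \<in> topspace X" "y \<in> D z" for y z
    using orb(3) that unfolding D_def by blast
  have DX: "D z \<subseteq> topspace X" for z unfolding D_def by (rule closure_of_subset_topspace)
  have Dorb: "D (a z h) = D z" if z: "z \<in> topspace X" and h: "h \<in> H" for z h
  proof (rule Deq[OF z])
    have "a z ` H \<subseteq> topspace X" using acl[OF z] subset by blast
    then show "a z h \<in> D z" unfolding D_def using closure_of_subset h by blast
  qed
  \<comment> \<open>Every \<open>H\<close>-orbit is dense in its class. So a class meets the open
    set \<open>A\<close> exactly if a given point of the class has an \<open>H\<close>-translate in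
    \<open>A\<close>, and the saturation of \<open>A\<close> is open.\<close>
  have Dopen: "openin Q (D ` A)" if A: "openin X A" for A
  proof -
    have AX: "A \<subseteq> topspace X" using A by (rule openin_subset)
    have "{z \<in> topspace X. D z \<in> D ` A} = (\<Union>h\<in>H. {z \<in> topspace X. a z h \<in> A})"
    proof
      show "{z \<in> topspace X. D z \<in> D ` A} \<subseteq> (\<Union>h\<in>H. {z \<in> topspace X. a z h \<in> A})"
      proof clarify
        fix z w assume z: "z \<in> topspace X" and w: "w \<in> A" "D z = D w"
        have "w \<in> X closure_of (a z ` H)" using Dself[of w] w AX unfolding D_def by auto
        then have "\<exists>y. y \<in> a z ` H \<and> y \<in> A" using w(1) A unfolding in_closure_of by blast
        then show "z \<in> (\<Union>h\<in>H. {z \<in> topspace X. a z h \<in> A})" using z by blast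
      qed
      show "(\<Union>h\<in>H. {z \<in> topspace X. a z h \<in> A}) \<subseteq> {z \<in> topspace X. D z \<in> D ` A}"
      proof clarify
        fix h z assume "h \<in> H" "z \<in> topspace X" "a z h \<in> A"
        then show "D z \<in> D ` A" using Dorb[of z h] by (metis imageI)
      qed
    qed
    moreover have "openin X (\<Union>h\<in>H. {z \<in> topspace X. a z h \<in> A})"
      using openin_continuous_map_preimage[OF flow_act_continuous[OF fl topspace_eq] A] subset
      by (intro openin_Union) auto
    ultimately show ?thesis unfolding Q_def openin_image_topology using AX by auto
  qed
  \<comment> \<open>Write \<open>g\<close> as \<open>h \<otimes> g'\<close> with \<open>h\<close> in
    \<open>H\<close>. Acting by \<open>h\<close> stays in the class, and acting by \<open>g'\<close>
    maps classes to classes by normality.\<close>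
  have Dact: "D (a y g) = D (a z g')"
    if yz: "y \<in> topspace X" "z \<in> topspace X" "D y = D z" and g: "g \<in> carrier G" "g' \<in> carrier G" "H #> g = H #> g'"
    for y z g g'
  proof -
    have "g \<in> H #> g'" using rcos_self[OF g(1) subgroup_axioms] g(3) by simp
    then obtain h where h: "h \<in> H" "g = h \<otimes> g'" by (auto simp: r_coset_def)
    have yh: "a y h \<in> topspace X" using acl yz(1) h(1) by simp
    have "a y h \<in> D z" using Dself[OF yh] Dorb[OF yz(1) h(1)] yz(3) by simp
    then have "a (a y h) g' \<in> D (a z g')"
      using orbit_closure_translate[OF fl topspace_eq H yz(2) _ g(2)] unfolding D_def by blast
    then have "D (a (a y h) g') = D (a z g')" using Deq acl yz g by blast
    then show ?thesis using assoc[OF yz(1) _ g(2), of h] h by simp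
  qed
  \<comment> \<open>Representatives are picked by choice; \<open>Dact\<close> makes the result
    independent of them.\<close>
  define c where "c q k = D (a (SOME z. z \<in> topspace X \<and> D z = q) (SOME g. g \<in> carrier G \<and> H #> g = k))" for q k
  have c: "c (D z) (H #> g) = D (a z g)" if z: "z \<in> topspace X" and g: "g \<in> carrier G" for z g
  proof -
    have "(SOME y. y \<in> topspace X \<and> D y = D z) \<in> topspace X \<and> D (SOME y. y \<in> topspace X \<and> D y = D z) = D z"
      by (rule someI[of _ z]) (use z in simp)
    moreover have "(SOME y. y \<in> carrier G \<and> H #> y = H #> g) \<in> carrier G \<and> H #> (SOME y. y \<in> carrier G \<and> H #> y = H #> g) = H #> g"
      by (rule someI[of _ g]) (use g in simp)
    ultimately show ?thesis unfolding c_def using z g by (intro Dact) auto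
  qed
  have Kcar: "\<exists>g\<in>carrier G. k = H #> g" if "k \<in> carrier (G Mod H)" for k
    using that by (auto simp: carrier_FactGroup)
  have Kmem: "H #> g \<in> carrier (G Mod H)" if "g \<in> carrier G" for g
    using that by (auto simp: carrier_FactGroup)
  have "flow (G Mod H) ?TK Q c"
    unfolding flow_def
  proof (intro conjI ballI)
    have "compactin Q (D ` topspace X)"
      using image_compactin[OF _ Dc] XH(1) by (simp add: compact_space_def)
    then show "compact_space Q" by (simp add: compact_space_def tQ)
    \<comment> \<open>A box around a pair outside the closed orbit relation projects to disjoint
      sets, which are open by \<open>Dopen\<close>.\<close>
    show "Hausdorff_space Q"
      unfolding Hausdorff_space_def
    proof clarify
      fix q r assume q: "q \<in> topspace Q" "r \<in> topspace Q" "q \<noteq> r"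
      obtain y z where yz: "y \<in> topspace X" "z \<in> topspace X" "q = D y" "r = D z" using q tQ by auto
      let ?R = "{(x, y). x \<in> topspace X \<and> y \<in> D x}"
      have "openin (prod_topology X X) (topspace (prod_topology X X) - ?R)"
        using orb(4) unfolding D_def by blast
      moreover have "z \<notin> D y" using Deq[OF yz(1), of z] q(3) yz(3,4) by metis
      then have "(y, z) \<in> topspace (prod_topology X X) - ?R" using yz(1,2) by simp
      ultimately obtain A B where AB: "openin X A" "openin X B" "y \<in> A" "z \<in> B"
        "A \<times> B \<subseteq> topspace (prod_topology X X) - ?R"
        unfolding openin_prod_topology_alt by meson
      have "D u \<noteq> D v" if "u \<in> A" "v \<in> B" for u v
      proof
        assume "D u = D v"
        have "(u, v) \<in> topspace (prod_topology X X) - ?R" using AB(5) that by blast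
        then show False using Dself[of v] \<open>D u = D v\<close> by auto
      qed
      then have "disjnt (D ` A) (D ` B)" by (auto simp: disjnt_def)
      then show "\<exists>U V. openin Q U \<and> openin Q V \<and> q \<in> U \<and> r \<in> V \<and> disjnt U V"
        using Dopen AB yz by blast
    qed
    \<comment> \<open>Both quotient maps are open, so boxes upstairs map to boxes
      downstairs.\<close>
    show "continuous_map (prod_topology Q ?TK) Q (\<lambda>(q, k). c q k)"
    proof (rule continuous_mapI_local)
      fix w assume wQ: "w \<in> topspace (prod_topology Q ?TK)"
      then have "fst w \<in> D ` topspace X" "snd w \<in> carrier (G Mod H)" using tQ LK.topspace_eq by auto
      then obtain z g where w: "w = (D z, H #> g)" "z \<in> topspace X" "g \<in> carrier G"
        using Kcar[of "snd w"] by (metis imageE prod.collapse)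
      then show "(\<lambda>(q, k). c q k) w \<in> topspace Q" using c acl tQ by auto
      fix W assume W: "openin Q W" "(\<lambda>(q, k). c q k) w \<in> W"
      have "continuous_map (prod_topology X T) Q (D \<circ> (\<lambda>(x, g). a x g))"
        using fl Dc by (intro continuous_map_compose) (auto simp: flow_def)
      then have "openin (prod_topology X T) {v \<in> topspace (prod_topology X T). (D \<circ> (\<lambda>(x, g). a x g)) v \<in> W}"
        using W(1) by (rule openin_continuous_map_preimage)
      moreover have "(z, g) \<in> {v \<in> topspace (prod_topology X T). (D \<circ> (\<lambda>(x, g). a x g)) v \<in> W}"
        using w W c topspace_eq by simp
      ultimately obtain A B where AB: "openin X A" "openin T B" "z \<in> A" "g \<in> B"
        "A \<times> B \<subseteq> {v \<in> topspace (prod_topology X T). (D \<circ> (\<lambda>(x, g). a x g)) v \<in> W}"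
        unfolding openin_prod_topology_alt by meson
      have "openin (prod_topology Q ?TK) (D ` A \<times> (\<lambda>g. H #> g) ` B)"
        using Dopen[OF AB(1)] openin_quotient_image[OF AB(2) H] by (simp add: openin_prod_Times_iff)
      moreover have "w \<in> D ` A \<times> (\<lambda>g. H #> g) ` B" using w AB by auto
      moreover have "(\<lambda>(q, k). c q k) ` (D ` A \<times> (\<lambda>g. H #> g) ` B) \<subseteq> W"
      proof clarify
        fix y h assume "y \<in> A" "h \<in> B"
        then have "(y, h) \<in> {v \<in> topspace (prod_topology X T). (D \<circ> (\<lambda>(x, g). a x g)) v \<in> W}"
          using AB(5) by blast
        then show "c (D y) (H #> h) \<in> W" using c topspace_eq by simp
      qed
      ultimately show "\<exists>U. openin (prod_topology Q ?TK) U \<and> w \<in> U \<and> (\<lambda>(q, k). c q k) ` U \<subseteq> W" by blast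
    qed
    show "c q \<one>\<^bsub>G Mod H\<^esub> = q" if "q \<in> topspace Q" for q
    proof -
      obtain z where "z \<in> topspace X" "q = D z" using \<open>q \<in> topspace Q\<close> tQ by auto
      then show ?thesis using c[of z \<one>] one by (simp add: coset_mult_one subset)
    qed
    show "c (c q k) l = c q (k \<otimes>\<^bsub>G Mod H\<^esub> l)"
      if qkl: "q \<in> topspace Q" "k \<in> carrier (G Mod H)" "l \<in> carrier (G Mod H)" for q k l
    proof -
      obtain z g h where "z \<in> topspace X" "q = D z" "g \<in> carrier G" "k = H #> g" "h \<in> carrier G" "l = H #> h"
        using qkl(1) tQ Kcar[OF qkl(2)] Kcar[OF qkl(3)] by auto
      then show ?thesis using c assoc acl by (simp add: rcos_sum)
    qed
  qed
  moreover have "Q closure_of (c q ` carrier (G Mod H)) = topspace Q" if q: "q \<in> topspace Q" for q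
  proof
    show "Q closure_of (c q ` carrier (G Mod H)) \<subseteq> topspace Q" by (rule closure_of_subset_topspace)
    obtain z where z: "z \<in> topspace X" "q = D z" using q tQ by auto
    have "D ` (X closure_of (a z ` carrier G)) \<subseteq> Q closure_of (D ` (a z ` carrier G))"
      by (rule continuous_map_image_closure_subset[OF Dc])
    moreover have "D ` (a z ` carrier G) \<subseteq> c q ` carrier (G Mod H)"
      using c[OF z(1)] z(2) Kmem by (auto intro!: image_eqI)
    moreover have "X closure_of (a z ` carrier G) = topspace X" using X z(1) by (simp add: minimal_flow_def)
    ultimately show "topspace Q \<subseteq> Q closure_of (c q ` carrier (G Mod H))"
      using tQ closure_of_mono by (metis subset_trans)
  qed
  ultimately have Qmin: "minimal_flow (G Mod H) ?TK Q c"
    using neX tQ by (auto simp: minimal_flow_def)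
  have pc: "continuous_map X MK p" and peq: "\<And>z g. z \<in> topspace X \<Longrightarrow> g \<in> carrier G \<Longrightarrow> p (a z g) = b (p z) (H #> g)"
    using p by (auto simp: G_map_def)
  have pX: "p z \<in> topspace MK" if "z \<in> topspace X" for z using pc that by (auto simp: continuous_map_def)
  have MKH: "Hausdorff_space MK" using Kfl by (simp add: flow_def)
  \<comment> \<open>\<open>H\<close> acts trivially on \<open>MK\<close>, so \<open>p\<close> is
    constant on \<open>H\<close>-orbits and, by continuity, on their closures.\<close>
  have pD: "p y = p z" if z: "z \<in> topspace X" and y: "y \<in> D z" for y z
  proof (rule forall_in_closure_of_eq[of y X "a z ` H" MK p "\<lambda>_. p z"])
    show "y \<in> X closure_of (a z ` H)" using y by (simp add: D_def)
    show "continuous_map X MK (\<lambda>_. p z)" using pX[OF z] by simp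
    show "p w = p z" if w: "w \<in> a z ` H" for w
    proof -
      obtain h where h: "h \<in> H" "w = a z h" using w by blast
      have "H #> h = \<one>\<^bsub>G Mod H\<^esub>" using h(1) coset_join2[OF _ subgroup_axioms] by simp
      then show ?thesis using peq[OF z, of h] h pX[OF z] Kfl by (simp add: flow_def)
    qed
  qed (rule MKH pc)+
  have "p y = p z" if "y \<in> topspace X" "z \<in> topspace X" "D y = D z" for y z
    using pD[OF that(2)] Dself[OF that(1)] that(3) by blast
  then obtain p' where "continuous_map Q MK p'" and p': "\<And>z. z \<in> topspace X \<Longrightarrow> p' (D z) = p z"
    using quotient_map_lift_exists[OF Dq pc] by metis
  have p'g: "p' (c q k) = b (p' q) k" if qk: "q \<in> topspace Q" "k \<in> carrier (G Mod H)" for q k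
  proof -
    obtain z g where "z \<in> topspace X" "q = D z" "g \<in> carrier G" "k = H #> g"
      using qk(1) tQ Kcar[OF qk(2)] by auto
    then show ?thesis using c acl p' peq by simp
  qed
  have p'm: "G_map (G Mod H) Q c MK b p'" using p'g \<open>continuous_map Q MK p'\<close> by (simp add: G_map_def)
  obtain s where s: "G_map (G Mod H) MK b Q c s" "s ` topspace MK = topspace Q"
    by (rule universal_minimal_flow_onto[OF K Qmin LK.topspace_eq])
  \<comment> \<open>An endomorphism of \<open>MK\<close>, injective by coalescence. As
    \<open>s\<close> is onto \<open>Q\<close>, the induced map \<open>p'\<close> is injective, so no
    fibre of \<open>p\<close> contains two classes.\<close>
  have inj: "inj_on (p' \<circ> s) (topspace MK)"
    by (rule universal_minimal_flow_coalescent[OF K LK.topspace_eq LK.is_group G_map_compose[OF s(1) p'm]])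
  have "D z = D x" if z: "z \<in> topspace X" "p z = p x" for z
  proof -
    have "D z \<in> s ` topspace MK" "D x \<in> s ` topspace MK" using z x s(2) tQ by auto
    then obtain u v where "u \<in> topspace MK" "v \<in> topspace MK" "s u = D z" "s v = D x" by (metis imageE)
    moreover from this have "(p' \<circ> s) u = (p' \<circ> s) v" using p' z x by simp
    ultimately show ?thesis using inj by (metis inj_onD)
  qed
  then have "{z \<in> topspace X. p z = p x} = D x"
    using pD[OF x] Dself DX[of x] by blast
  then show ?thesis by (simp add: D_def)
qed

section \<open>Metrizability from finite nets\<close>

text \<open>One Urysohn function per disjoint pair of sets from \<open>\<C>\<close> gives countably
  many functions separating points. They embed \<open>X\<close> into a countable power of the unit
  interval.\<close>

lemma compact_Hausdorff_metrizable_criterion: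
  assumes X: "compact_space X" "Hausdorff_space X" and \<C>: "countable \<C>" "\<And>C. C \<in> \<C> \<Longrightarrow> closedin X C"
    and sep: "\<And>x y. x \<in> topspace X \<Longrightarrow> y \<in> topspace X \<Longrightarrow> x \<noteq> y \<Longrightarrow> \<exists>C\<in>\<C>. \<exists>D\<in>\<C>. x \<in> C \<and> y \<in> D \<and> disjnt C D"
  shows "metrizable_space X"
proof -
  have norm: "normal_space X" using X by (simp add: compact_Hausdorff_or_regular_imp_normal_space)
  define I where "I = {i \<in> \<C> \<times> \<C>. disjnt (fst i) (snd i)}"
  have "I \<subseteq> \<C> \<times> \<C>" by (auto simp: I_def)
  then have I: "countable I" by (rule countable_subset) (intro countable_SIGMA \<C>(1))
  let ?Y = "top_of_set {0..1::real}"
  have "\<exists>f. continuous_map X ?Y f \<and> f ` fst i \<subseteq> {0} \<and> f ` snd i \<subseteq> {1}" if i: "i \<in> I" for i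
  proof -
    have "closedin X (fst i)" "closedin X (snd i)" "disjnt (fst i) (snd i)" using i \<C>(2) by (auto simp: I_def)
    then obtain f where "continuous_map X ?Y f" "f ` fst i \<subseteq> {0}" "f ` snd i \<subseteq> {1}"
      by (rule Urysohn_lemma[OF norm _ _ _ zero_le_one])
    then show ?thesis by blast
  qed
  then obtain f where f: "\<And>i. i \<in> I \<Longrightarrow> continuous_map X ?Y (f i)"
    "\<And>i. i \<in> I \<Longrightarrow> f i ` fst i \<subseteq> {0}" "\<And>i. i \<in> I \<Longrightarrow> f i ` snd i \<subseteq> {1}" by metis
  let ?P = "product_topology (\<lambda>_. ?Y) I"
  define e where "e x = (\<lambda>i\<in>I. f i x)" for x
  have e: "continuous_map X ?P e"
    unfolding continuous_map_componentwise e_def using f(1) by auto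
  have inj: "inj_on e (topspace X)"
  proof (rule inj_onI, rule ccontr)
    fix x y assume xy: "x \<in> topspace X" "y \<in> topspace X" "e x = e y" "x \<noteq> y"
    then obtain C D where CD: "C \<in> \<C>" "D \<in> \<C>" "x \<in> C" "y \<in> D" "disjnt C D" using sep by blast
    then have i: "(C, D) \<in> I" by (simp add: I_def)
    have "f (C, D) x = 0" "f (C, D) y = 1" using f(2,3)[OF i] CD by auto
    moreover have "f (C, D) x = f (C, D) y" using fun_cong[OF xy(3), of "(C, D)"] i by (simp add: e_def)
    ultimately show False by simp
  qed
  have "metrizable_space ?Y" by (rule metrizable_space_subtopology[OF metrizable_space_euclidean])
  moreover have "countable {i \<in> I. \<not> (\<exists>a. topspace ?Y \<subseteq> {a})}" by (rule countable_subset[OF _ I]) auto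
  ultimately have P: "metrizable_space ?P" unfolding metrizable_space_product_topology by blast
  have "embedding_map X ?P e"
    by (rule continuous_imp_embedding_map[OF e X(1) metrizable_imp_Hausdorff_space[OF P] inj])
  then have "X homeomorphic_space subtopology ?P (e ` topspace X)"
    by (rule embedding_map_imp_homeomorphic_space)
  then show ?thesis using metrizable_space_subtopology[OF P] homeomorphic_metrizable_space by blast
qed

context length_group
begin

text \<open>The bound is uniform in \<open>f\<close>: near points are at distance at most
  \<open>r\<close> in the supremum metric of the Lipschitz functions on the flow.\<close>

lemma near_lipschitz:
  assumes near: "near X a r p q" and pq: "p \<in> topspace X" "q \<in> topspace X"
    and f: "continuous_map X euclideanreal f"
    and lip: "\<And>x u. x \<in> topspace X \<Longrightarrow> u \<in> carrier G \<Longrightarrow> \<bar>f (a x u) - f x\<bar> \<le> \<rho> u"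
  shows "\<bar>f p - f q\<bar> \<le> r"
proof (rule field_le_epsilon)
  fix e :: real assume e: "0 < e"
  define N where "N z = {x \<in> topspace X. f x \<in> {f z - e / 2 <..< f z + e / 2}}" for z
  have "openin X (N z)" for z
    unfolding N_def by (rule openin_continuous_map_preimage[OF f]) auto
  moreover have "p \<in> N p" "q \<in> N q" using pq e by (auto simp: N_def)
  ultimately obtain x u where x: "x \<in> N p" "u \<in> carrier G" "\<rho> u < r" "a x u \<in> N q"
    using near unfolding near_def by blast
  have xX: "x \<in> topspace X" using x(1) by (simp add: N_def)
  have "f p - e / 2 < f x" "f x < f p + e / 2" "f q - e / 2 < f (a x u)" "f (a x u) < f q + e / 2"
    using x(1,4) by (auto simp: N_def)
  then show "\<bar>f p - f q\<bar> \<le> r + e" using lip[OF xX x(2)] x(3) by linarith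
qed

definition flow_lipschitz_functions :: "'x topology \<Rightarrow> ('x \<Rightarrow> 'a \<Rightarrow> 'x) \<Rightarrow> ('x \<Rightarrow> real) set" where
  "flow_lipschitz_functions X a = {f. continuous_map X euclideanreal f \<and>
     (\<forall>x\<in>topspace X. \<forall>g\<in>carrier G. \<bar>f (a x g) - f x\<bar> \<le> \<rho> g)}"

text \<open>The closed balls around the net points at the scales \<open>1 / real (Suc n)\<close>
  form a countable family. It separates points because Lipschitz functions do, by
  \<open>lipschitz_separation\<close>.\<close>

lemma metrizable_if_totally_bounded:
  assumes X: "universal_minimal_flow G T X a"
    and net: "\<And>e. 0 < e \<Longrightarrow> \<exists>P. finite P \<and> (\<forall>x\<in>topspace X. \<exists>p\<in>P. \<forall>f\<in>flow_lipschitz_functions X a. \<bar>f x - f p\<bar> \<le> e)"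
  shows "metrizable_space X"
proof -
  let ?L = "flow_lipschitz_functions X a"
  have fl: "flow G T X a" using X by (simp add: universal_minimal_flow_def minimal_flow_def)
  then have XH: "compact_space X" "Hausdorff_space X" by (auto simp: flow_def)
  obtain P where P: "\<And>n. finite (P n)"
    "\<And>n x. x \<in> topspace X \<Longrightarrow> \<exists>p\<in>P n. \<forall>f\<in>?L. \<bar>f x - f p\<bar> \<le> 1 / real (Suc n)"
    using net[of "1 / real (Suc _)"] by (metis of_nat_0_less_iff zero_less_Suc zero_less_divide_1_iff)
  define C where "C p n = {x \<in> topspace X. \<forall>f\<in>?L. \<bar>f x - f p\<bar> \<le> 1 / real (Suc n)}" for p and n :: nat
  have Ccl: "closedin X (C p n)" for p n
  proof -
    have "closedin X {x \<in> topspace X. \<bar>f x - f p\<bar> \<in> {..1 / real (Suc n)}}" if "f \<in> ?L" for f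
      using that unfolding flow_lipschitz_functions_def
      by (intro closedin_continuous_map_preimage[where Y = euclideanreal] continuous_map_real_abs continuous_map_diff) auto
    moreover have "C p n = topspace X \<inter> (\<Inter>f\<in>?L. {x \<in> topspace X. \<bar>f x - f p\<bar> \<in> {..1 / real (Suc n)}})"
      by (auto simp: C_def)
    ultimately show ?thesis
      by (cases "?L = {}") (auto intro!: closedin_Int closedin_Inter simp del: of_nat_Suc)
  qed
  define \<C> where "\<C> = (\<Union>n. (\<lambda>p. C p n) ` P n)"
  show ?thesis
  proof (rule compact_Hausdorff_metrizable_criterion[OF XH, of \<C>])
    show "countable \<C>" unfolding \<C>_def by (rule countable_UN) (simp_all add: P(1) countable_finite)
    show "closedin X K" if "K \<in> \<C>" for K using that Ccl by (auto simp: \<C>_def)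
    fix x y assume xy: "x \<in> topspace X" "y \<in> topspace X" "x \<noteq> y"
    then obtain A B where AB: "openin X A" "openin X B" "x \<in> A" "y \<in> B" "disjnt A B"
      using XH(2) unfolding Hausdorff_space_def by blast
    obtain V r where V: "openin X V" "x \<in> V" "0 < r"
      "\<And>z u. z \<in> V \<Longrightarrow> u \<in> carrier G \<Longrightarrow> \<rho> u < r \<Longrightarrow> a z u \<in> A"
      using flow_small_action[OF fl AB(1,3)] by metis
    have sep: "a z u \<notin> B" if "z \<in> V" "u \<in> carrier G" "\<rho> u < r" for z u
      using V(4)[OF that] AB(5) by (auto simp: disjnt_def)
    obtain f where "continuous_map X euclideanreal f" "\<forall>x\<in>topspace X. \<forall>g\<in>carrier G. \<bar>f (a x g) - f x\<bar> \<le> \<rho> g"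
      "\<forall>x\<in>V. f x = 0" "\<forall>x\<in>B. f x = r"
      using lipschitz_separation[OF X V(1) AB(2) less_imp_le[OF V(3)] sep] by blast
    then have f: "f \<in> ?L" "f x = 0" "f y = r" using V(2) AB(4) by (auto simp: flow_lipschitz_functions_def)
    \<comment> \<open>A common point of the two balls would bound the gap \<open>r\<close> between
      \<open>f x\<close> and \<open>f y\<close> by four errors of size below
      \<open>r / 4\<close>.\<close>
    obtain n where n: "1 / real (Suc n) < r / 4" using nat_approx_posE[of "r / 4"] V(3) by auto
    obtain p q where pq: "p \<in> P n" "x \<in> C p n" "q \<in> P n" "y \<in> C q n" using P(2) xy unfolding C_def by blast
    have "disjnt (C p n) (C q n)"
      unfolding disjnt_iff
    proof (intro allI notI; elim conjE)
      fix z assume z: "z \<in> C p n" "z \<in> C q n"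
      have "\<bar>f x - f p\<bar> \<le> 1 / real (Suc n)" "\<bar>f z - f p\<bar> \<le> 1 / real (Suc n)"
        "\<bar>f z - f q\<bar> \<le> 1 / real (Suc n)" "\<bar>f y - f q\<bar> \<le> 1 / real (Suc n)"
        using z pq f(1) unfolding C_def by blast+
      then show False using n f(2,3) by linarith
    qed
    then show "\<exists>K\<in>\<C>. \<exists>L\<in>\<C>. x \<in> K \<and> y \<in> L \<and> disjnt K L" using pq unfolding \<C>_def by blast
  qed
qed

end

text \<open>A point is joined to the net in two moves of size \<open>e / 2\<close>: first to the
  fibre over a net point of \<open>MK\<close>, then inside that fibre to the image of a net point of
  \<open>M\<close>. There are only finitely many such images.\<close>

theorem extension_metrizable:
  fixes G (structure) and X :: "'x topology" and MK :: "'k topology" and M :: "'h topology"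
  assumes LG: "length_group G T \<rho>" and H: "H \<lhd> G"
    and M: "universal_minimal_flow (G\<lparr>carrier := H\<rparr>) (subtopology T H) M m" "metrizable_space M"
    and K: "universal_minimal_flow (G Mod H) (quotient_group_topology G T H) MK b" "metrizable_space MK"
    and X: "universal_minimal_flow G T X a"
  shows "metrizable_space X"
proof -
  interpret length_group G T \<rho> by (rule LG)
  interpret normal H G by (rule H)
  let ?TK = "quotient_group_topology G T H" and ?H = "G\<lparr>carrier := H\<rparr>"
  let ?q = "\<lambda>g. H #> g"
  interpret LK: length_group "G Mod H" ?TK "\<lambda>k. Inf (\<rho> ` k)" by (rule length_group_quotient[OF LG H])
  interpret LH: length_group ?H "subtopology T H" \<rho> by (rule length_group_subgroup[OF LG subgroup_axioms])
  have Xmin: "minimal_flow G T X a" and fl: "flow G T X a"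
    using X by (auto simp: universal_minimal_flow_def minimal_flow_def)
  have XH: "compact_space X" "Hausdorff_space X" using fl by (auto simp: flow_def)
  have Kmin: "minimal_flow (G Mod H) ?TK MK b" and Kfl: "flow (G Mod H) ?TK MK b"
    using K by (auto simp: universal_minimal_flow_def minimal_flow_def)
  have MKH: "Hausdorff_space MK" using Kfl by (simp add: flow_def)
  obtain p where p: "G_map G X a MK (\<lambda>y g. b y (H #> g)) p" "p ` topspace X = topspace MK"
    by (rule universal_minimal_flow_onto[OF X minimal_flow_of_quotient[OF topspace_eq H Kmin] topspace_eq])
  have pc: "continuous_map X MK p" and peq: "\<And>z g. z \<in> topspace X \<Longrightarrow> g \<in> carrier G \<Longrightarrow> p (a z g) = b (p z) (H #> g)"
    using p by (auto simp: G_map_def)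
  note fibre = quotient_map_fibres[OF LG H M Xmin K(1) p(1)]
  note orb = normal_orbit_closures[OF LG H M Xmin]
  have acl: "a z g \<in> topspace X" if "z \<in> topspace X" "g \<in> carrier G" for z g
    by (rule flow_closed[OF fl topspace_eq that])
  have pclosed: "closedin MK (p ` C)" if "closedin X C" for C
  proof -
    have "compactin MK (p ` C)" using image_compactin[OF closedin_compact_space[OF XH(1) that] pc] .
    then show ?thesis using MKH by (simp add: compactin_imp_closedin)
  qed
  have porb: "p (a z h) = p z" if z: "z \<in> topspace X" and h: "h \<in> H" for z h
  proof -
    have "a z ` H \<subseteq> topspace X" using acl[OF z] subset by blast
    then have "a z h \<in> orbit_closure X a H z" using h closure_of_subset by blast
    then show ?thesis using fibre[OF z] by blast
  qed
  \<comment> \<open>Fibres are closures of \<open>H\<close>-orbits. So \<open>p z\<close> lies in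
    \<open>p\<close>
    B\<open>exactly if some\<close>H\<open>-translate of\<close>z\<open>lies in\<close>B\<open>, and the complement of\<close>p
    \<open>B\<close> is the image of a closed set under the closed map \<open>p\<close>.\<close>
  have popen: "openin MK (p ` B)" if B: "openin X B" for B
  proof -
    define S where "S = (\<Union>h\<in>H. {z \<in> topspace X. a z h \<in> B})"
    have "openin X S"
      using openin_continuous_map_preimage[OF flow_act_continuous[OF fl topspace_eq] B] subset
      unfolding S_def by (intro openin_Union) auto
    then have cl: "closedin MK (p ` (topspace X - S))" by (intro pclosed) auto
    have BX: "B \<subseteq> topspace X" using B by (rule openin_subset)
    have "p ` B = topspace MK - p ` (topspace X - S)"
    proof
      show "p ` B \<subseteq> topspace MK - p ` (topspace X - S)"
      proof clarify
        fix w assume w: "w \<in> B"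
        have "p w \<notin> p ` (topspace X - S)"
        proof clarify
          fix z assume z: "z \<in> topspace X" "z \<notin> S" "p w = p z"
          then have "w \<in> orbit_closure X a H z" using fibre[OF z(1)] w BX by auto
          then have "\<exists>y. y \<in> a z ` H \<and> y \<in> B" using w B unfolding in_closure_of by blast
          then show False using z unfolding S_def by blast
        qed
        then show "p w \<in> topspace MK - p ` (topspace X - S)" using w BX p(2) by blast
      qed
      show "topspace MK - p ` (topspace X - S) \<subseteq> p ` B"
      proof
        fix y assume y: "y \<in> topspace MK - p ` (topspace X - S)"
        then have "y \<in> p ` topspace X" using p(2) by simp
        then obtain z where "z \<in> topspace X" "y = p z" by blast
        with y have z: "z \<in> topspace X" "y = p z" "z \<in> S" by auto
        then obtain h where "h \<in> H" "a z h \<in> B" unfolding S_def by blast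
        then show "y \<in> p ` B" using porb[OF z(1)] z(2) by (metis imageI)
      qed
    qed
    then show ?thesis using cl by auto
  qed
  \<comment> \<open>A point near the fibre in \<open>MK\<close> is near a point of the fibre in \<open>X\<close>, by compactness.\<close>
  have lift: "\<exists>z\<in>topspace X. p z = y \<and> near X a r z x"
    if x: "x \<in> topspace X" and y: "y \<in> topspace MK" and near: "LK.near MK b r y (p x)" for x y r
  proof (rule ccontr)
    assume neg: "\<not> ?thesis"
    define F where "F = {z \<in> topspace X. p z \<in> {y}}"
    have "closedin X F" unfolding F_def
      using MKH y by (intro closedin_continuous_map_preimage[OF pc]) (simp add: closedin_Hausdorff_singleton)
    then have Fc: "compactin X F" by (rule closedin_compact_space[OF XH(1)])
    define far where "far A B \<longleftrightarrow> (\<forall>z\<in>A. \<forall>u\<in>carrier G. \<rho> u < r \<longrightarrow> a z u \<notin> B)" for A B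
    have "\<exists>A B. openin X A \<and> openin X B \<and> z \<in> A \<and> x \<in> B \<and> far A B" if z: "z \<in> F" for z
    proof -
      have "z \<in> topspace X" "p z = y" using z by (simp_all add: F_def)
      then have "\<not> near X a r z x" using neg by blast
      then show ?thesis unfolding near_def far_def by blast
    qed
    then have "\<forall>z\<in>F. \<exists>A B. openin X A \<and> openin X B \<and> z \<in> A \<and> x \<in> B \<and> far A B" by blast
    from bchoice[OF this] obtain A where
      "\<forall>z\<in>F. \<exists>B. openin X (A z) \<and> openin X B \<and> z \<in> A z \<and> x \<in> B \<and> far (A z) B" by blast
    from bchoice[OF this] obtain B where
      "\<forall>z\<in>F. openin X (A z) \<and> openin X (B z) \<and> z \<in> A z \<and> x \<in> B z \<and> far (A z) (B z)" by blast
    then have AB: "\<And>z. z \<in> F \<Longrightarrow> openin X (A z)" "\<And>z. z \<in> F \<Longrightarrow> openin X (B z)"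
      "\<And>z. z \<in> F \<Longrightarrow> z \<in> A z" "\<And>z. z \<in> F \<Longrightarrow> x \<in> B z" "\<And>z. z \<in> F \<Longrightarrow> far (A z) (B z)"
      by blast+
    have "\<exists>\<F>. finite \<F> \<and> \<F> \<subseteq> A ` F \<and> F \<subseteq> \<Union>\<F>"
      by (rule compactinD[OF Fc]) (use AB in auto)
    then obtain \<F> where \<F>: "finite \<F>" "\<F> \<subseteq> A ` F" "F \<subseteq> \<Union>\<F>" by blast
    obtain F0 where F0: "F0 \<subseteq> F" "finite F0" "\<F> = A ` F0" using finite_subset_image[OF \<F>(1,2)] by blast
    define A0 where "A0 = (\<Union>z\<in>F0. A z)"
    define B0 where "B0 = topspace X \<inter> (\<Inter>z\<in>F0. B z)"
    have A0: "openin X A0" "F \<subseteq> A0" using AB(1) F0 \<F>(3) by (auto simp: A0_def)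
    have B0: "openin X B0" "x \<in> B0"
      unfolding B0_def using AB(2,4) F0 x by (auto intro!: openin_Int_Inter)
    have far0: "far A0 B0"
      using AB(5) F0(1) unfolding far_def A0_def B0_def by blast
    \<comment> \<open>Since \<open>p\<close> is closed, the neighbourhood \<open>A0\<close> of the
      fibre contains the whole preimage of a neighbourhood \<open>N\<close> of
      \<open>y\<close>.\<close>
    define N where "N = topspace MK - p ` (topspace X - A0)"
    have "openin MK N" unfolding N_def using pclosed[of "topspace X - A0"] A0(1) by auto
    moreover have "y \<in> N" using y A0(2) unfolding N_def F_def by blast
    moreover have "openin MK (p ` B0)" "p x \<in> p ` B0" using popen B0 by auto
    ultimately obtain w v where w: "w \<in> N" "v \<in> carrier (G Mod H)" "Inf (\<rho> ` v) < r" "b w v \<in> p ` B0"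
      using near unfolding LK.near_def by meson
    obtain g where g: "g \<in> carrier G" "v = H #> g" using w(2) by (auto simp: carrier_FactGroup)
    have "g \<in> v" using rcos_self[OF g(1) subgroup_axioms] g(2) by simp
    \<comment> \<open>The length of \<open>v\<close> is an infimum over a coset, so a short
      \<open>v\<close> has a short representative.\<close>
    then obtain u where u: "u \<in> v" "\<rho> u < r"
    proof -
      have "\<rho> ` v \<noteq> {}" using \<open>g \<in> v\<close> by blast
      then obtain u where "u \<in> v" "\<rho> u < r" using cInf_lessD[OF _ w(3)] by blast
      then show thesis by (rule that)
    qed
    have uG: "u \<in> carrier G" "v = H #> u"
      using u(1) g r_coset_subset_G[OF subset g(1)] repr_independence[OF _ g(1) subgroup_axioms] by auto
    obtain z where z: "z \<in> B0" "b w v = p z" using w(4) by blast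
    have zX: "z \<in> topspace X" using z(1) B0_def by simp
    \<comment> \<open>Going back from \<open>z\<close> by \<open>u\<close> ends over
      \<open>w\<close>, which is in \<open>N\<close>, hence in \<open>A0\<close>. So the short
      \<open>u\<close> leads from \<open>A0\<close> to \<open>B0\<close>, against
      \<open>far0\<close>.\<close>
    define z' where "z' = a z (inv u)"
    have z'X: "z' \<in> topspace X" unfolding z'_def using acl[OF zX] uG(1) by simp
    have wMK: "w \<in> topspace MK" using w(1) by (simp add: N_def)
    have "p z' = b (b w v) (H #> inv u)" unfolding z'_def using peq[OF zX] uG(1) z(2) by simp
    also have "\<dots> = b (b w v) (inv\<^bsub>G Mod H\<^esub> v)"
      using w(2) uG by (simp add: inv_FactGroup rcos_inv)
    also have "\<dots> = w" by (rule flow_invert(1)[OF Kfl LK.is_group wMK w(2)])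
    finally have "p z' \<in> N" using w(1) by simp
    then have "z' \<in> A0" using z'X unfolding N_def by blast
    moreover have "a z' u = z" unfolding z'_def by (rule flow_invert(2)[OF fl is_group zX uG(1)])
    ultimately show False using far0 z(1) uG(1) u(2) unfolding far_def by blast
  qed
  show ?thesis
  proof (rule metrizable_if_totally_bounded[OF X])
    fix e :: real assume e: "0 < e"
    obtain PK where PK: "finite PK" "PK \<subseteq> topspace MK" "\<And>y. y \<in> topspace MK \<Longrightarrow> \<exists>k\<in>PK. LK.near MK b (e / 2) k y"
      using LK.metrizable_imp_finite_near_net[OF K, of "e / 2"] e by (metis half_gt_zero)
    obtain PH where PH: "finite PH" "PH \<subseteq> topspace M" "\<And>y. y \<in> topspace M \<Longrightarrow> \<exists>h\<in>PH. LH.near M m (e / 2) h y"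
      using LH.metrizable_imp_finite_near_net[OF M, of "e / 2"] e by (metis half_gt_zero)
    have "\<exists>\<phi>. G_map ?H M m X a \<phi> \<and> \<phi> ` topspace M = {z \<in> topspace X. p z = k}" if k: "k \<in> PK" for k
    proof -
      obtain z where z: "z \<in> topspace X" "k = p z" using k PK(2) p(2) by (metis imageE subsetD)
      obtain \<phi> where "G_map ?H M m X a \<phi>" "orbit_closure X a H z = \<phi> ` topspace M" using orb(1)[OF z(1)] by blast
      then show ?thesis using fibre[OF z(1)] z(2) by auto
    qed
    then have "\<forall>k\<in>PK. \<exists>\<phi>. G_map ?H M m X a \<phi> \<and> \<phi> ` topspace M = {z \<in> topspace X. p z = k}"
      by (rule ballI)
    from bchoice[OF this] obtain \<phi> where
      "\<forall>k\<in>PK. G_map ?H M m X a (\<phi> k) \<and> \<phi> k ` topspace M = {z \<in> topspace X. p z = k}" by (rule exE)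
    then have \<phi>: "\<And>k. k \<in> PK \<Longrightarrow> G_map ?H M m X a (\<phi> k)"
      "\<And>k. k \<in> PK \<Longrightarrow> \<phi> k ` topspace M = {z \<in> topspace X. p z = k}" by simp_all
    define P where "P = (\<lambda>(k, h). \<phi> k h) ` (PK \<times> PH)"
    have "\<exists>q\<in>P. \<forall>f\<in>flow_lipschitz_functions X a. \<bar>f x - f q\<bar> \<le> e" if x: "x \<in> topspace X" for x
    proof -
      have "p x \<in> topspace MK" using x p(2) by blast
      then obtain k where k: "k \<in> PK" "LK.near MK b (e / 2) k (p x)" using PK(3) by blast
      then obtain z where z: "z \<in> topspace X" "p z = k" "near X a (e / 2) z x"
        using lift[OF x _ k(2)] PK(2) by blast
      then have "z \<in> \<phi> k ` topspace M" using \<phi>(2)[OF k(1)] by simp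
      then obtain w where w: "w \<in> topspace M" "z = \<phi> k w" by blast
      obtain h where h: "h \<in> PH" "LH.near M m (e / 2) h w" using PH(3)[OF w(1)] by blast
      have hM: "h \<in> topspace M" using h(1) PH(2) by blast
      \<comment> \<open>Nearness is meant for the action of \<open>H\<close>. As \<open>H\<close>
        carries the restriction of \<open>\<rho>\<close>, it bounds the same Lipschitz
        functions.\<close>
      have n2: "LH.near X a (e / 2) (\<phi> k h) z"
        unfolding w(2) by (rule LH.near_image[OF h(2) \<phi>(1)[OF k(1)] hM w(1)])
      have hX: "\<phi> k h \<in> topspace X" using \<phi>(2)[OF k(1)] hM by blast
      have "\<bar>f x - f (\<phi> k h)\<bar> \<le> e" if f: "f \<in> flow_lipschitz_functions X a" for f
      proof -
        have fc: "continuous_map X euclideanreal f"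
          and flip: "\<And>x u. x \<in> topspace X \<Longrightarrow> u \<in> carrier G \<Longrightarrow> \<bar>f (a x u) - f x\<bar> \<le> \<rho> u"
          using f by (auto simp: flow_lipschitz_functions_def)
        have "\<bar>f z - f x\<bar> \<le> e / 2" by (rule near_lipschitz[OF z(3,1) x fc flip])
        moreover have "\<bar>f (\<phi> k h) - f z\<bar> \<le> e / 2"
          by (rule LH.near_lipschitz[OF n2 hX z(1) fc]) (simp add: flip)
        ultimately show ?thesis by linarith
      qed
      moreover have "\<phi> k h \<in> P" unfolding P_def using k(1) h(1) by auto
      ultimately show ?thesis by blast
    qed
    moreover have "finite P" unfolding P_def using PK(1) PH(1) by simp
    ultimately show "\<exists>P. finite P \<and> (\<forall>x\<in>topspace X. \<exists>p\<in>P. \<forall>f\<in>flow_lipschitz_functions X a. \<bar>f x - f p\<bar> \<le> e)"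
      by blast
  qed
qed

theorem theorem1p1:
  fixes G :: "('g, 'm) monoid_scheme" and T :: "'g topology" and H :: "'g set"
    and MH :: "'a topology" and actH :: "'a \<Rightarrow> 'g \<Rightarrow> 'a"
    and MK :: "'b topology" and actK :: "'b \<Rightarrow> 'g set \<Rightarrow> 'b"
    and MG :: "'c topology" and actG :: "'c \<Rightarrow> 'g \<Rightarrow> 'c"
  assumes "Polish_group G T" and "H \<lhd> G" and "closedin T H"
    and "universal_minimal_flow (G\<lparr>carrier := H\<rparr>) (subtopology T H) MH actH"
    and "universal_minimal_flow (G Mod H) (quotient_group_topology G T H) MK actK"
    and "universal_minimal_flow G T MG actG"
    and "metrizable_space MH" and "metrizable_space MK"
  shows "metrizable_space MG \<and>
    (\<forall>p. G_map G MG actG MK (\<lambda>y g. actK y (H #>\<^bsub>G\<^esub> g)) p \<longrightarrow>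
       (\<forall>y\<in>topspace MK.
          minimal_flow (G\<lparr>carrier := H\<rparr>) (subtopology T H)
            (subtopology MG {x \<in> topspace MG. p x = y}) actG))"
proof (intro conjI allI impI ballI)
  have TG: "topological_group G T" and "completely_metrizable_space T"
    using assms(1) by (auto simp: Polish_group_def)
  then have "first_countable T"
    by (intro metrizable_imp_first_countable completely_metrizable_imp_metrizable_space)
  then obtain \<rho> where \<rho>: "length_group G T \<rho>" using Birkhoff_Kakutani[OF TG] by blast
  show "metrizable_space MG"
    by (rule extension_metrizable[OF \<rho> assms(2,4,7,5,8,6)])
  fix p y assume p: "G_map G MG actG MK (\<lambda>y g. actK y (H #>\<^bsub>G\<^esub> g)) p" and y: "y \<in> topspace MK"
  have T: "topspace T = carrier G" using TG by (simp add: topological_group_def)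
  have min: "minimal_flow G T MG actG" and Kmin: "minimal_flow (G Mod H) (quotient_group_topology G T H) MK actK"
    using assms(5,6) by (auto simp: universal_minimal_flow_def)
  then have "flow G T MG actG" "topspace MG \<noteq> {}" by (auto simp: minimal_flow_def)
  \<comment> \<open>Minimality of \<open>MK\<close> makes any \<open>p\<close> onto. Each fibre is
    therefore nonempty and is the \<open>H\<close>-orbit closure of one of its points.\<close>
  then have "p ` topspace MG = topspace MK"
    using G_map_onto_minimal[OF _ minimal_flow_of_quotient[OF T assms(2) Kmin] p _ T] by blast
  then obtain x where x: "x \<in> topspace MG" "y = p x" using y by blast
  have "{z \<in> topspace MG. p z = y} = orbit_closure MG actG H x"
    unfolding x(2) by (rule quotient_map_fibres[OF \<rho> assms(2,4,7) min assms(5) p x(1)])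
  then show "minimal_flow (G\<lparr>carrier := H\<rparr>) (subtopology T H)
            (subtopology MG {z \<in> topspace MG. p z = y}) actG"
    using normal_orbit_closures(2)[OF \<rho> assms(2,4,7) min x(1)] by simp
qed


end
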